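(* (i) Assume that for every $n\in\mathbb{N}$ there exists an even density $f_n:\mathbb{R}^n\to\mathbb{R}$, whose restriction to any subspace of $\mathbb{R}^n$ is integrable, with the following property: for all $T\in GL_n$ and all diagonal $n\times n$ matrices $A$, the function $$\mathbb{R}\ni t\mapsto\int_{e^{At}C_n}f_n(Tx)\,dx$$ is log-concave. Then, for all $n\in\mathbb{N}$, the log-Brunn-Minkowski inequality holds for all even log-concave densities $g:\mathbb{R}^n\to\mathbb{R}$. (ii) Assume that for every $n\in\mathbb{N}$ there exists an even density $f_n:\mathbb{R}^n\to\mathbb{R}$, whose restriction to any subspace of $\mathbb{R}^n$ is integrable, with the following property: for any two origin-symmetric parallelepipeds $P_1,P_2$ in $\mathbb{R}^n$ with parallel facets and any $\lambda\in(0,1)$, $$\int_{\lambda\cdot P_1+_0(1-\lambda)\cdot P_2}f_n\,dx\ \ge\ \Big[\int_{P_1}f_n\,dx\Big]^{\lambda}\Big[\int_{P_2}f_n\,dx\Big]^{1-\lambda}.$$ Then, for all $n\in\mathbb{N}$, the log-Brunn-Minkowski inequality holds for all even log-concave densities $g:\mathbb{R}^n\to\mathbb{R}$. (iii) Fix $n\in\mathbb{N}$. If the log-Brunn-Minkowski inequality holds for some density $f:\mathbb{R}^n\to\mathbb{R}$, then for all $T\in GL_n$ and all diagonal $n\times n$ matrices $A$, the function $$\mathbb{R}\ni t\mapsto\int_{e^{At}C_n}f(Tx)\,dx$$ is log-concave.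
   Context: A convex body in $\mathbb{R}^n$ is a compact convex set with non-empty interior; it is symmetric if $K=-K$. $C_n=[-1,1]^n$; matrices are real and $GL_n$ is the group of invertible linear maps of $\mathbb{R}^n$. A density on $\mathbb{R}^n$ is a non-negative measurable function that is not almost everywhere zero; it is even if $f(-x)=f(x)$. The support function is $h_K(u)=\max_{y\in K}u\cdot y$. For convex bodies $K,L$ containing the origin in their interiors and $\lambda\in(0,1)$, $$\lambda\cdot K+_0(1-\lambda)\cdot L=\{x\in\mathbb{R}^n : x\cdot u\le h_K(u)^{\lambda}h_L(u)^{1-\lambda}\ \text{for all } u\in S^{n-1}\}.$$ The log-Brunn-Minkowski inequality holds for a density $f$ on $\mathbb{R}^n$ if for all symmetric convex bodies $K,L$ in $\mathbb{R}^n$ and all $\lambda\in(0,1)$, $$\int_{\lambda\cdot K+_0(1-\lambda)\cdot L}f\,dx\ \ge\ \Big[\int_Kf\,dx\Big]^{\lambda}\Big[\int_Lf\,dx\Big]^{1-\lambda}.$$ "Parallel facets" means that the two parallelepipeds have the same facet normals. A non-negative function is log-concave if its logarithm (with values in $[-\infty,\infty)$) is concave. *)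

theory Defs
  imports "HOL-Analysis.Analysis" "HOL-Library.Function_Algebras"
begin

text \<open>
  The statement quantifies over the dimension inside its hypotheses, so \<open>\<real>\<^sup>n\<close> is the carrier of
  the library's \<^const>\<open>Euclidean_space\<close>, i.e. the sequences \<open>nat \<Rightarrow> real\<close> that vanish from index
  \<open>n\<close> on. With the pointwise linear structure on functions this is a linear subspace of
  \<open>nat \<Rightarrow> real\<close>, so that \<^const>\<open>linear\<close>, \<^const>\<open>convex\<close>, \<^const>\<open>span\<close> and \<^const>\<open>dim\<close> of the
  library apply. A function on \<open>\<real>\<^sup>n\<close> is a total function of which only the values on \<open>Rn n\<close>
  matter.
\<close>

instantiation "fun" :: (type, real_vector) real_vector
begin

definition scaleR_fun :: "real \<Rightarrow> ('a \<Rightarrow> 'b) \<Rightarrow> 'a \<Rightarrow> 'b" where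
  "scaleR_fun c f = (\<lambda>x. c *\<^sub>R f x)"

instance
  by standard (simp_all add: fun_eq_iff scaleR_fun_def scaleR_add_right scaleR_add_left)

end

lemma scaleR_fun_apply [simp]: "(c *\<^sub>R f) x = c *\<^sub>R f x"
  by (simp add: scaleR_fun_def)

definition Rn :: "nat \<Rightarrow> (nat \<Rightarrow> real) set" where
  "Rn n = topspace (Euclidean_space n)"

lemma Rn_eq: "Rn n = {x. \<forall>i\<ge>n. x i = 0}"
  by (simp add: Rn_def topspace_Euclidean_space)

lemma subspace_Rn: "subspace (Rn n)"
  by (auto simp: subspace_def Rn_eq)

definition dot :: "nat \<Rightarrow> (nat \<Rightarrow> real) \<Rightarrow> (nat \<Rightarrow> real) \<Rightarrow> real" where
  "dot n x y = (\<Sum>i<n. x i * y i)"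

definition unit_sphere :: "nat \<Rightarrow> (nat \<Rightarrow> real) set" where
  "unit_sphere n = {u \<in> Rn n. dot n u u = 1}"

definition cube :: "nat \<Rightarrow> (nat \<Rightarrow> real) set" where
  "cube n = {x \<in> Rn n. \<forall>i<n. \<bar>x i\<bar> \<le> 1}"


subsection \<open>Lebesgue measure\<close>

text \<open>
  The completion makes this Lebesgue rather than Borel measure: a log-concave function need not be
  Borel measurable.
\<close>

definition extend_by_zero :: "nat \<Rightarrow> (nat \<Rightarrow> real) \<Rightarrow> nat \<Rightarrow> real" where
  "extend_by_zero n x = (\<lambda>i. if i < n then x i else 0)"

definition leb :: "nat \<Rightarrow> (nat \<Rightarrow> real) measure" where
  "leb n = completion
     (distr (PiM {..<n} (\<lambda>_. lborel)) (restrict_space borel (Rn n)) (extend_by_zero n))"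

lemma measurable_extend_by_zero [measurable]:
  "extend_by_zero n \<in> PiM {..<n} (\<lambda>_. lborel) \<rightarrow>\<^sub>M restrict_space borel (Rn n)"
proof (rule measurable_restrict_space2)
  show "extend_by_zero n \<in> space (PiM {..<n} (\<lambda>_. lborel)) \<rightarrow> Rn n"
    by (auto simp: extend_by_zero_def Rn_eq)
  have "(\<lambda>x. extend_by_zero n x i) \<in> borel_measurable (PiM {..<n} (\<lambda>_. lborel))" for i
  proof (cases "i < n")
    case True
    have "(\<lambda>x. x i) \<in> PiM {..<n} (\<lambda>_. lborel) \<rightarrow>\<^sub>M lborel"
      by (rule measurable_component_singleton) (use True in simp)
    then show ?thesis using True by (simp add: extend_by_zero_def)
  qed (simp add: extend_by_zero_def)
  then show "extend_by_zero n \<in> borel_measurable (PiM {..<n} (\<lambda>_. lborel))"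
    by (rule measurable_coordinatewise_then_product)
qed

lemma space_leb [simp]: "space (leb n) = Rn n"
  by (simp add: leb_def space_restrict_space)

lemma emeasure_leb_box:
  assumes "\<And>i. i < n \<Longrightarrow> a i \<le> b i"
  shows "emeasure (leb n) {x \<in> Rn n. \<forall>i<n. x i \<in> {a i..b i}} = ennreal (\<Prod>i<n. b i - a i)"
proof -
  interpret product_sigma_finite "\<lambda>_::nat. lborel :: real measure"
    by (simp add: product_sigma_finite_def sigma_finite_lborel)
  let ?S = "{x \<in> Rn n. \<forall>i<n. x i \<in> {a i..b i}}"
  have "closed {x :: nat \<Rightarrow> real. \<forall>i<n. x i \<in> {a i..b i}}"
  proof -
    have "{x :: nat \<Rightarrow> real. \<forall>i<n. x i \<in> {a i..b i}} = (\<Inter>i\<in>{..<n}. (\<lambda>x. x i) -` {a i..b i})"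
      by auto
    moreover have "closed ((\<lambda>x :: nat \<Rightarrow> real. x i) -` {a i..b i})" for i
      by (rule closed_vimage[OF closed_atLeastAtMost continuous_on_product_coordinates])
    ultimately show ?thesis by (simp only:) (rule closed_INT, simp)
  qed
  then have "{x :: nat \<Rightarrow> real. \<forall>i<n. x i \<in> {a i..b i}} \<in> sets borel" by simp
  then have "Rn n \<inter> {x. \<forall>i<n. x i \<in> {a i..b i}} \<in> sets (restrict_space borel (Rn n))"
    unfolding sets_restrict_space by (rule imageI)
  then have S: "?S \<in> sets (restrict_space borel (Rn n))"
    by (simp only: Collect_conj_eq Collect_mem_eq)
  have "extend_by_zero n -` ?S \<inter> space (PiM {..<n} (\<lambda>_. lborel)) = PiE {..<n} (\<lambda>i. {a i..b i})"
  proof (rule set_eqI)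
    fix x
    have "extend_by_zero n x \<in> Rn n" by (simp add: extend_by_zero_def Rn_eq)
    moreover have "(\<forall>i<n. extend_by_zero n x i \<in> {a i..b i}) \<longleftrightarrow> (\<forall>i<n. x i \<in> {a i..b i})"
      by (simp add: extend_by_zero_def)
    ultimately show "x \<in> extend_by_zero n -` ?S \<inter> space (PiM {..<n} (\<lambda>_. lborel)) \<longleftrightarrow>
        x \<in> PiE {..<n} (\<lambda>i. {a i..b i})"
      by (simp add: space_PiM PiE_iff) blast
  qed
  moreover have "emeasure (leb n) ?S =
      emeasure (distr (PiM {..<n} (\<lambda>_. lborel)) (restrict_space borel (Rn n)) (extend_by_zero n)) ?S"
    unfolding leb_def using S
    by (simp only: emeasure_completion sets_distr sets_completionI_sets main_part)
  ultimately have "emeasure (leb n) ?S =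
      emeasure (PiM {..<n} (\<lambda>_. lborel)) (PiE {..<n} (\<lambda>i. {a i..b i}))"
    by (simp only: emeasure_distr[OF measurable_extend_by_zero S])
  also have "\<dots> = (\<Prod>i<n. emeasure lborel {a i..b i})"
    by (rule emeasure_PiM) auto
  also have "\<dots> = ennreal (\<Prod>i<n. b i - a i)"
    using assms by (subst prod_ennreal[symmetric]) auto
  finally show ?thesis .
qed

definition density_fun :: "nat \<Rightarrow> ((nat \<Rightarrow> real) \<Rightarrow> real) \<Rightarrow> bool" where
  "density_fun n f \<longleftrightarrow> f \<in> borel_measurable (leb n) \<and> (\<forall>x\<in>Rn n. 0 \<le> f x) \<and>
     \<not> (AE x in leb n. f x = 0)"

definition even_fun :: "nat \<Rightarrow> ((nat \<Rightarrow> real) \<Rightarrow> real) \<Rightarrow> bool" where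
  "even_fun n f \<longleftrightarrow> (\<forall>x\<in>Rn n. f (- x) = f x)"

definition orthonormal :: "nat \<Rightarrow> nat \<Rightarrow> (nat \<Rightarrow> nat \<Rightarrow> real) \<Rightarrow> bool" where
  "orthonormal n k v \<longleftrightarrow> (\<forall>i<k. v i \<in> Rn n) \<and>
     (\<forall>i<k. \<forall>j<k. dot n (v i) (v j) = (if i = j then 1 else 0))"

text \<open>
  Integration over a \<open>k\<close>-dimensional linear subspace is with respect to its own \<open>k\<close>-dimensional
  Lebesgue measure, the image of \<open>leb k\<close> under the isometry given by an orthonormal basis.
\<close>

definition integrable_on_subspace :: "nat \<Rightarrow> ((nat \<Rightarrow> real) \<Rightarrow> real) \<Rightarrow> (nat \<Rightarrow> real) set \<Rightarrow> bool" where
  "integrable_on_subspace n f H \<longleftrightarrow>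
     (\<forall>k v. orthonormal n k v \<and> span (v ` {..<k}) = H \<longrightarrow>
        integrable (leb k) (\<lambda>y. f (\<Sum>i<k. y i *\<^sub>R v i)))"

definition integrable_on_all_subspaces :: "nat \<Rightarrow> ((nat \<Rightarrow> real) \<Rightarrow> real) \<Rightarrow> bool" where
  "integrable_on_all_subspaces n f \<longleftrightarrow>
     (\<forall>H. subspace H \<and> H \<subseteq> Rn n \<longrightarrow> integrable_on_subspace n f H)"

text \<open>
  A density need not be locally integrable, so integrals take values in \<open>[0,\<infinity>]\<close>.
\<close>

definition int_over :: "nat \<Rightarrow> ((nat \<Rightarrow> real) \<Rightarrow> real) \<Rightarrow> (nat \<Rightarrow> real) set \<Rightarrow> ennreal" where
  "int_over n f K = (\<integral>\<^sup>+x\<in>K. ennreal (f x) \<partial>leb n)"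


subsection \<open>Powers and log-concavity in \<open>[0,\<infinity>]\<close>\<close>

definition ennpow :: "ennreal \<Rightarrow> real \<Rightarrow> ennreal" where
  "ennpow x p = (if x = \<infinity> then \<infinity> else ennreal (enn2real x powr p))"

definition elog :: "ennreal \<Rightarrow> ereal" where
  "elog x = (if x = 0 then -\<infinity> else if x = \<infinity> then \<infinity> else ereal (ln (enn2real x)))"

text \<open>
  The inequality is void where the logarithm is \<open>-\<infinity>\<close> at an endpoint. For finite-valued functions
  this is the usual concavity with values in \<open>[-\<infinity>,\<infinity>)\<close>; for functions that also take the value
  \<open>\<infinity>\<close> it reads \<open>-\<infinity> + \<infinity>\<close> as \<open>-\<infinity>\<close> (unlike \<^typ>\<open>ereal\<close>), in agreement with \<open>0 * \<infinity> = 0\<close>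
  in \<^typ>\<open>ennreal\<close>.
\<close>

definition log_concave_on :: "'a::real_vector set \<Rightarrow> ('a \<Rightarrow> ennreal) \<Rightarrow> bool" where
  "log_concave_on S f \<longleftrightarrow> convex S \<and>
     (\<forall>x\<in>S. \<forall>y\<in>S. \<forall>c. 0 < c \<and> c < 1 \<and> elog (f x) \<noteq> -\<infinity> \<and> elog (f y) \<noteq> -\<infinity> \<longrightarrow>
        ereal c * elog (f x) + ereal (1 - c) * elog (f y) \<le> elog (f (c *\<^sub>R x + (1 - c) *\<^sub>R y)))"


subsection \<open>Convex bodies and the log-Brunn-Minkowski inequality\<close>

definition convex_body :: "nat \<Rightarrow> (nat \<Rightarrow> real) set \<Rightarrow> bool" where
  "convex_body n K \<longleftrightarrow> compactin (Euclidean_space n) K \<and> convex K \<and>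
     Euclidean_space n interior_of K \<noteq> {}"

definition symmetric_set :: "(nat \<Rightarrow> real) set \<Rightarrow> bool" where
  "symmetric_set K \<longleftrightarrow> K = uminus ` K"

definition support_fun :: "nat \<Rightarrow> (nat \<Rightarrow> real) set \<Rightarrow> (nat \<Rightarrow> real) \<Rightarrow> real" where
  "support_fun n K u = (SUP y\<in>K. dot n u y)"

definition log_comb :: "nat \<Rightarrow> real \<Rightarrow> (nat \<Rightarrow> real) set \<Rightarrow> (nat \<Rightarrow> real) set \<Rightarrow> (nat \<Rightarrow> real) set" where
  "log_comb n c K L = {x \<in> Rn n. \<forall>u\<in>unit_sphere n.
     dot n x u \<le> support_fun n K u powr c * support_fun n L u powr (1 - c)}"

definition log_BM_for ::
  "nat \<Rightarrow> ((nat \<Rightarrow> real) \<Rightarrow> real) \<Rightarrow> real \<Rightarrow> (nat \<Rightarrow> real) set \<Rightarrow> (nat \<Rightarrow> real) set \<Rightarrow> bool" where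
  "log_BM_for n f c K L \<longleftrightarrow>
     int_over n f (log_comb n c K L) \<ge> ennpow (int_over n f K) c * ennpow (int_over n f L) (1 - c)"

definition log_BM :: "nat \<Rightarrow> ((nat \<Rightarrow> real) \<Rightarrow> real) \<Rightarrow> bool" where
  "log_BM n f \<longleftrightarrow>
     (\<forall>K L c. convex_body n K \<and> symmetric_set K \<and> convex_body n L \<and> symmetric_set L \<and>
        0 < c \<and> c < 1 \<longrightarrow> log_BM_for n f c K L)"


subsection \<open>Linear maps and diagonal exponentials\<close>

text \<open>
  Matrices are identified with linear maps. A linear map of \<open>\<real>\<^sup>n\<close> is represented by a linear map
  of the ambient sequence space; its values outside \<open>Rn n\<close> are irrelevant.
\<close>

definition GL :: "nat \<Rightarrow> ((nat \<Rightarrow> real) \<Rightarrow> nat \<Rightarrow> real) set" where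
  "GL n = {T. linear T \<and> bij_betw T (Rn n) (Rn n)}"

definition diag_map :: "(nat \<Rightarrow> real) \<Rightarrow> (nat \<Rightarrow> real) \<Rightarrow> nat \<Rightarrow> real" where
  "diag_map a x = (\<lambda>i. a i * x i)"

definition exp_map :: "((nat \<Rightarrow> real) \<Rightarrow> nat \<Rightarrow> real) \<Rightarrow> (nat \<Rightarrow> real) \<Rightarrow> nat \<Rightarrow> real" where
  "exp_map B x = (\<Sum>k. (B ^^ k) x /\<^sub>R fact k)"

lemma sums_fun_iff:
  fixes f :: "nat \<Rightarrow> 'a \<Rightarrow> real"
  shows "f sums s \<longleftrightarrow> (\<forall>i. (\<lambda>k. f k i) sums s i)"
proof -
  have "(\<Sum>k<m. f k) i = (\<Sum>k<m. f k i)" for m i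
    by (induction m) auto
  then show ?thesis
    unfolding sums_def
    using limitin_componentwise[of "\<lambda>_. euclidean" UNIV "\<lambda>m. \<Sum>k<m. f k" s sequentially]
    by (simp add: euclidean_product_topology)
qed

lemma exp_map_diag: "exp_map (\<lambda>x. t *\<^sub>R diag_map a x) = diag_map (\<lambda>i. exp (t * a i))"
proof
  fix x
  have *: "((\<lambda>x. t *\<^sub>R diag_map a x) ^^ k) x = (\<lambda>i. (t * a i) ^ k * x i)" for k
    by (induction k) (auto simp: diag_map_def fun_eq_iff)
  have "(\<lambda>k. ((\<lambda>i. (t * a i) ^ k * x i) /\<^sub>R fact k) i) sums (exp (t * a i) * x i)" for i
    using sums_mult2[OF exp_converges[of "t * a i"], of "x i"] by (simp add: mult.assoc)
  then have "(\<lambda>k. ((\<lambda>x. t *\<^sub>R diag_map a x) ^^ k) x /\<^sub>R fact k) sums diag_map (\<lambda>i. exp (t * a i)) x"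
    unfolding sums_fun_iff * by (simp add: diag_map_def)
  then show "exp_map (\<lambda>x. t *\<^sub>R diag_map a x) x = diag_map (\<lambda>i. exp (t * a i)) x"
    unfolding exp_map_def by (rule sums_unique[symmetric])
qed

definition diag_log_concave :: "nat \<Rightarrow> ((nat \<Rightarrow> real) \<Rightarrow> real) \<Rightarrow> bool" where
  "diag_log_concave n f \<longleftrightarrow>
     (\<forall>T\<in>GL n. \<forall>a. log_concave_on UNIV
        (\<lambda>t::real. int_over n (\<lambda>x. f (T x)) (exp_map (\<lambda>x. t *\<^sub>R diag_map a x) ` cube n)))"


subsection \<open>Parallelepipeds\<close>

definition parallelepiped :: "nat \<Rightarrow> (nat \<Rightarrow> real) set \<Rightarrow> bool" where
  "parallelepiped n P \<longleftrightarrow> (\<exists>p\<in>Rn n. \<exists>T\<in>GL n. P = (\<lambda>x. p + T x) ` cube n)"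

definition exposed_face :: "nat \<Rightarrow> (nat \<Rightarrow> real) set \<Rightarrow> (nat \<Rightarrow> real) \<Rightarrow> (nat \<Rightarrow> real) set" where
  "exposed_face n P u = {x \<in> P. dot n x u = support_fun n P u}"

text \<open>
  A facet is a face whose direction space has dimension \<open>n - 1\<close>.
\<close>

definition facet_normals :: "nat \<Rightarrow> (nat \<Rightarrow> real) set \<Rightarrow> (nat \<Rightarrow> real) set" where
  "facet_normals n P = {u \<in> unit_sphere n.
     dim {x - y |x y. x \<in> exposed_face n P u \<and> y \<in> exposed_face n P u} = n - 1}"

definition parallel_facets :: "nat \<Rightarrow> (nat \<Rightarrow> real) set \<Rightarrow> (nat \<Rightarrow> real) set \<Rightarrow> bool" where
  "parallel_facets n P Q \<longleftrightarrow> facet_normals n P = facet_normals n Q"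

definition log_BM_parallelepipeds :: "nat \<Rightarrow> ((nat \<Rightarrow> real) \<Rightarrow> real) \<Rightarrow> bool" where
  "log_BM_parallelepipeds n f \<longleftrightarrow>
     (\<forall>P Q c. parallelepiped n P \<and> symmetric_set P \<and> parallelepiped n Q \<and> symmetric_set Q \<and>
        parallel_facets n P Q \<and> 0 < c \<and> c < 1 \<longrightarrow> log_BM_for n f c P Q)"

end

theory Submission
  imports Defs
begin

text \<open>
  Let \<open>f\<close> be a density on \<open>\<real>\<^sup>N\<close> satisfying the inequality for linear images of boxes, write
  \<open>\<real>\<^sup>N = \<real>\<^sup>M \<times> \<real>\<^sup>d\<close> with points \<open>(z, x)\<close>, and let \<open>K\<^sub>\<alpha> = {x. \<bar>u\<^sub>i \<bullet> x\<bar> \<le> \<alpha>\<^sub>i}\<close> be an intersection of slabs in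
  \<open>\<real>\<^sup>d\<close>. Degenerating shears of boxes shows that the mass \<open>G(\<alpha>, R)\<close> of the tube
  \<open>{x - z\<^sub>0 m \<in> K\<^sub>\<alpha>, \<bar>z\<^sub>0\<bar> \<le> R}\<close> is log-concave in \<open>(ln \<alpha>, ln R)\<close>. For almost every \<open>m\<close>, the part of the tube of
  width \<open>r\<close> with \<open>R < \<bar>z\<^sub>0\<bar>\<close> has mass asymptotic to \<open>r\<^sup>d vol(K\<^sub>\<alpha>)\<close> times a fibre integral of \<open>f\<close>; the fibre
  integral over all of \<open>z\<close> is finite because \<open>f\<close> is integrable on subspaces. An increasing
  concave function on \<open>\<real>\<close> that is bounded below is constant, so \<open>ln (G(r \<alpha>, R) / r\<^sup>d)\<close> becomes, as \<open>r\<close>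
  tends to \<open>0\<close>, a function of \<open>ln R\<close> that is unbounded below. Hence a possible singularity of \<open>f\<close> at
  the origin does not contribute, and what remains is the inequality for the volumes of the \<open>K\<^sub>\<alpha>\<close>.

  Log-combinations are decreasing limits of such intersections of slabs. Applied to superlevel sets
  of an even log-concave \<open>g\<close> inside \<open>K\<close> and \<open>L\<close>, this combines with the Prekopa-Leindler inequality in the
  (exponential) level parameter to the inequality for \<open>g\<close>.
\<close>

subsection \<open>Product Lebesgue measure\<close>

text \<open>All boxes are centred at the origin, so every tube contains the place where
  \<open>f\<close> may be singular, and cutting it out is no option: log-concavity concerns whole
  masses, not differences. Only the increments of \<open>G\<close> in \<open>R\<close> are under
  control. The way out is that \<open>R\<close> ranges over arbitrarily small scales; concavity in
  ln R over a long interval bounds the uncontrolled inner mass by the increments alone. Two further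
  points fix the shape. A linear image of a box has only as many facet pairs as dimensions, so each
  slab normal gets an auxiliary coordinate; the dimension \<open>N = Suc p + d\<close> grows with
  the number of slabs, and the hypothesis is used in unboundedly many dimensions. And a single fibre
  may be a null set, on which a Borel representative need not agree with \<open>f\<close> and
  convergence in mean says nothing; hence the slope \<open>m\<close> is generic, and r tends to 0
  along a sequence fixed before \<open>m\<close>. No determinant is computed: a factor common to all
  integrals cancels in the inequality.\<close>

definition lam :: "nat \<Rightarrow> (nat \<Rightarrow> real) measure" where
  "lam n = distr (PiM {..<n} (\<lambda>_. lborel)) borel (extend_by_zero n)"

interpretation lborel_prod: product_sigma_finite "\<lambda>_::nat. lborel :: real measure"
  by (simp add: product_sigma_finite_def sigma_finite_lborel)

lemma space_lam [simp]: "space (lam n) = UNIV" and sets_lam [simp, measurable_cong]: "sets (lam n) = sets borel"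
  by (auto simp: lam_def)

lemma measurable_coord [measurable]: "(\<lambda>x::nat \<Rightarrow> real. x i) \<in> borel_measurable borel"
  by (intro borel_measurable_continuous_onI continuous_on_product_coordinates)

lemma extend_by_zero_in_Rn [simp]: "extend_by_zero n x \<in> Rn n"
  by (simp add: extend_by_zero_def Rn_eq)

lemma measurable_extend_by_zero_borel [measurable]:
  "extend_by_zero n \<in> PiM {..<n} (\<lambda>_. lborel) \<rightarrow>\<^sub>M borel"
  using measurable_extend_by_zero measurable_restrict_space2_iff by blast

lemma Rn_Int: "Rn n = (\<Inter>i\<in>{n..}. (\<lambda>x. x i) -` {0})"
  by (auto simp: Rn_eq)

lemma closed_Rn: "closed (Rn n)"
  unfolding Rn_Int
  by (intro closed_INT ballI closed_vimage[OF closed_singleton continuous_on_product_coordinates])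

lemma Rn_borel [measurable]: "Rn n \<in> sets borel"
  using closed_Rn by simp

lemma Rn_add: "x \<in> Rn n \<Longrightarrow> y \<in> Rn n \<Longrightarrow> x + y \<in> Rn n"
  and Rn_diff: "x \<in> Rn n \<Longrightarrow> y \<in> Rn n \<Longrightarrow> x - y \<in> Rn n"
  and Rn_scale: "x \<in> Rn n \<Longrightarrow> c *\<^sub>R x \<in> Rn n"
  and Rn_uminus: "x \<in> Rn n \<Longrightarrow> - x \<in> Rn n"
  and Rn_0: "0 \<in> Rn n"
  by (auto simp: Rn_eq)

text \<open>\<open>lam\<close> lives on the whole sequence space, so that Borel measurability never
  involves a restricted space. The price is that membership in \<open>Rn n\<close> is only an almost
  everywhere fact, which is fed into most pointwise arguments below.\<close>

lemma AE_lam_Rn: "AE x in lam n. x \<in> Rn n"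
  unfolding lam_def by (subst AE_distr_iff) auto

lemma measurable_funI:
  fixes f :: "'a \<Rightarrow> nat \<Rightarrow> real"
  shows "(\<And>i. (\<lambda>x. f x i) \<in> borel_measurable M) \<Longrightarrow> f \<in> borel_measurable M"
  by (rule measurable_coordinatewise_then_product)

lemma measurable_fun_coord:
  fixes f :: "'a \<Rightarrow> nat \<Rightarrow> real"
  shows "f \<in> borel_measurable M \<Longrightarrow> (\<lambda>x. f x i) \<in> borel_measurable M"
  by (rule measurable_compose[OF _ measurable_coord])

lemma borel_measurable_fun_add [measurable (raw)]:
  fixes f g :: "'a \<Rightarrow> nat \<Rightarrow> real"
  assumes "f \<in> borel_measurable M" "g \<in> borel_measurable M"
  shows "(\<lambda>x. f x + g x) \<in> borel_measurable M"
  using assms[THEN measurable_fun_coord] by (intro measurable_funI) simp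

lemma borel_measurable_fun_diff [measurable (raw)]:
  fixes f g :: "'a \<Rightarrow> nat \<Rightarrow> real"
  assumes "f \<in> borel_measurable M" "g \<in> borel_measurable M"
  shows "(\<lambda>x. f x - g x) \<in> borel_measurable M"
  using assms[THEN measurable_fun_coord] by (intro measurable_funI) simp

lemma borel_measurable_fun_uminus [measurable (raw)]:
  fixes f :: "'a \<Rightarrow> nat \<Rightarrow> real"
  assumes "f \<in> borel_measurable M"
  shows "(\<lambda>x. - f x) \<in> borel_measurable M"
  using assms[THEN measurable_fun_coord] by (intro measurable_funI) simp

lemma borel_measurable_fun_scaleR [measurable (raw)]:
  fixes f :: "'a \<Rightarrow> nat \<Rightarrow> real"
  assumes "c \<in> borel_measurable M" "f \<in> borel_measurable M"
  shows "(\<lambda>x. c x *\<^sub>R f x) \<in> borel_measurable M"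
  using assms(1) assms(2)[THEN measurable_fun_coord] by (intro measurable_funI) simp

section \<open>Invariance of \<open>lam\<close> and uniqueness of translation-invariant
  measures\<close>

lemma lam_coordinatewise_invariant:
  assumes \<phi>: "\<And>i. i < n \<Longrightarrow> distr lborel borel (\<phi> i) = lborel"
    and m: "\<And>i. i < n \<Longrightarrow> \<phi> i \<in> borel_measurable borel"
    and g: "\<And>x. g (extend_by_zero n x) = extend_by_zero n (\<lambda>i. \<phi> i (x i))"
    and gm: "g \<in> borel_measurable borel"
  shows "distr (lam n) borel g = lam n"
proof -
  let ?P = "PiM {..<n} (\<lambda>_. lborel :: real measure)"
  define \<tau> where "\<tau> = (\<lambda>x. \<lambda>i\<in>{..<n}. \<phi> i (x i :: real) :: real)"
  have [measurable]: "\<tau> \<in> ?P \<rightarrow>\<^sub>M ?P"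
    unfolding \<tau>_def
    by (intro measurable_restrict measurable_compose[OF measurable_component_singleton]) (auto simp: m)
  have "distr ?P ?P \<tau> = ?P"
  proof (rule lborel_prod.PiM_eqI)
    fix A :: "nat \<Rightarrow> real set" assume A: "\<And>i. i \<in> {..<n} \<Longrightarrow> A i \<in> sets lborel"
    then have A': "\<And>i. i < n \<Longrightarrow> A i \<in> sets borel" by auto
    have B: "\<phi> i -` A i \<in> sets borel" if "i < n" for i
      using measurable_sets_borel[OF m[OF that] A'[OF that]] .
    have "emeasure (distr ?P ?P \<tau>) (PiE {..<n} A) = emeasure ?P (\<tau> -` PiE {..<n} A \<inter> space ?P)"
      by (rule emeasure_distr) (use A' in \<open>auto intro!: sets_PiM_I_finite\<close>)
    also have "\<tau> -` PiE {..<n} A \<inter> space ?P = PiE {..<n} (\<lambda>i. \<phi> i -` A i)"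
      by (auto simp: space_PiM PiE_iff \<tau>_def)
    also have "emeasure ?P \<dots> = (\<Prod>i<n. emeasure lborel (\<phi> i -` A i))"
      using B by (intro lborel_prod.emeasure_PiM) auto
    also have "\<dots> = (\<Prod>i<n. emeasure lborel (A i))"
    proof (rule prod.cong)
      fix i assume "i \<in> {..<n}"
      then have i: "i < n" by simp
      have "emeasure lborel (A i) = emeasure (distr lborel borel (\<phi> i)) (A i)"
        by (simp add: \<phi>[OF i])
      also have "\<dots> = emeasure lborel (\<phi> i -` A i)"
        using m[OF i] A'[OF i] by (subst emeasure_distr) auto
      finally show "emeasure lborel (\<phi> i -` A i) = emeasure lborel (A i)" by simp
    qed simp
    finally show "emeasure (distr ?P ?P \<tau>) (PiE {..<n} A) = (\<Prod>i<n. emeasure lborel (A i))" .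
  qed auto
  then have "lam n = distr (distr ?P ?P \<tau>) borel (extend_by_zero n)"
    by (simp add: lam_def)
  also have "\<dots> = distr ?P borel (\<lambda>x. extend_by_zero n (\<tau> x))"
    by (subst distr_distr) (auto simp: comp_def)
  also have "\<dots> = distr ?P borel (\<lambda>x. g (extend_by_zero n x))"
    by (intro arg_cong[where f="distr ?P borel"] ext) (simp only: g, simp add: \<tau>_def extend_by_zero_def fun_eq_iff)
  also have "\<dots> = distr (lam n) borel g"
    unfolding lam_def using gm by (subst distr_distr) (auto simp: comp_def)
  finally show ?thesis ..
qed

lemma lam_translate:
  assumes "v \<in> Rn n" shows "distr (lam n) borel (\<lambda>x. x + v) = lam n"
proof (rule lam_coordinatewise_invariant)
  show "distr lborel borel (\<lambda>t. t + v i) = lborel" for i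
    using lborel_distr_plus[of "v i"] by (simp add: add.commute[of _ "v i"] cong: distr_cong)
qed (use assms in \<open>auto simp: extend_by_zero_def Rn_eq fun_eq_iff\<close>)

lemma lam_reflect: "distr (lam n) borel (\<lambda>x. - x) = lam n"
proof (rule lam_coordinatewise_invariant)
  show "distr lborel borel (\<lambda>t. - t :: real) = lborel" for i
    using lborel_distr_uminus .
qed (auto simp: extend_by_zero_def fun_eq_iff)

lemma nn_integral_lam_translate:
  assumes "v \<in> Rn n" and [measurable]: "f \<in> borel_measurable borel"
  shows "(\<integral>\<^sup>+x. f (x + v) \<partial>lam n) = (\<integral>\<^sup>+x. f x \<partial>lam n)"
  by (subst (2) lam_translate[OF assms(1), symmetric], subst nn_integral_distr) auto

lemma nn_integral_lam_reflect:
  assumes [measurable]: "f \<in> borel_measurable borel"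
  shows "(\<integral>\<^sup>+x. f (- x) \<partial>lam n) = (\<integral>\<^sup>+x. f x \<partial>lam n)"
  by (subst (2) lam_reflect[symmetric], subst nn_integral_distr) auto

definition symbox :: "nat \<Rightarrow> (nat \<Rightarrow> real) \<Rightarrow> (nat \<Rightarrow> real) set" where
  "symbox n a = {x \<in> Rn n. \<forall>i<n. \<bar>x i\<bar> \<le> a i}"

lemma symbox_borel [measurable]: "symbox n a \<in> sets borel"
  unfolding symbox_def by measurable

lemma emeasure_lam:
  assumes "A \<in> sets borel"
  shows "emeasure (lam n) A = emeasure (PiM {..<n} (\<lambda>_. lborel)) (extend_by_zero n -` A \<inter> space (PiM {..<n} (\<lambda>_. lborel)))"
  unfolding lam_def using assms by (rule emeasure_distr[OF measurable_extend_by_zero_borel])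

lemma emeasure_lam_symbox:
  assumes "\<And>i. i < n \<Longrightarrow> 0 \<le> a i"
  shows "emeasure (lam n) (symbox n a) = ennreal (\<Prod>i<n. 2 * a i)"
proof -
  have "extend_by_zero n x \<in> symbox n a \<longleftrightarrow> (\<forall>i<n. x i \<in> {- a i..a i})" for x
    by (simp add: symbox_def) (auto simp: extend_by_zero_def abs_le_iff minus_le_iff)
  then have "extend_by_zero n -` symbox n a \<inter> space (PiM {..<n} (\<lambda>_. lborel)) = PiE {..<n} (\<lambda>i. {- a i..a i})"
    by (simp add: set_eq_iff space_PiM PiE_iff) blast
  then have "emeasure (lam n) (symbox n a) = emeasure (PiM {..<n} (\<lambda>_. lborel)) (PiE {..<n} (\<lambda>i. {- a i..a i}))"
    by (simp add: emeasure_lam)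
  also have "\<dots> = (\<Prod>i<n. emeasure lborel {- a i..a i})"
    by (rule lborel_prod.emeasure_PiM) auto
  also have "\<dots> = ennreal (\<Prod>i<n. 2 * a i)"
    using assms by (subst prod_ennreal[symmetric]) (auto intro!: prod.cong)
  finally show ?thesis .
qed

lemma Rn_UN_symbox: "Rn n = (\<Union>k::nat. symbox n (\<lambda>_. real k))"
proof safe
  fix x assume "x \<in> Rn n"
  obtain k :: nat where k: "Max (insert 0 ((\<lambda>i. \<bar>x i\<bar>) ` {..<n})) \<le> real k"
    using real_arch_simple by blast
  have "\<bar>x i\<bar> \<le> real k" if "i < n" for i
    using that by (intro order.trans[OF Max_ge k]) auto
  then show "x \<in> (\<Union>k::nat. symbox n (\<lambda>_. real k))" using \<open>x \<in> Rn n\<close> by (auto simp: symbox_def)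
qed (auto simp: symbox_def)

lemma sigma_finite_lam: "sigma_finite_measure (lam n)"
proof
  let ?A = "insert (- Rn n) (range (\<lambda>k::nat. symbox n (\<lambda>_. real k)))"
  have "emeasure (lam n) (- Rn n) = 0"
    using AE_lam_Rn[of n] by (subst (asm) AE_iff_measurable[of "- Rn n"]) auto
  moreover have "\<Union>?A = UNIV" using Rn_UN_symbox[of n] by auto
  ultimately show "\<exists>A. countable A \<and> A \<subseteq> sets (lam n) \<and> \<Union> A = space (lam n) \<and> (\<forall>a\<in>A. emeasure (lam n) a \<noteq> \<infinity>)"
    by (intro exI[of _ ?A]) (auto simp: emeasure_lam_symbox)
qed

text \<open>Integrate 1_A(x) 1_B(y + x) against the product of the two measures. Translation in y
  gives the left side. Translation in x gives 1_A(x - y) 1_B(x), whose integral over y is lam(A)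
  1_B(x) because \<open>lam\<close> is also invariant under reflection.\<close>

lemma haar_unique:
  assumes [measurable_cong]: "sets \<nu> = sets borel" and "sigma_finite_measure \<nu>"
    and tr: "\<And>v f. v \<in> Rn n \<Longrightarrow> f \<in> borel_measurable borel \<Longrightarrow> (\<integral>\<^sup>+x. f (x + v) \<partial>\<nu>) = (\<integral>\<^sup>+x. f x \<partial>\<nu>)"
    and Rn: "AE x in \<nu>. x \<in> Rn n"
    and [measurable]: "A \<in> sets borel" "B \<in> sets borel"
  shows "emeasure \<nu> A * emeasure (lam n) B = emeasure \<nu> B * emeasure (lam n) A"
proof -
  interpret \<nu>: sigma_finite_measure \<nu> by fact
  interpret lam: sigma_finite_measure "lam n" by (rule sigma_finite_lam)
  interpret P: pair_sigma_finite \<nu> "lam n" ..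
  let ?i = "\<lambda>A x. indicator A x :: ennreal"
  have "emeasure \<nu> A * emeasure (lam n) B = (\<integral>\<^sup>+x. ?i A x * (\<integral>\<^sup>+y. ?i B y \<partial>lam n) \<partial>\<nu>)"
    by (simp add: nn_integral_multc)
  also have "\<dots> = (\<integral>\<^sup>+x. ?i A x * (\<integral>\<^sup>+y. ?i B (y + x) \<partial>lam n) \<partial>\<nu>)"
    by (intro nn_integral_cong_AE) (use Rn in eventually_elim, subst nn_integral_lam_translate, auto)
  also have "\<dots> = (\<integral>\<^sup>+x. (\<integral>\<^sup>+y. ?i A x * ?i B (y + x) \<partial>lam n) \<partial>\<nu>)"
    by (intro nn_integral_cong nn_integral_cmult[symmetric]) simp
  also have "\<dots> = (\<integral>\<^sup>+y. (\<integral>\<^sup>+x. ?i A x * ?i B (y + x) \<partial>\<nu>) \<partial>lam n)"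
    by (rule P.Fubini'[symmetric]) measurable
  also have "\<dots> = (\<integral>\<^sup>+y. (\<integral>\<^sup>+x. ?i A (x - y) * ?i B x \<partial>\<nu>) \<partial>lam n)"
  proof (intro nn_integral_cong_AE, use AE_lam_Rn in eventually_elim)
    fix y assume "y \<in> Rn n"
    from tr[OF this, of "\<lambda>x. ?i A (x - y) * ?i B x"]
    show "(\<integral>\<^sup>+x. ?i A x * ?i B (y + x) \<partial>\<nu>) = (\<integral>\<^sup>+x. ?i A (x - y) * ?i B x \<partial>\<nu>)"
      by (simp add: add.commute)
  qed
  also have "\<dots> = (\<integral>\<^sup>+x. (\<integral>\<^sup>+y. ?i A (x - y) * ?i B x \<partial>lam n) \<partial>\<nu>)"
    by (rule P.Fubini') measurable
  also have "\<dots> = (\<integral>\<^sup>+x. (\<integral>\<^sup>+y. ?i A (x - y) \<partial>lam n) * ?i B x \<partial>\<nu>)"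
    by (intro nn_integral_cong nn_integral_multc) simp
  also have "\<dots> = (\<integral>\<^sup>+x. emeasure (lam n) A * ?i B x \<partial>\<nu>)"
  proof (intro nn_integral_cong_AE, use Rn in eventually_elim)
    fix x assume x: "x \<in> Rn n"
    have "(\<integral>\<^sup>+y. ?i A (x - y) \<partial>lam n) = (\<integral>\<^sup>+y. ?i A (y + x) \<partial>lam n)"
      using nn_integral_lam_reflect[of "\<lambda>y. ?i A (y + x)" n] by simp
    also have "\<dots> = emeasure (lam n) A"
      using x by (subst nn_integral_lam_translate) auto
    finally show "(\<integral>\<^sup>+y. ?i A (x - y) \<partial>lam n) * ?i B x = emeasure (lam n) A * ?i B x" by simp
  qed
  also have "\<dots> = emeasure \<nu> B * emeasure (lam n) A"
    by (subst nn_integral_cmult) (auto simp: mult.commute)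
  finally show ?thesis .
qed

subsection \<open>Linear maps and splitting of coordinates\<close>

definition axis_vec :: "nat \<Rightarrow> nat \<Rightarrow> real" where
  "axis_vec i = (\<lambda>j. if j = i then 1 else 0)"

lemma axis_vec_Rn: "i < n \<Longrightarrow> axis_vec i \<in> Rn n"
  by (auto simp: axis_vec_def Rn_eq)

lemma sum_fun_apply: "(\<Sum>i\<in>I. f i :: nat \<Rightarrow> real) j = (\<Sum>i\<in>I. f i j)"
  by (induction I rule: infinite_finite_induct) auto

lemma axis_expansion:
  assumes "x \<in> Rn n" shows "(\<Sum>i<n. x i *\<^sub>R axis_vec i) = x"
proof
  fix j
  have "(\<Sum>i<n. x i *\<^sub>R axis_vec i) j = (\<Sum>i<n. x i * (if i = j then 1 else 0))"
    by (simp only: sum_fun_apply scaleR_fun_apply axis_vec_def real_scaleR_def eq_commute[of j])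
  also have "\<dots> = (\<Sum>i<n. if i = j then x j else 0)"
    by (intro sum.cong) auto
  finally have "(\<Sum>i<n. x i *\<^sub>R axis_vec i) j = (\<Sum>i<n. if i = j then x j else 0)" .
  then show "(\<Sum>i<n. x i *\<^sub>R axis_vec i) j = x j"
    using assms by (cases "j < n") (auto simp: Rn_eq)
qed

text \<open>A linear map \<open>T\<close> of the infinite-dimensional sequence space may be neither
  continuous nor measurable. This version reads only the first n coordinates, agrees with
  \<open>T\<close> on \<open>Rn n\<close>, and is continuous everywhere.\<close>

definition lin_on :: "nat \<Rightarrow> ((nat \<Rightarrow> real) \<Rightarrow> nat \<Rightarrow> real) \<Rightarrow> (nat \<Rightarrow> real) \<Rightarrow> nat \<Rightarrow> real" where
  "lin_on n T x = (\<Sum>i<n. x i *\<^sub>R T (axis_vec i))"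

lemma lin_on_eq:
  assumes "linear T" "x \<in> Rn n" shows "lin_on n T x = T x"
proof -
  have "T x = T (\<Sum>i<n. x i *\<^sub>R axis_vec i)" by (simp add: axis_expansion assms)
  also have "\<dots> = lin_on n T x"
    using assms(1) by (simp add: linear_sum linear_scale lin_on_def)
  finally show ?thesis ..
qed

lemma linear_lin_on: "linear (lin_on n T)"
  by (rule linearI) (simp_all add: lin_on_def scaleR_add_left sum.distrib scaleR_sum_right)

lemma lin_on_apply: "lin_on n T x j = (\<Sum>i<n. x i * T (axis_vec i) j)"
  by (simp add: lin_on_def sum_fun_apply)

lemma measurable_lin_on [measurable]: "lin_on n T \<in> borel_measurable borel"
  by (intro measurable_funI) (simp add: lin_on_apply)

lemma continuous_fun_iff:
  fixes f :: "'a::topological_space \<Rightarrow> nat \<Rightarrow> real"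
  shows "continuous_on S f \<longleftrightarrow> (\<forall>i. continuous_on S (\<lambda>x. f x i))"
  by (auto intro: continuous_on_coordinatewise_then_product continuous_on_product_then_coordinatewise)

lemma continuous_coord [continuous_intros]:
  fixes f :: "'a::topological_space \<Rightarrow> nat \<Rightarrow> real"
  shows "continuous_on S f \<Longrightarrow> continuous_on S (\<lambda>x. f x i)"
  by (simp add: continuous_fun_iff)

lemma continuous_lin_on: "continuous_on S (lin_on n T)"
  unfolding continuous_fun_iff lin_on_apply
  by (intro allI continuous_intros continuous_coord continuous_on_id)

lemma GL_inverse:
  assumes "T \<in> GL n"
  obtains S where "S \<in> GL n" "\<And>x. x \<in> Rn n \<Longrightarrow> S (T x) = x" "\<And>x. x \<in> Rn n \<Longrightarrow> T (S x) = x"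
proof
  \<comment> \<open>\<open>inv_into\<close> is meaningful only on \<open>Rn n\<close>;
    \<open>lin_on\<close> extends its values at the axis vectors to a map that is linear on the
    whole ambient space, as \<open>GL\<close> demands.\<close>
  define S where "S = lin_on n (inv_into (Rn n) T)"
  have lin: "linear T" and bij: "bij_betw T (Rn n) (Rn n)"
    using assms by (auto simp: GL_def)
  have inv: "inv_into (Rn n) T y \<in> Rn n" "T (inv_into (Rn n) T y) = y" if "y \<in> Rn n" for y
    using bij that by (auto simp: bij_betw_def f_inv_into_f inv_into_into)
  have SRn: "S y \<in> Rn n" for y
    unfolding S_def lin_on_def
    by (intro subspace_sum subspace_Rn subspace_scale) (auto intro: inv axis_vec_Rn)
  show TS: "T (S y) = y" if "y \<in> Rn n" for y
  proof -
    have "T (S y) = (\<Sum>i<n. y i *\<^sub>R axis_vec i)"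
      using lin by (simp add: S_def lin_on_def linear_sum linear_scale inv axis_vec_Rn)
    then show ?thesis using that by (simp add: axis_expansion)
  qed
  show ST: "S (T x) = x" if "x \<in> Rn n" for x
  proof -
    have "T x \<in> Rn n" using bij that by (auto simp: bij_betw_def)
    then show ?thesis using bij that SRn TS[of "T x"] by (auto simp: bij_betw_def inj_on_def)
  qed
  show "S \<in> GL n"
    unfolding GL_def using bij TS ST SRn
    by (auto simp: S_def linear_lin_on intro!: bij_betw_byWitness[where f'=T] dest: bij_betwE)
qed

text \<open>Comparison with the cube of volume 2^n turns \<open>haar_unique\<close> into an identity
  of measures. It serves for linear images, dilations and products, so that each of these needs only
  translation invariance and a look at cubes.\<close>

lemma haar_scale:
  assumes sets: "sets \<nu> = sets borel"
    and tr: "\<And>v f. v \<in> Rn n \<Longrightarrow> f \<in> borel_measurable borel \<Longrightarrow> (\<integral>\<^sup>+x. f (x + v) \<partial>\<nu>) = (\<integral>\<^sup>+x. f x \<partial>\<nu>)"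
    and Rn: "AE x in \<nu>. x \<in> Rn n"
    and fin: "\<And>k::nat. emeasure \<nu> (symbox n (\<lambda>_. real k)) < \<infinity>"
  shows "\<nu> = scale_measure (emeasure \<nu> (symbox n (\<lambda>_. 1)) / 2 ^ n) (lam n)"
proof (rule measure_eqI)
  have sp: "space \<nu> = UNIV" using sets_eq_imp_space_eq[OF sets] by simp
  have sf: "sigma_finite_measure \<nu>"
  proof
    let ?A = "insert (- Rn n) (range (\<lambda>k::nat. symbox n (\<lambda>_. real k)))"
    have 0: "emeasure \<nu> (- Rn n) = 0"
      using Rn by (subst (asm) AE_iff_measurable[of "- Rn n"]) (auto simp: sp sets)
    have 1: "\<Union>?A = space \<nu>" using Rn_UN_symbox[of n] by (auto simp: sp)
    have 2: "?A \<subseteq> sets \<nu>" unfolding sets by auto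
    have 3: "emeasure \<nu> a \<noteq> \<infinity>" if "a \<in> ?A" for a
      using that
    proof (elim insertE imageE)
      fix k assume "a = symbox n (\<lambda>_. real k)"
      then show ?thesis using fin[of k] by (simp only: less_irrefl less_top infinity_ennreal_def not_False_eq_True)
    qed (simp add: 0)
    have 4: "countable ?A" by simp
    show "\<exists>A. countable A \<and> A \<subseteq> sets \<nu> \<and> \<Union> A = space \<nu> \<and> (\<forall>a\<in>A. emeasure \<nu> a \<noteq> \<infinity>)"
      by (rule exI[of _ ?A], intro conjI ballI 1 2 4, erule 3)
  qed
  fix A assume "A \<in> sets \<nu>"
  then have A: "A \<in> sets borel" by (simp add: sets)
  have "emeasure \<nu> A * emeasure (lam n) (symbox n (\<lambda>_. 1)) = emeasure \<nu> (symbox n (\<lambda>_. 1)) * emeasure (lam n) A"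
    using tr Rn A by (intro haar_unique sets sf symbox_borel)
  moreover have "emeasure (lam n) (symbox n (\<lambda>_. 1)) = 2 ^ n"
    by (subst emeasure_lam_symbox) (simp_all add: ennreal_power[symmetric])
  ultimately have "emeasure \<nu> A * 2 ^ n = emeasure \<nu> (symbox n (\<lambda>_. 1)) * emeasure (lam n) A"
    by (simp only:)
  then have "emeasure \<nu> A * 2 ^ n / 2 ^ n = emeasure \<nu> (symbox n (\<lambda>_. 1)) * emeasure (lam n) A / 2 ^ n"
    by simp
  moreover have "emeasure \<nu> A * 2 ^ n / 2 ^ n = emeasure \<nu> A"
    by (rule ennreal_mult_divide_eq) (auto simp: power_eq_top_ennreal)
  ultimately show "emeasure \<nu> A = emeasure (scale_measure (emeasure \<nu> (symbox n (\<lambda>_. 1)) / 2 ^ n) (lam n)) A"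
    by (simp add: ennreal_divide_times ennreal_times_divide)
qed (simp add: sets)

lemma lin_on_bounded: "x \<in> symbox n (\<lambda>_. r) \<Longrightarrow> \<bar>lin_on n T x j\<bar> \<le> r * (\<Sum>i<n. \<bar>T (axis_vec i) j\<bar>)"
  unfolding lin_on_apply sum_distrib_left symbox_def
  by (rule order.trans[OF sum_abs]) (auto simp: abs_mult intro!: sum_mono mult_right_mono)

text \<open>The factor \<open>k\<close> is 1 / |det T|, but only its positivity and finiteness
  matter, since \<open>ennpow_scale_iff\<close> lets it cancel.\<close>

lemma lam_GL:
  assumes T: "T \<in> GL n"
  obtains k where "0 < k" "k < \<infinity>"
    "\<And>f. f \<in> borel_measurable borel \<Longrightarrow> (\<integral>\<^sup>+x. f (lin_on n T x) \<partial>lam n) = k * (\<integral>\<^sup>+x. f x \<partial>lam n)"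
proof -
  obtain S where S: "S \<in> GL n" and ST: "\<And>x. x \<in> Rn n \<Longrightarrow> S (T x) = x"
    and TS: "\<And>x. x \<in> Rn n \<Longrightarrow> T (S x) = x"
    using GL_inverse[OF T] by blast
  have lin: "linear T" "linear S" using T S by (auto simp: GL_def)
  have TR: "T x \<in> Rn n" and SR: "S x \<in> Rn n" if "x \<in> Rn n" for x
    using T S that by (auto simp: GL_def bij_betw_def)
  define \<nu> where "\<nu> = distr (lam n) borel (lin_on n T)"
  define k where "k = emeasure \<nu> (symbox n (\<lambda>_. 1)) / 2 ^ n"
  have sets: "sets \<nu> = sets borel" by (simp add: \<nu>_def)
  have Rn: "AE x in \<nu>. x \<in> Rn n"
    unfolding \<nu>_def by (subst AE_distr_iff)
      (use AE_lam_Rn[of n] in \<open>auto elim!: eventually_mono simp: lin_on_eq[OF lin(1)] TR\<close>)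
  have fin: "emeasure \<nu> (symbox n (\<lambda>_. real m)) < \<infinity>" for m :: nat
  proof -
    \<comment> \<open>Since x = S (T x), the preimage of a box lies in a box whose sides come from
      the matrix entries of the inverse.\<close>
    let ?C = "\<lambda>j. real m * (\<Sum>i<n. \<bar>S (axis_vec i) j\<bar>)"
    have "emeasure \<nu> (symbox n (\<lambda>_. real m)) = emeasure (lam n) (lin_on n T -` symbox n (\<lambda>_. real m))"
      by (simp add: \<nu>_def emeasure_distr)
    also have "\<dots> \<le> emeasure (lam n) (symbox n ?C)"
    proof (rule emeasure_mono_AE)
      show "AE x in lam n. x \<in> lin_on n T -` symbox n (\<lambda>_. real m) \<longrightarrow> x \<in> symbox n ?C"
        using AE_lam_Rn
      proof eventually_elim
        case (elim x)
        { assume *: "lin_on n T x \<in> symbox n (\<lambda>_. real m)"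
          have "lin_on n S (lin_on n T x) = x"
            using elim by (simp add: lin_on_eq[OF lin(1)] lin_on_eq[OF lin(2)] TR ST)
          then have "x \<in> symbox n ?C"
            using lin_on_bounded[OF *, of S] elim unfolding symbox_def by simp }
        then show ?case by simp
      qed
    qed simp
    also have "\<dots> < \<infinity>"
      by (subst emeasure_lam_symbox) (auto intro!: mult_nonneg_nonneg sum_nonneg)
    finally show ?thesis .
  qed
  have tr: "(\<integral>\<^sup>+x. f (x + v) \<partial>\<nu>) = (\<integral>\<^sup>+x. f x \<partial>\<nu>)" if "v \<in> Rn n" and [measurable]: "f \<in> borel_measurable borel"
    for v and f :: "_ \<Rightarrow> ennreal"
  proof -
    have *: "lin_on n T x + v = lin_on n T (x + S v)" for x
      using that(1) by (simp add: linear_add[OF linear_lin_on] lin_on_eq[OF lin(1)] SR TS)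
    have "(\<integral>\<^sup>+x. f (x + v) \<partial>\<nu>) = (\<integral>\<^sup>+x. f (lin_on n T (x + S v)) \<partial>lam n)"
      unfolding \<nu>_def by (subst nn_integral_distr) (auto simp: *)
    also have "\<dots> = (\<integral>\<^sup>+x. f (lin_on n T x) \<partial>lam n)"
      using SR[OF that(1)] by (rule nn_integral_lam_translate) measurable
    also have "\<dots> = (\<integral>\<^sup>+x. f x \<partial>\<nu>)"
      unfolding \<nu>_def by (subst nn_integral_distr) auto
    finally show ?thesis .
  qed
  have eq: "\<nu> = scale_measure k (lam n)"
    unfolding k_def by (rule haar_scale[OF sets tr Rn fin])
  have "k < \<infinity>"
    using fin[of 1] ennreal_divide_eq_top_iff[of "emeasure \<nu> (symbox n (\<lambda>_. 1))" "2 ^ n"]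
    by (simp add: k_def top.not_eq_extremum[symmetric])
  \<comment> \<open>An image measure keeps the total mass, so a zero factor would make
    \<open>lam n\<close> vanish.\<close>
  moreover have "k \<noteq> 0"
  proof
    assume "k = 0"
    then have "emeasure \<nu> UNIV = 0" by (simp add: eq)
    moreover have "emeasure \<nu> UNIV = emeasure (lam n) UNIV"
      by (simp add: \<nu>_def emeasure_distr)
    moreover have "emeasure (lam n) (symbox n (\<lambda>_. 1)) \<le> emeasure (lam n) UNIV"
      by (rule emeasure_mono) auto
    ultimately show False by (simp add: emeasure_lam_symbox)
  qed
  moreover have "(\<integral>\<^sup>+x. f (lin_on n T x) \<partial>lam n) = k * (\<integral>\<^sup>+x. f x \<partial>lam n)"
    if [measurable]: "f \<in> borel_measurable borel" for f
  proof -
    have "(\<integral>\<^sup>+x. f (lin_on n T x) \<partial>lam n) = (\<integral>\<^sup>+x. f x \<partial>\<nu>)"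
      unfolding \<nu>_def by (subst nn_integral_distr) auto
    then show ?thesis by (simp add: eq nn_integral_scale_measure)
  qed
  ultimately show thesis using that by (auto simp: zero_less_iff_neq_zero)
qed

lemma nn_integral_lam_scale:
  assumes r: "r \<noteq> 0" and [measurable]: "f \<in> borel_measurable borel"
  shows "(\<integral>\<^sup>+x. f (r *\<^sub>R x) \<partial>lam n) = ennreal (1 / \<bar>r\<bar> ^ n) * (\<integral>\<^sup>+x. f x \<partial>lam n)"
proof -
  define \<nu> where "\<nu> = distr (lam n) borel (\<lambda>x. r *\<^sub>R x)"
  have sets: "sets \<nu> = sets borel" by (simp add: \<nu>_def)
  have Rn: "AE x in \<nu>. x \<in> Rn n"
    unfolding \<nu>_def by (subst AE_distr_iff)
      (use AE_lam_Rn[of n] in \<open>auto elim!: eventually_mono simp: Rn_scale\<close>)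
  have symbox: "emeasure \<nu> (symbox n (\<lambda>_. c)) = ennreal ((2 * c / \<bar>r\<bar>) ^ n)" if "0 \<le> c" for c
  proof -
    have "(\<lambda>x. r *\<^sub>R x) -` symbox n (\<lambda>_. c) = symbox n (\<lambda>_. c / \<bar>r\<bar>)"
      using r by (auto simp: symbox_def Rn_eq abs_mult field_simps)
    then have "emeasure \<nu> (symbox n (\<lambda>_. c)) = emeasure (lam n) (symbox n (\<lambda>_. c / \<bar>r\<bar>))"
      by (simp add: \<nu>_def emeasure_distr)
    then show ?thesis using that by (simp add: emeasure_lam_symbox)
  qed
  have tr: "(\<integral>\<^sup>+x. f (x + v) \<partial>\<nu>) = (\<integral>\<^sup>+x. f x \<partial>\<nu>)" if "v \<in> Rn n" and [measurable]: "f \<in> borel_measurable borel"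
    for v and f :: "_ \<Rightarrow> ennreal"
  proof -
    have *: "r *\<^sub>R x + v = r *\<^sub>R (x + (1 / r) *\<^sub>R v)" for x
      using r by (simp add: scaleR_add_right)
    have "(\<integral>\<^sup>+x. f (x + v) \<partial>\<nu>) = (\<integral>\<^sup>+x. f (r *\<^sub>R (x + (1 / r) *\<^sub>R v)) \<partial>lam n)"
      unfolding \<nu>_def by (subst nn_integral_distr) (auto simp: *)
    also have "\<dots> = (\<integral>\<^sup>+x. f (r *\<^sub>R x) \<partial>lam n)"
      using Rn_scale[OF that(1)] by (rule nn_integral_lam_translate) measurable
    also have "\<dots> = (\<integral>\<^sup>+x. f x \<partial>\<nu>)"
      unfolding \<nu>_def by (subst nn_integral_distr) auto
    finally show ?thesis .
  qed
  have "\<nu> = scale_measure (emeasure \<nu> (symbox n (\<lambda>_. 1)) / 2 ^ n) (lam n)"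
    by (rule haar_scale[OF sets tr Rn]) (auto simp: symbox)
  moreover have "emeasure \<nu> (symbox n (\<lambda>_. 1)) / 2 ^ n = ennreal (1 / \<bar>r\<bar> ^ n)"
  proof -
    have "emeasure \<nu> (symbox n (\<lambda>_. 1)) / 2 ^ n = ennreal ((2 / \<bar>r\<bar>) ^ n) / ennreal (2 ^ n)"
      by (subst symbox) (simp_all add: ennreal_power[symmetric])
    also have "\<dots> = ennreal ((2 / \<bar>r\<bar>) ^ n / 2 ^ n)"
      by (subst divide_ennreal) auto
    finally show ?thesis by (simp add: power_divide)
  qed
  ultimately have "\<nu> = scale_measure (ennreal (1 / \<bar>r\<bar> ^ n)) (lam n)" by simp
  moreover have "(\<integral>\<^sup>+x. f (r *\<^sub>R x) \<partial>lam n) = (\<integral>\<^sup>+x. f x \<partial>\<nu>)"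
    unfolding \<nu>_def by (subst nn_integral_distr) auto
  ultimately show ?thesis by (simp add: nn_integral_scale_measure)
qed

section \<open>Lebesgue measure on a product\<close>

definition join :: "nat \<Rightarrow> (nat \<Rightarrow> real) \<Rightarrow> (nat \<Rightarrow> real) \<Rightarrow> nat \<Rightarrow> real" where
  "join m z x = (\<lambda>i. if i < m then z i else x (i - m))"

lemma measurable_join [measurable (raw)]:
  assumes [THEN measurable_fun_coord, measurable]: "f \<in> borel_measurable M" "g \<in> borel_measurable M"
  shows "(\<lambda>x. join m (f x) (g x)) \<in> borel_measurable M"
  unfolding join_def by (intro measurable_funI) simp

text \<open>The image of the product measure under \<open>join\<close> is translation invariant,
  because a translation splits into one of z and one of x. On cubes it has the right value, so by
  \<open>haar_scale\<close> it is \<open>lam (m + d)\<close>.\<close>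

lemma nn_integral_lam_join:
  assumes [measurable]: "f \<in> borel_measurable borel"
  shows "(\<integral>\<^sup>+x. f x \<partial>lam (m + d)) = (\<integral>\<^sup>+z. (\<integral>\<^sup>+x. f (join m z x) \<partial>lam d) \<partial>lam m)"
proof -
  interpret M: sigma_finite_measure "lam m" by (rule sigma_finite_lam)
  interpret D: sigma_finite_measure "lam d" by (rule sigma_finite_lam)
  interpret P: pair_sigma_finite "lam m" "lam d" ..
  define \<nu> where "\<nu> = distr (lam m \<Otimes>\<^sub>M lam d) borel (\<lambda>(z, x). join m z x)"
  have sets: "sets \<nu> = sets borel" by (simp add: \<nu>_def)
  have int: "(\<integral>\<^sup>+x. f x \<partial>\<nu>) = (\<integral>\<^sup>+z. (\<integral>\<^sup>+x. f (join m z x) \<partial>lam d) \<partial>lam m)"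
    if [measurable]: "f \<in> borel_measurable borel" for f :: "_ \<Rightarrow> ennreal"
    unfolding \<nu>_def by (subst nn_integral_distr) (auto simp: D.nn_integral_fst[symmetric] case_prod_unfold)
  have Rn: "AE x in \<nu>. x \<in> Rn (m + d)"
  proof -
    have "(\<integral>\<^sup>+x. indicator (- Rn (m + d)) x \<partial>\<nu>) = (\<integral>\<^sup>+z. (\<integral>\<^sup>+x. 0 \<partial>lam d) \<partial>lam m)"
    proof (subst int)
      show "(\<integral>\<^sup>+z. (\<integral>\<^sup>+x. indicator (- Rn (m + d)) (join m z x) \<partial>lam d) \<partial>lam m) = (\<integral>\<^sup>+z. (\<integral>\<^sup>+x. 0 \<partial>lam d) \<partial>lam m)"
        by (rule nn_integral_cong, rule nn_integral_cong_AE, use AE_lam_Rn[of d] in eventually_elim)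
          (auto simp: join_def Rn_eq indicator_def)
    qed simp
    then have "emeasure \<nu> (- Rn (m + d)) = 0" by (simp add: sets nn_integral_indicator)
    then show ?thesis by (intro AE_I[where N="- Rn (m+d)"]) (auto simp: sets)
  qed
  have symbox: "emeasure \<nu> (symbox (m + d) (\<lambda>_. c)) = ennreal ((2 * c) ^ (m + d))" if "0 \<le> c" for c
  proof -
    have "emeasure \<nu> (symbox (m + d) (\<lambda>_. c)) = (\<integral>\<^sup>+x. indicator (symbox (m + d) (\<lambda>_. c)) x \<partial>\<nu>)"
      by (simp add: sets nn_integral_indicator)
    also have "\<dots> = (\<integral>\<^sup>+z. (\<integral>\<^sup>+x. indicator (symbox m (\<lambda>_. c)) z * indicator (symbox d (\<lambda>_. c)) x \<partial>lam d) \<partial>lam m)"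
    proof (subst int, simp, intro nn_integral_cong_AE, use AE_lam_Rn[of m] in eventually_elim,
        intro nn_integral_cong_AE, use AE_lam_Rn[of d] in eventually_elim)
      fix z x assume z: "z \<in> Rn m" and x: "x \<in> Rn d"
      have "join m z x \<in> Rn (m + d)" using x by (auto simp: join_def Rn_eq)
      moreover have "(\<forall>i<m+d. \<bar>join m z x i\<bar> \<le> c) \<longleftrightarrow> (\<forall>i<m. \<bar>z i\<bar> \<le> c) \<and> (\<forall>i<d. \<bar>x i\<bar> \<le> c)"
      proof (safe)
        fix i assume *: "\<forall>i<m+d. \<bar>join m z x i\<bar> \<le> c" 
        { assume "i < m" then show "\<bar>z i\<bar> \<le> c" using *[rule_format, of i] by (simp add: join_def) }
        { assume "i < d" then show "\<bar>x i\<bar> \<le> c" using *[rule_format, of "i+m"] by (simp add: join_def) }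
      qed (auto simp: join_def)
      ultimately show "indicator (symbox (m + d) (\<lambda>_. c)) (join m z x) =
          (indicator (symbox m (\<lambda>_. c)) z * indicator (symbox d (\<lambda>_. c)) x :: ennreal)"
        using z x by (simp add: indicator_def symbox_def)
    qed
    also have "\<dots> = ennreal ((2 * c) ^ (m + d))"
      using that by (simp add: nn_integral_cmult nn_integral_multc emeasure_lam_symbox power_add ennreal_mult)
    finally show ?thesis .
  qed
  have tr: "(\<integral>\<^sup>+x. f (x + v) \<partial>\<nu>) = (\<integral>\<^sup>+x. f x \<partial>\<nu>)" if "v \<in> Rn (m + d)" and [measurable]: "f \<in> borel_measurable borel"
    for v and f :: "_ \<Rightarrow> ennreal"
  proof -
    define v1 v2 where "v1 = extend_by_zero m v" and "v2 = (\<lambda>i. v (i + m))"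
    have v12: "v1 \<in> Rn m" "v2 \<in> Rn d" using that by (auto simp: v1_def v2_def Rn_eq extend_by_zero_def)
    have j: "join m z x + v = join m (z + v1) (x + v2)" for z x
      by (auto simp: join_def v1_def v2_def extend_by_zero_def fun_eq_iff)
    have "(\<integral>\<^sup>+x. f (x + v) \<partial>\<nu>) = (\<integral>\<^sup>+z. (\<integral>\<^sup>+x. f (join m (z + v1) (x + v2)) \<partial>lam d) \<partial>lam m)"
      by (subst int) (auto simp: j)
    also have "\<dots> = (\<integral>\<^sup>+z. (\<integral>\<^sup>+x. f (join m (z + v1) x) \<partial>lam d) \<partial>lam m)"
      by (intro nn_integral_cong nn_integral_lam_translate v12) measurable
    also have "\<dots> = (\<integral>\<^sup>+z. (\<integral>\<^sup>+x. f (join m z x) \<partial>lam d) \<partial>lam m)"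
      by (rule nn_integral_lam_translate[OF v12(1)]) measurable
    finally show ?thesis by (simp add: int)
  qed
  have "\<nu> = scale_measure (emeasure \<nu> (symbox (m + d) (\<lambda>_. 1)) / 2 ^ (m + d)) (lam (m + d))"
    by (rule haar_scale[OF sets tr Rn]) (auto simp: symbox)
  moreover have "emeasure \<nu> (symbox (m + d) (\<lambda>_. 1)) / 2 ^ (m + d) = 1"
  proof -
    have "emeasure \<nu> (symbox (m + d) (\<lambda>_. 1)) / 2 ^ (m + d) = ennreal (2 ^ (m+d)) / ennreal (2 ^ (m + d))"
      by (subst symbox) (simp_all add: ennreal_power[symmetric])
    also have "\<dots> = 1" by (subst divide_ennreal) auto
    finally show ?thesis .
  qed
  ultimately have "\<nu> = lam (m + d)" by simp
  then show ?thesis using int[OF assms] by simp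
qed

section \<open>Passage between the completed measure \<open>leb\<close> and the Borel measure
  \<open>lam\<close>\<close>

lemma leb_eq: "leb n = completion (restrict_space (lam n) (Rn n))"
proof -
  let ?P = "PiM {..<n} (\<lambda>_. lborel :: real measure)"
  have "distr ?P (restrict_space borel (Rn n)) (extend_by_zero n) = restrict_space (lam n) (Rn n)"
  proof (rule measure_eqI)
    show "sets (distr ?P (restrict_space borel (Rn n)) (extend_by_zero n)) = sets (restrict_space (lam n) (Rn n))"
      by (simp add: sets_restrict_space)
    fix A assume "A \<in> sets (distr ?P (restrict_space borel (Rn n)) (extend_by_zero n))"
    then have A: "A \<in> sets (restrict_space borel (Rn n))" by simp
    then have A': "A \<in> sets borel" "A \<subseteq> Rn n"
      using sets_restrict_space_iff[of "Rn n" borel A] by auto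
    show "emeasure (distr ?P (restrict_space borel (Rn n)) (extend_by_zero n)) A = emeasure (restrict_space (lam n) (Rn n)) A"
      using A' by (simp add: emeasure_distr[OF measurable_extend_by_zero A] emeasure_restrict_space emeasure_lam)
  qed
  then show ?thesis by (simp add: leb_def)
qed

lemma AE_leb_iff: "(AE x in leb n. P x) \<longleftrightarrow> (AE x in lam n. P x)"
proof -
  have "(AE x in leb n. P x) \<longleftrightarrow> (AE x in lam n. x \<in> Rn n \<longrightarrow> P x)"
    unfolding leb_eq AE_completion_iff by (subst AE_restrict_space_iff) auto
  also have "\<dots> \<longleftrightarrow> (AE x in lam n. P x)"
    using AE_lam_Rn[of n] by (auto elim: eventually_elim2)
  finally show ?thesis .
qed

lemma nn_integral_leb:
  assumes "f \<in> borel_measurable borel"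
  shows "(\<integral>\<^sup>+x. f x \<partial>leb n) = (\<integral>\<^sup>+x. f x \<partial>lam n)"
proof -
  have "(\<integral>\<^sup>+x. f x \<partial>leb n) = (\<integral>\<^sup>+x. f x * indicator (Rn n) x \<partial>lam n)"
    by (simp add: leb_eq nn_integral_completion nn_integral_restrict_space)
  also have "\<dots> = (\<integral>\<^sup>+x. f x \<partial>lam n)"
    by (intro nn_integral_cong_AE) (use AE_lam_Rn[of n] in \<open>auto elim!: eventually_mono\<close>)
  finally show ?thesis .
qed

text \<open>Fubini and translations require a Borel function on the whole sequence space. Taking the
  maximum with 0 keeps the representative non-negative on the exceptional null set as well.\<close>

lemma leb_borel_rep:
  fixes f :: "(nat \<Rightarrow> real) \<Rightarrow> real"
  assumes "f \<in> borel_measurable (leb n)" and pos: "\<And>x. x \<in> Rn n \<Longrightarrow> 0 \<le> f x"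
  obtains f' where "f' \<in> borel_measurable borel" "\<And>x. 0 \<le> f' x" "AE x in lam n. f x = f' x"
proof -
  obtain g where g: "g \<in> borel_measurable (restrict_space (lam n) (Rn n))"
    "AE x in restrict_space (lam n) (Rn n). f x = g x"
    using completion_ex_borel_measurable_real[OF assms(1)[unfolded leb_eq]] by blast
  define f' where "f' = (\<lambda>x. max 0 (g x * indicator (Rn n) x))"
  have "(\<lambda>x. g x * indicator (Rn n) x) \<in> borel_measurable (lam n)"
    using g(1) by (subst (asm) borel_measurable_restrict_space_iff) (auto simp: mult.commute)
  then have "f' \<in> borel_measurable borel"
    unfolding f'_def by (intro borel_measurable_max) (auto cong: measurable_cong_sets)
  moreover have "0 \<le> f' x" for x by (simp add: f'_def)
  moreover have "AE x in lam n. f x = f' x"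
  proof -
    have "AE x in lam n. x \<in> Rn n \<longrightarrow> f x = g x"
      using g(2) by (subst (asm) AE_restrict_space_iff) auto
    with AE_lam_Rn[of n] show ?thesis
    proof eventually_elim
      case (elim x)
      then show ?case using pos[of x] by (simp add: f'_def max_def)
    qed
  qed
  ultimately show thesis by (rule that)
qed

lemma int_over_rep:
  assumes [measurable]: "f' \<in> borel_measurable borel" "S \<in> sets borel"
    and "AE x in lam n. f x = f' x"
  shows "int_over n f S = (\<integral>\<^sup>+x. ennreal (f' x) * indicator S x \<partial>lam n)"
proof -
  have "int_over n f S = (\<integral>\<^sup>+x. ennreal (f' x) * indicator S x \<partial>leb n)"
    unfolding int_over_def using assms(3)
    by (intro nn_integral_cong_AE) (auto simp: AE_leb_iff elim!: eventually_mono)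
  then show ?thesis by (simp add: nn_integral_leb)
qed

subsection \<open>Continuity of translations in the mean\<close>

lemma Rn_translate_tendsto:
  fixes v :: "nat \<Rightarrow> nat \<Rightarrow> real"
  assumes "\<And>i. (\<lambda>j. v j i) \<longlonglongrightarrow> 0"
  shows "(\<lambda>j. x + v j) \<longlonglongrightarrow> x"
proof -
  have "(\<lambda>j. (x + v j) i) \<longlonglongrightarrow> x i" for i
    using tendsto_add[OF tendsto_const[of "x i"] assms[of i]] by simp
  then show ?thesis
    using limitin_componentwise[of "\<lambda>_. euclidean" UNIV "\<lambda>j. x + v j" x sequentially]
    by (simp add: euclidean_product_topology)
qed

context
  fixes n :: nat and v :: "nat \<Rightarrow> nat \<Rightarrow> real"
  assumes vR: "\<And>j. v j \<in> Rn n" and v0: "\<And>i. (\<lambda>j. v j i) \<longlonglongrightarrow> 0"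
begin

lemma integrable_translate:
  fixes f :: "(nat \<Rightarrow> real) \<Rightarrow> real"
  assumes "integrable (lam n) f"
  shows "integrable (lam n) (\<lambda>x. f (x + v j))" "(\<integral>x. f (x + v j) \<partial>lam n) = (\<integral>x. f x \<partial>lam n)"
proof -
  have [measurable]: "f \<in> borel_measurable borel" using assms by (auto cong: measurable_cong_sets)
  have "integrable (distr (lam n) borel (\<lambda>x. x + v j)) f"
    using assms by (simp add: lam_translate[OF vR])
  then show "integrable (lam n) (\<lambda>x. f (x + v j))"
    by (subst (asm) integrable_distr_eq) auto
  have "(\<integral>x. f x \<partial>distr (lam n) borel (\<lambda>x. x + v j)) = (\<integral>x. f (x + v j) \<partial>lam n)"
    by (rule integral_distr) auto
  then show "(\<integral>x. f (x + v j) \<partial>lam n) = (\<integral>x. f x \<partial>lam n)"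
    by (simp add: lam_translate[OF vR])
qed

text \<open>The predicate for the induction over integrable functions, along the fixed sequence
  \<open>v\<close>. Stating it for one sequence makes dominated convergence available.\<close>

definition mean_continuous :: "((nat \<Rightarrow> real) \<Rightarrow> real) \<Rightarrow> bool" where
  "mean_continuous f \<longleftrightarrow> integrable (lam n) f \<and> (\<lambda>j. \<integral>x. \<bar>f (x + v j) - f x\<bar> \<partial>lam n) \<longlonglongrightarrow> 0"

text \<open>Translation preserves the distance in mean between f and its approximation g, so the
  approximation error counts twice and the translation error of g once; r / 4 for each leaves
  room.\<close>

lemma mean_continuous_approx:
  assumes f: "integrable (lam n) f"
    and ap: "\<And>e. e > 0 \<Longrightarrow> \<exists>g. mean_continuous g \<and> (\<integral>x. \<bar>f x - g x\<bar> \<partial>lam n) \<le> e"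
  shows "mean_continuous f"
  unfolding mean_continuous_def
proof (intro conjI f LIMSEQ_I)
  fix r :: real assume r: "r > 0"
  obtain g where g: "mean_continuous g" "(\<integral>x. \<bar>f x - g x\<bar> \<partial>lam n) \<le> r / 4"
    using ap[of "r/4"] r by auto
  have gi: "integrable (lam n) g" using g(1) by (simp add: mean_continuous_def)
  have "(\<lambda>j. \<integral>x. \<bar>g (x + v j) - g x\<bar> \<partial>lam n) \<longlonglongrightarrow> 0" using g(1) by (simp add: mean_continuous_def)
  from LIMSEQ_D[OF this, of "r/4"] r obtain N where N: "\<And>j. j \<ge> N \<Longrightarrow> (\<integral>x. \<bar>g (x + v j) - g x\<bar> \<partial>lam n) < r / 4"
    by (auto simp: abs_less_iff)
  show "\<exists>N. \<forall>j\<ge>N. norm ((\<integral>x. \<bar>f (x + v j) - f x\<bar> \<partial>lam n) - 0) < r"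
  proof (intro exI allI impI)
    fix j assume j: "j \<ge> N"
    note tr = integrable_translate[where j=j]
    have i1: "integrable (lam n) (\<lambda>x. \<bar>f x - g x\<bar>)" using f gi by auto
    have i2: "integrable (lam n) (\<lambda>x. \<bar>g (x + v j) - g x\<bar>)" using gi tr by auto
    have i3: "integrable (lam n) (\<lambda>x. \<bar>f (x + v j) - f x\<bar>)" using f tr by auto
    have "(\<integral>x. \<bar>f (x + v j) - f x\<bar> \<partial>lam n) \<le>
      (\<integral>x. \<bar>f (x + v j) - g (x + v j)\<bar> + (\<bar>g (x + v j) - g x\<bar> + \<bar>f x - g x\<bar>) \<partial>lam n)"
      by (intro integral_mono i3 Bochner_Integration.integrable_add tr(1)[OF i1] i2 i1) linarith
    also have "\<dots> = (\<integral>x. \<bar>f x - g x\<bar> \<partial>lam n) + ((\<integral>x. \<bar>g (x + v j) - g x\<bar> \<partial>lam n) + (\<integral>x. \<bar>f x - g x\<bar> \<partial>lam n))"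
      using tr(1)[OF i1] i1 i2 by (simp add: tr(2)[OF i1])
    also have "\<dots> < r" using g(2) N[OF j] r by linarith
    finally show "norm ((\<integral>x. \<bar>f (x + v j) - f x\<bar> \<partial>lam n) - 0) < r" by simp
  qed
qed

text \<open>The integral of |1_A(x + v) - 1_A(x)| is twice the measure of A minus twice the overlap
  of A with its translate. Openness makes the overlap integrand converge at each point of A, and off
  A it vanishes identically, so the boundary of A causes no trouble.\<close>

lemma mean_continuous_open:
  assumes A: "open A" and fin: "emeasure (lam n) A < \<infinity>"
  shows "mean_continuous (indicator A)"
  unfolding mean_continuous_def
proof
  have [measurable]: "A \<in> sets borel" using A by simp
  let ?i = "indicator A :: _ \<Rightarrow> real"
  show i: "integrable (lam n) ?i" using fin by simp
  have "(\<lambda>j. \<integral>x. ?i x * ?i (x + v j) \<partial>lam n) \<longlonglongrightarrow> (\<integral>x. ?i x \<partial>lam n)"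
  proof (rule integral_dominated_convergence[where w="?i"])
    show "AE x in lam n. (\<lambda>j. ?i x * ?i (x + v j)) \<longlonglongrightarrow> ?i x"
    proof (rule AE_I2)
      fix x show "(\<lambda>j. ?i x * ?i (x + v j)) \<longlonglongrightarrow> ?i x"
      proof (cases "x \<in> A")
        case True
        have "\<forall>\<^sub>F j in sequentially. x + v j \<in> A"
          using topological_tendstoD[OF Rn_translate_tendsto[OF v0] A True] .
        then have "\<forall>\<^sub>F j in sequentially. ?i x * ?i (x + v j) = ?i x"
          by eventually_elim (simp add: True)
        then show ?thesis by (rule tendsto_eventually)
      qed simp
    qed
    show "AE x in lam n. norm (?i x * ?i (x + v j)) \<le> ?i x" for j
      by (rule AE_I2) (simp add: indicator_def)
  qed (use i in auto)
  from tendsto_diff[OF tendsto_const[of "2 * (\<integral>x. ?i x \<partial>lam n)"] tendsto_mult[OF tendsto_const[of 2] this]]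
  have "(\<lambda>j. 2 * (\<integral>x. ?i x \<partial>lam n) - 2 * (\<integral>x. ?i x * ?i (x + v j) \<partial>lam n)) \<longlonglongrightarrow> 0" by simp
  moreover have "(\<integral>x. \<bar>?i (x + v j) - ?i x\<bar> \<partial>lam n) = 2 * (\<integral>x. ?i x \<partial>lam n) - 2 * (\<integral>x. ?i x * ?i (x + v j) \<partial>lam n)" for j
  proof -
    note tr = integrable_translate[OF i, of j]
    have i2: "integrable (lam n) (\<lambda>x. ?i x * ?i (x + v j))"
      by (rule Bochner_Integration.integrable_bound[OF i]) (auto simp: indicator_def)
    have "(\<integral>x. \<bar>?i (x + v j) - ?i x\<bar> \<partial>lam n) = (\<integral>x. (?i (x + v j) + ?i x) - 2 * (?i x * ?i (x + v j)) \<partial>lam n)"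
      by (intro Bochner_Integration.integral_cong) (auto simp: indicator_def)
    also have "\<dots> = ((\<integral>x. ?i (x + v j) \<partial>lam n) + (\<integral>x. ?i x \<partial>lam n)) - (\<integral>x. 2 * (?i x * ?i (x + v j)) \<partial>lam n)"
      using tr(1) i i2 by (subst Bochner_Integration.integral_diff) auto
    finally show ?thesis by (simp add: tr(2))
  qed
  ultimately show "(\<lambda>j. \<integral>x. \<bar>?i (x + v j) - ?i x\<bar> \<partial>lam n) \<longlonglongrightarrow> 0" by simp
qed

lemma mean_continuous_set:
  assumes [measurable]: "A \<in> sets borel" and fin: "emeasure (lam n) A < \<infinity>"
  shows "mean_continuous (indicator A)"
proof (rule mean_continuous_approx)
  show "integrable (lam n) (indicator A :: _ \<Rightarrow> real)" using fin by simp
  fix e :: real assume e: "e > 0"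
  define Q where "Q k = {x :: nat \<Rightarrow> real. \<forall>i<n. \<bar>x i\<bar> < real k}" for k
  have opQ: "open (Q k)" for k
  proof -
    have "Q k = (\<Inter>i\<in>{..<n}. {x. \<bar>x i\<bar> < real k})" by (auto simp: Q_def)
    moreover have "open {x :: nat \<Rightarrow> real. \<bar>x i\<bar> < real k}" for i
      by (rule open_Collect_less) (rule continuous_on_rabs continuous_on_const continuous_on_product_coordinates)+
    ultimately show ?thesis by (simp only:) (intro open_INT, auto)
  qed
  have [measurable]: "Q k \<in> sets borel" for k using opQ by simp
  have Qfin: "emeasure (lam n) (Q k) < \<infinity>" for k
  proof -
    have "emeasure (lam n) (Q k) \<le> emeasure (lam n) (symbox n (\<lambda>_. real k))"
      by (intro emeasure_mono_AE) (use AE_lam_Rn[of n] in \<open>auto elim!: eventually_mono simp: Q_def symbox_def\<close>)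
    also have "\<dots> < \<infinity>" by (simp add: emeasure_lam_symbox)
    finally show ?thesis .
  qed
  have "(\<lambda>k. measure (lam n) (A \<inter> Q k)) \<longlonglongrightarrow> measure (lam n) (\<Union>k. A \<inter> Q k)"
  proof (rule Lim_measure_incseq)
    show "incseq (\<lambda>k. A \<inter> Q k)"
      by (rule incseq_SucI) (fastforce simp: Q_def)
    have "emeasure (lam n) (\<Union>k. A \<inter> Q k) \<le> emeasure (lam n) A" by (intro emeasure_mono) auto
    then show "emeasure (lam n) (\<Union>k. A \<inter> Q k) \<noteq> \<infinity>" using fin by auto
  qed auto
  moreover have "(\<Union>k. A \<inter> Q k) = A"
  proof -
    have "\<exists>k. x \<in> Q k" for x
    proof -
      obtain k :: nat where k: "Max (insert 0 ((\<lambda>i. \<bar>x i\<bar>) ` {..<n})) < real k"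
        using reals_Archimedean2 by blast
      have "\<bar>x i\<bar> < real k" if "i < n" for i
        using that by (intro order.strict_trans1[OF Max_ge k]) auto
      then show ?thesis by (auto simp: Q_def)
    qed
    then show ?thesis by auto
  qed
  ultimately have "(\<lambda>k. measure (lam n) (A \<inter> Q k)) \<longlonglongrightarrow> measure (lam n) A" by simp
  from LIMSEQ_D[OF this, of "e/2"] e obtain k where
    k: "\<bar>measure (lam n) (A \<inter> Q k) - measure (lam n) A\<bar> < e / 2" by auto
  \<comment> \<open>Outer regularity is applied to a finite measure, the restriction of
    \<open>lam n\<close> to the open cylinder \<open>Q k\<close>. Intersecting the open hull with
    \<open>Q k\<close> keeps it open and gives it finite measure.\<close>
  let ?\<nu> = "density (lam n) (indicator (Q k))"
  have \<nu>: "emeasure ?\<nu> B = emeasure (lam n) (Q k \<inter> B)" if [measurable]: "B \<in> sets borel" for B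
    by (simp add: emeasure_density nn_integral_indicator indicator_inter_arith[symmetric])
  have "emeasure ?\<nu> (A \<inter> Q k) = (INF U \<in> {U. A \<inter> Q k \<subseteq> U \<and> open U}. emeasure ?\<nu> U)"
    by (rule outer_regular) (use Qfin[of k] in \<open>auto simp: \<nu>\<close>)
  moreover have fA: "emeasure ?\<nu> (A \<inter> Q k) < \<infinity>"
  proof -
    have "emeasure (lam n) (Q k \<inter> (A \<inter> Q k)) \<le> emeasure (lam n) (Q k)" by (intro emeasure_mono) auto
    then show ?thesis using Qfin[of k] by (simp add: \<nu> le_less_trans)
  qed
  moreover have "emeasure ?\<nu> (A \<inter> Q k) < emeasure ?\<nu> (A \<inter> Q k) + ennreal (e / 2)"
    using fA e by (simp add: ennreal_add_left_cancel_less[of _ 0, simplified])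
  ultimately obtain U where U: "A \<inter> Q k \<subseteq> U" "open U" "emeasure ?\<nu> U < emeasure ?\<nu> (A \<inter> Q k) + ennreal (e / 2)"
    by (auto simp: INF_less_iff)
  have [measurable]: "U \<in> sets borel" using U by simp
  have fU: "emeasure (lam n) (U \<inter> Q k) < \<infinity>"
    using emeasure_mono[of "U \<inter> Q k" "Q k" "lam n"] Qfin[of k] by (simp add: le_less_trans)
  have fAQ: "emeasure (lam n) (A \<inter> Q k) < \<infinity>"
    using emeasure_mono[of "A \<inter> Q k" "Q k" "lam n"] Qfin[of k] by (simp add: le_less_trans)
  have m: "mean_continuous (indicator (U \<inter> Q k))"
    by (rule mean_continuous_open) (use U opQ fU in auto)
  have "emeasure (lam n) (U \<inter> Q k) < emeasure (lam n) (A \<inter> Q k) + ennreal (e / 2)"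
    using U(3) by (simp add: \<nu> Int_commute Int_left_commute)
  then have d1: "measure (lam n) (U \<inter> Q k) < measure (lam n) (A \<inter> Q k) + e / 2"
    using fU fAQ e by (simp add: emeasure_eq_ennreal_measure ennreal_plus[symmetric] ennreal_less_iff del: ennreal_plus)
  let ?i = "\<lambda>A x. indicator A x :: real"
  have "(\<integral>x. \<bar>?i A x - ?i (U \<inter> Q k) x\<bar> \<partial>lam n) \<le>
     (\<integral>x. (?i A x - ?i (A \<inter> Q k) x) + (?i (U \<inter> Q k) x - ?i (A \<inter> Q k) x) \<partial>lam n)"
  proof (rule integral_mono)
    show "integrable (lam n) (\<lambda>x. \<bar>?i A x - ?i (U \<inter> Q k) x\<bar>)" using fin fU by auto
    show "integrable (lam n) (\<lambda>x. (?i A x - ?i (A \<inter> Q k) x) + (?i (U \<inter> Q k) x - ?i (A \<inter> Q k) x))"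
      using fin fU fAQ by (intro Bochner_Integration.integrable_add Bochner_Integration.integrable_diff) auto
    show "\<bar>?i A x - ?i (U \<inter> Q k) x\<bar> \<le> (?i A x - ?i (A \<inter> Q k) x) + (?i (U \<inter> Q k) x - ?i (A \<inter> Q k) x)" for x
      using U(1) by (auto simp: indicator_def)
  qed
  also have "\<dots> = (measure (lam n) A - measure (lam n) (A \<inter> Q k)) + (measure (lam n) (U \<inter> Q k) - measure (lam n) (A \<inter> Q k))"
    using fin fU fAQ by simp
  also have "\<dots> \<le> e" using d1 k by linarith
  finally show "\<exists>g. mean_continuous g \<and> (\<integral>x. \<bar>?i A x - g x\<bar> \<partial>lam n) \<le> e"
    using m by blast
qed

lemma mean_continuous_integrable:
  fixes f :: "(nat \<Rightarrow> real) \<Rightarrow> real"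
  assumes "integrable (lam n) f" shows "mean_continuous f"
  using assms
proof (induction rule: integrable_induct)
  case (base A c)
  then have "mean_continuous (indicator A)" by (intro mean_continuous_set) auto
  then have i: "integrable (lam n) (indicator A :: _ \<Rightarrow> real)"
    and l: "(\<lambda>j. \<integral>x. \<bar>indicator A (x + v j) - indicator A x\<bar> \<partial>lam n) \<longlonglongrightarrow> (0::real)"
    by (auto simp: mean_continuous_def)
  have "(\<integral>x. \<bar>indicator A (x + v j) *\<^sub>R c - indicator A x *\<^sub>R c\<bar> \<partial>lam n) =
     \<bar>c\<bar> * (\<integral>x. \<bar>indicator A (x + v j) - indicator A x\<bar> \<partial>lam n)" for j
    by (subst integral_mult_right_zero[symmetric])
      (auto simp: abs_mult[symmetric] algebra_simps intro!: Bochner_Integration.integral_cong)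
  then show ?case
    unfolding mean_continuous_def using i tendsto_mult_right[OF l, of "\<bar>c\<bar>"] by (auto simp: mult.commute)
next
  case (add f g)
  note fg = add(3,4)[unfolded mean_continuous_def]
  have i: "integrable (lam n) f" "integrable (lam n) g" using add(1,2) .
  have b: "(\<integral>x. \<bar>(f (x + v j) + g (x + v j)) - (f x + g x)\<bar> \<partial>lam n) \<le>
     (\<integral>x. \<bar>f (x + v j) - f x\<bar> \<partial>lam n) + (\<integral>x. \<bar>g (x + v j) - g x\<bar> \<partial>lam n)" for j
  proof -
    note t = integrable_translate(1)[OF i(1), of j] integrable_translate(1)[OF i(2), of j]
    have "(\<integral>x. \<bar>(f (x + v j) + g (x + v j)) - (f x + g x)\<bar> \<partial>lam n) \<le>
      (\<integral>x. \<bar>f (x + v j) - f x\<bar> + \<bar>g (x + v j) - g x\<bar> \<partial>lam n)"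
      using t i by (intro integral_mono) auto
    then show ?thesis using t i by simp
  qed
  have "(\<lambda>j. \<integral>x. \<bar>(f (x + v j) + g (x + v j)) - (f x + g x)\<bar> \<partial>lam n) \<longlonglongrightarrow> 0"
    by (rule tendsto_sandwich[OF _ _ tendsto_const])
      (use b tendsto_add[OF fg(1)[THEN conjunct2] fg(2)[THEN conjunct2]] in \<open>auto intro!: eventuallyI\<close>)
  then show ?case using i by (simp add: mean_continuous_def)
next
  case (lim f s)
  show ?case
  proof (rule mean_continuous_approx)
    show "integrable (lam n) f" by fact
    fix e :: real assume e: "e > 0"
    have [measurable]: "f \<in> borel_measurable (lam n)" "\<And>i. s i \<in> borel_measurable (lam n)"
      using lim by auto
    have "(\<lambda>i. \<integral>x. \<bar>f x - s i x\<bar> \<partial>lam n) \<longlonglongrightarrow> (\<integral>x. 0 \<partial>lam n)"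
    proof (rule integral_dominated_convergence[where w="\<lambda>x. 3 * norm (f x)"])
      show "AE x in lam n. (\<lambda>i. \<bar>f x - s i x\<bar>) \<longlonglongrightarrow> 0"
      proof (rule AE_I2)
        fix x assume "x \<in> space (lam n)"
        from tendsto_diff[OF tendsto_const[of "f x"] lim.hyps(2)[OF this]]
        show "(\<lambda>i. \<bar>f x - s i x\<bar>) \<longlonglongrightarrow> 0" by (simp add: tendsto_rabs_zero)
      qed
      show "AE x in lam n. norm \<bar>f x - s i x\<bar> \<le> 3 * norm (f x)" for i
        using lim.hyps(3)[of _ i] by (intro AE_I2) (smt (verit) real_norm_def)
    qed (use lim in auto)
    from LIMSEQ_D[OF this, of e] e obtain i where "(\<integral>x. \<bar>f x - s i x\<bar> \<partial>lam n) < e"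
      by (auto simp: abs_less_iff)
    then show "\<exists>g. mean_continuous g \<and> (\<integral>x. \<bar>f x - g x\<bar> \<partial>lam n) \<le> e"
      using lim.IH[of i] by (intro exI[of _ "s i"]) auto
  qed
qed

end

lemma translation_mean_tendsto:
  fixes f :: "(nat \<Rightarrow> real) \<Rightarrow> real"
  assumes "integrable (lam n) f" "\<And>j. v j \<in> Rn n" "\<And>i. (\<lambda>j. v j i) \<longlonglongrightarrow> 0"
  shows "(\<lambda>j. \<integral>x. \<bar>f (x + v j) - f x\<bar> \<partial>lam n) \<longlonglongrightarrow> 0"
  using mean_continuous_integrable[of v n f] assms by (simp add: mean_continuous_def)

subsection \<open>Tubes around a line\<close>

lemma ennpow_ennreal: "0 \<le> x \<Longrightarrow> ennpow (ennreal x) c = ennreal (x powr c)"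
  by (simp add: ennpow_def)

text \<open>Common form of both hypotheses: a log-Brunn-Minkowski inequality for linear images of
  two boxes under one map, with the log-combination replaced by the image of the box whose sides are
  geometric means.\<close>

definition box_ineq :: "nat \<Rightarrow> ((nat \<Rightarrow> real) \<Rightarrow> real) \<Rightarrow> bool" where
  "box_ineq n f \<longleftrightarrow> (\<forall>T\<in>GL n. \<forall>a b c. (\<forall>i. 0 < a i \<and> 0 < b i) \<and> 0 < c \<and> c < 1 \<longrightarrow>
     ennpow (int_over n f (T ` symbox n a)) c * ennpow (int_over n f (T ` symbox n b)) (1 - c) \<le>
     int_over n f (T ` symbox n (\<lambda>i. a i powr c * b i powr (1 - c))))"

lemma dot_add: "dot n u (x + y) = dot n u x + dot n u y"
  and dot_scale: "dot n u (r *\<^sub>R x) = r * dot n u x"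
  and dot_minus: "dot n u (- x) = - dot n u x"
  and dot_diff: "dot n u (x - y) = dot n u x - dot n u y"
  by (simp_all add: dot_def algebra_simps sum.distrib sum_distrib_left sum_negf sum_subtractf)

lemma measurable_dot [measurable]: "dot n u \<in> borel_measurable borel"
  unfolding dot_def by measurable

text \<open>In a point \<open>y\<close>, index 0 is the position along the axis of the tube, indices
  1 to \<open>p\<close> are auxiliary coordinates, one for each slab normal, and the last
  \<open>d\<close> indices hold the point x of the space of the slabs. \<open>F\<close> is a Borel
  representative of \<open>f\<close>.\<close>

locale tube =
  fixes d p N :: nat and u :: "nat \<Rightarrow> nat \<Rightarrow> real" and m :: "nat \<Rightarrow> real"
    and f F :: "(nat \<Rightarrow> real) \<Rightarrow> real"
  assumes N_eq: "N = Suc p + d"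
    and F_meas [measurable]: "F \<in> borel_measurable borel" and F_pos: "0 \<le> F x"
    and F_int: "integrable (lam N) F"
    and F_rep: "AE x in lam N. f x = F x"
    and f_ineq: "box_ineq N f"
    and m_Rn: "m \<in> Rn d"
begin

definition height :: "nat \<Rightarrow> (nat \<Rightarrow> real) \<Rightarrow> real" where
  "height i y = dot d (u i) (\<lambda>l. y (Suc p + l) - y 0 * m l)"

definition tset :: "(nat \<Rightarrow> real) \<Rightarrow> real \<Rightarrow> (nat \<Rightarrow> real) set" where
  "tset \<alpha> R = {y. \<bar>y 0\<bar> \<le> R \<and> (\<forall>i<p. \<bar>height i y\<bar> \<le> \<alpha> i)}"

definition G :: "(nat \<Rightarrow> real) \<Rightarrow> real \<Rightarrow> real" where
  "G \<alpha> R = (\<integral>y. F y * indicator (tset \<alpha> R) y \<partial>lam N)"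

lemma height_meas [measurable]: "height i \<in> borel_measurable borel"
  unfolding height_def dot_def by measurable

lemma tset_borel [measurable]: "tset \<alpha> R \<in> sets borel"
  unfolding tset_def by measurable

lemma F_int_set: "S \<in> sets borel \<Longrightarrow> integrable (lam N) (\<lambda>y. F y * indicator S y)"
  using F_int by (rule Bochner_Integration.integrable_bound) (auto simp: indicator_def)

lemma G_nonneg: "0 \<le> G \<alpha> R"
  unfolding G_def by (intro Bochner_Integration.integral_nonneg) (auto simp: F_pos)

lemma int_over_eq:
  assumes "S \<in> sets borel"
  shows "int_over N f S = ennreal (\<integral>y. F y * indicator S y \<partial>lam N)"
proof -
  have "int_over N f S = (\<integral>\<^sup>+y. ennreal (F y * indicator S y) \<partial>lam N)"
    using int_over_rep[OF F_meas assms F_rep]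
    by (simp add: ennreal_mult' F_pos ennreal_indicator)
  then show ?thesis
    by (simp add: nn_integral_eq_integral F_int_set assms F_pos)
qed

text \<open>\<open>height\<close> does not see the auxiliary coordinates, so the shear preserves it
  and the shear by \<open>- t\<close> is the inverse. In the image of a box an auxiliary condition
  reads |y_k + t height| \<le> a_k; divided by t, it tends to a slab condition on the height
  alone.\<close>

definition shear :: "real \<Rightarrow> (nat \<Rightarrow> real) \<Rightarrow> nat \<Rightarrow> real" where
  "shear t y = (\<lambda>k. if 1 \<le> k \<and> k \<le> p then y k - t * height (k - 1) y else y k)"

lemma height_shear [simp]: "height i (shear t y) = height i y"
  by (simp add: height_def shear_def)

lemma shear_shear: "shear t (shear (- t) y) = y"
proof
  fix k show "shear t (shear (- t) y) k = y k"
    unfolding shear_def[of t] height_shear by (simp add: shear_def)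
qed

lemma shear_Rn: "y \<in> Rn N \<Longrightarrow> shear t y \<in> Rn N"
  by (auto simp: Rn_eq shear_def N_eq)

lemma shear_GL: "shear t \<in> GL N"
proof -
  have h: "height i (x + y) = height i x + height i y" "height i (c *\<^sub>R x) = c * height i x" for i x y c
    unfolding height_def dot_def by (simp_all add: algebra_simps sum.distrib[symmetric] sum_distrib_left)
  have "linear (shear t)"
    by (rule linearI) (auto simp: shear_def h fun_eq_iff algebra_simps)
  moreover have "bij_betw (shear t) (Rn N) (Rn N)"
    using shear_shear[of t] shear_shear[of "- t"]
    by (intro bij_betw_byWitness[where f'="shear (- t)"]) (auto simp: shear_Rn)
  ultimately show ?thesis by (simp add: GL_def)
qed

lemma shear_image:
  "shear t ` symbox N a = {y \<in> Rn N. \<forall>k<N. \<bar>if 1 \<le> k \<and> k \<le> p then y k + t * height (k - 1) y else y k\<bar> \<le> a k}"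
  (is "_ = ?R")
proof -
  have "shear t ` symbox N a = {y. shear (- t) y \<in> symbox N a}"
  proof safe
    fix y assume "shear (- t) y \<in> symbox N a"
    then show "y \<in> shear t ` symbox N a" by (intro image_eqI[of _ _ "shear (- t) y"]) (simp_all add: shear_shear)
  qed (use shear_shear[of "- t"] in simp)
  also have "\<dots> = ?R"
  proof -
    have "shear (- t) y \<in> Rn N \<longleftrightarrow> y \<in> Rn N" for y
      using shear_Rn[of y "- t"] shear_Rn[of "shear (- t) y" t] by (auto simp: shear_shear)
    then show ?thesis by (auto simp: symbox_def shear_def)
  qed
  finally show ?thesis .
qed

text \<open>With t = \<open>Suc j\<close>, an auxiliary side of about t \<alpha> becomes the slab
  width \<alpha> after division by t. The factor 1 + 1 / sqrt t leaves a slack of order 1 / sqrt t,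
  which beats the perturbation y_k / t, so that points on the boundary of a slab are captured too.
  The last sides t exhaust the space. All factors in t are common to the boxes and survive geometric
  means.\<close>

definition bsize :: "nat \<Rightarrow> (nat \<Rightarrow> real) \<Rightarrow> real \<Rightarrow> nat \<Rightarrow> real" where
  "bsize j \<alpha> R k = (if k = 0 then R else if k \<le> p then real (Suc j) * (1 + 1 / sqrt (real (Suc j))) * \<alpha> (k - 1)
     else real (Suc j))"

definition bset :: "nat \<Rightarrow> (nat \<Rightarrow> real) \<Rightarrow> real \<Rightarrow> (nat \<Rightarrow> real) set" where
  "bset j \<alpha> R = shear (real (Suc j)) ` symbox N (bsize j \<alpha> R)"

lemma bset_iff:
  assumes "y \<in> Rn N"
  shows "y \<in> bset j \<alpha> R \<longleftrightarrow> \<bar>y 0\<bar> \<le> R \<and>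
    (\<forall>i<p. \<bar>y (Suc i) / real (Suc j) + height i y\<bar> \<le> (1 + 1 / sqrt (real (Suc j))) * \<alpha> i) \<and>
    (\<forall>l<d. \<bar>y (Suc p + l)\<bar> \<le> real (Suc j))" (is "_ \<longleftrightarrow> ?R")
proof -
  let ?j = "real (Suc j)"
  have *: "\<bar>y (Suc i) + ?j * height i y\<bar> \<le> ?j * (1 + 1 / sqrt ?j) * \<alpha> i \<longleftrightarrow>
    \<bar>y (Suc i) / ?j + height i y\<bar> \<le> (1 + 1 / sqrt ?j) * \<alpha> i" for i
  proof -
    have "y (Suc i) + ?j * height i y = ?j * (y (Suc i) / ?j + height i y)" by (simp add: field_simps)
    then have "\<bar>y (Suc i) + ?j * height i y\<bar> = ?j * \<bar>y (Suc i) / ?j + height i y\<bar>"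
      by (simp only: abs_mult abs_of_nat)
    then show ?thesis
      using mult_le_cancel_left_pos[of ?j "\<bar>y (Suc i) / ?j + height i y\<bar>" "(1 + 1 / sqrt ?j) * \<alpha> i"]
      by (simp only: mult.assoc)
  qed
  have split: "(\<forall>k<N. P k) \<longleftrightarrow> P 0 \<and> (\<forall>i<p. P (Suc i)) \<and> (\<forall>l<d. P (Suc p + l))" for P
  proof safe
    fix k assume P: "P 0" "\<forall>i<p. P (Suc i)" "\<forall>l<d. P (Suc p + l)" and k: "k < N"
    consider "k = 0" | i where "k = Suc i" "i < p" | l where "k = Suc p + l" "l < d"
    proof (cases "k \<le> p")
      case True then show ?thesis using that by (cases k) auto
    next
      case False
      then have "k = Suc p + (k - Suc p)" "k - Suc p < d" using k by (auto simp: N_eq)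
      then show ?thesis by (rule that(3))
    qed
    then show "P k" using P by cases auto
  qed (auto simp: N_eq)
  show ?thesis
    unfolding bset_def shear_image using assms
    by (simp only: mem_Collect_eq split simp_thms) (simp add: bsize_def * del: of_nat_Suc)
qed

lemma bset_borel: "bset j \<alpha> R \<in> sets borel"
  unfolding bset_def shear_image by measurable

lemma bset_tendsto:
  assumes y: "y \<in> Rn N" and \<alpha>: "\<And>i. 0 < \<alpha> i"
  shows "(\<lambda>j. indicator (bset j \<alpha> R) y :: real) \<longlonglongrightarrow> indicator (tset \<alpha> R) y"
proof -
  have sq: "filterlim (\<lambda>j. sqrt (real (Suc j))) at_top sequentially"
    by (rule filterlim_compose[OF sqrt_at_top]) (rule filterlim_compose[OF filterlim_real_sequentially filterlim_Suc])
  have j: "filterlim (\<lambda>j. real (Suc j)) at_top sequentially"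
    by (rule filterlim_compose[OF filterlim_real_sequentially filterlim_Suc])
  have "\<forall>\<^sub>F j in sequentially. (y \<in> bset j \<alpha> R) = (y \<in> tset \<alpha> R)"
  proof (cases "y \<in> tset \<alpha> R")
    case True
    have "\<forall>\<^sub>F j in sequentially. \<forall>l\<in>{..<d}. \<bar>y (Suc p + l)\<bar> \<le> real (Suc j)"
      using j by (intro eventually_ball_finite) (auto simp: filterlim_at_top)
    moreover have "\<forall>\<^sub>F j in sequentially. \<forall>i\<in>{..<p}. \<bar>y (Suc i)\<bar> / \<alpha> i \<le> sqrt (real (Suc j))"
      using sq by (intro eventually_ball_finite) (auto simp: filterlim_at_top)
    ultimately show ?thesis
    proof eventually_elim
      case (elim j)
      have "\<bar>y (Suc i) / real (Suc j) + height i y\<bar> \<le> (1 + 1 / sqrt (real (Suc j))) * \<alpha> i" if i: "i < p" for i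
      proof -
        define s where "s = sqrt (real (Suc j))"
        have s: "real (Suc j) = s * s" "s > 0" by (simp_all add: s_def)
        have "\<bar>y (Suc i)\<bar> \<le> s * \<alpha> i" using bspec[OF elim(2), of i] i \<alpha>[of i] by (simp add: pos_divide_le_eq s_def del: of_nat_Suc)
        then have "\<bar>y (Suc i)\<bar> / (s * s) \<le> s * \<alpha> i / (s * s)" by (intro divide_right_mono) auto
        then have "\<bar>y (Suc i) / real (Suc j)\<bar> \<le> \<alpha> i / s"
          unfolding s(1) using s(2) by (simp add: abs_mult)
        moreover have "\<bar>height i y\<bar> \<le> \<alpha> i" using True i by (simp add: tset_def)
        moreover have "(1 + 1 / s) * \<alpha> i = \<alpha> i + \<alpha> i / s" by (simp add: distrib_right)
        ultimately show ?thesis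
          using abs_triangle_ineq[of "y (Suc i) / real (Suc j)" "height i y"] unfolding s_def[symmetric] by linarith
      qed
      then show ?case using elim True by (simp add: bset_iff[OF y]) (simp add: tset_def)
    qed
  next
    case False
    then consider "R < \<bar>y 0\<bar>" | i where "i < p" "\<alpha> i < \<bar>height i y\<bar>"
      by (auto simp: tset_def not_le)
    then show ?thesis
    proof cases
      case 1 then show ?thesis using False by (auto simp: bset_iff[OF y])
    next
      case (2 i)
      have "(\<lambda>j. y (Suc i) / real (Suc j)) \<longlonglongrightarrow> 0"
        by (rule real_tendsto_divide_at_top[OF tendsto_const j])
      from tendsto_rabs[OF tendsto_add[OF this tendsto_const[of "height i y"]]]
      have l1: "(\<lambda>j. \<bar>y (Suc i) / real (Suc j) + height i y\<bar>) \<longlonglongrightarrow> \<bar>height i y\<bar>" by simp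
      have "(\<lambda>j. 1 / sqrt (real (Suc j))) \<longlonglongrightarrow> 0"
        by (rule real_tendsto_divide_at_top[OF tendsto_const sq])
      from tendsto_mult[OF tendsto_add[OF tendsto_const[of 1] this] tendsto_const[of "\<alpha> i"]]
      have l2: "(\<lambda>j. (1 + 1 / sqrt (real (Suc j))) * \<alpha> i) \<longlonglongrightarrow> \<alpha> i" by simp
      define c where "c = (\<alpha> i + \<bar>height i y\<bar>) / 2"
      have c: "c < \<bar>height i y\<bar>" "\<alpha> i < c" using 2 by (auto simp: c_def)
      from order_tendstoD(1)[OF l1 c(1)] order_tendstoD(2)[OF l2 c(2)]
      show ?thesis
      proof eventually_elim
        case (elim j)
        then show ?case using False 2 bset_iff[OF y, of j \<alpha> R] by (auto simp del: of_nat_Suc)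
      qed
    qed
  qed
  then have "\<forall>\<^sub>F j in sequentially. indicator (bset j \<alpha> R) y = (indicator (tset \<alpha> R) y :: real)"
    by eventually_elim (simp add: indicator_def)
  then show ?thesis by (rule tendsto_eventually)
qed

lemma bset_integral_tendsto:
  assumes "\<And>i. 0 < \<alpha> i"
  shows "(\<lambda>j. \<integral>y. F y * indicator (bset j \<alpha> R) y \<partial>lam N) \<longlonglongrightarrow> G \<alpha> R"
  unfolding G_def
proof (rule integral_dominated_convergence[where w=F])
  show "AE y in lam N. (\<lambda>j. F y * indicator (bset j \<alpha> R) y) \<longlonglongrightarrow> F y * indicator (tset \<alpha> R) y"
    using AE_lam_Rn by eventually_elim (intro tendsto_mult tendsto_const bset_tendsto assms)
qed (use F_int bset_borel in \<open>auto simp: F_pos indicator_def\<close>)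

text \<open>The inequality for sheared boxes passes to the limit, since their masses converge by
  dominated convergence with majorant \<open>F\<close>.\<close>

lemma G_log_concave:
  assumes \<alpha>: "\<And>i. 0 < \<alpha> i" and \<beta>: "\<And>i. 0 < \<beta> i" and R: "0 < R" "0 < R'" and c: "0 < c" "c < 1"
  shows "G \<alpha> R powr c * G \<beta> R' powr (1 - c) \<le> G (\<lambda>i. \<alpha> i powr c * \<beta> i powr (1 - c)) (R powr c * R' powr (1 - c))"
proof (rule LIMSEQ_le)
  let ?\<gamma> = "\<lambda>i. \<alpha> i powr c * \<beta> i powr (1 - c)" and ?R = "R powr c * R' powr (1 - c)"
  let ?I = "\<lambda>j \<alpha> R. \<integral>y. F y * indicator (bset j \<alpha> R) y \<partial>lam N"
  have pos: "0 \<le> ?I j \<alpha> R" for j \<alpha> R by (intro Bochner_Integration.integral_nonneg) (auto simp: F_pos)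
  show "(\<lambda>j. ?I j \<alpha> R powr c * ?I j \<beta> R' powr (1 - c)) \<longlonglongrightarrow> G \<alpha> R powr c * G \<beta> R' powr (1 - c)"
    by (intro tendsto_mult tendsto_powr' bset_integral_tendsto \<alpha> \<beta> tendsto_const) (use c pos in auto)
  show "(\<lambda>j. ?I j ?\<gamma> ?R) \<longlonglongrightarrow> G ?\<gamma> ?R"
    by (intro bset_integral_tendsto) (use \<alpha> \<beta> in \<open>simp add: less_imp_neq[THEN not_sym]\<close>)
  have "?I j \<alpha> R powr c * ?I j \<beta> R' powr (1 - c) \<le> ?I j ?\<gamma> ?R" for j
  proof -
    have powr_one: "x powr c * x powr (1 - c) = x" if "0 < x" for x :: real
      using that by (simp add: powr_add[symmetric])
    have bs: "bsize j \<alpha> R k powr c * bsize j \<beta> R' k powr (1 - c) = bsize j ?\<gamma> ?R k" for k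
    proof -
      let ?q = "real (Suc j) * (1 + 1 / sqrt (real (Suc j)))"
      have q: "0 < ?q" by (intro mult_pos_pos add_pos_nonneg) auto
      have "(?q * a) powr c * (?q * b) powr (1 - c) = ?q * (a powr c * b powr (1 - c))" if "0 < a" "0 < b" for a b
      proof -
        have "(?q * a) powr c * (?q * b) powr (1 - c) = (?q powr c * ?q powr (1 - c)) * (a powr c * b powr (1 - c))"
          using q that by (simp only: powr_mult less_imp_le) (simp only: mult_ac)
        then show ?thesis by (simp only: powr_one[OF q])
      qed
      then show ?thesis using \<alpha> \<beta> powr_one[of "real (Suc j)"] by (simp add: bsize_def del: of_nat_Suc)
    qed
    have "0 < bsize j \<alpha> R k \<and> 0 < bsize j \<beta> R' k" for k
      using R \<alpha> \<beta> by (auto simp: bsize_def intro!: mult_pos_pos add_pos_nonneg)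
    then have "ennpow (int_over N f (bset j \<alpha> R)) c * ennpow (int_over N f (bset j \<beta> R')) (1 - c) \<le>
        int_over N f (bset j ?\<gamma> ?R)"
      using f_ineq[unfolded box_ineq_def, rule_format, OF shear_GL[of "real (Suc j)"], of "bsize j \<alpha> R" "bsize j \<beta> R'" c] c
      by (simp add: bset_def bs del: of_nat_Suc)
    then show ?thesis
      by (simp add: int_over_eq[OF bset_borel] ennpow_ennreal pos ennreal_mult''[symmetric] ennreal_le_iff)
  qed
  then show "\<exists>N. \<forall>j\<ge>N. ?I j \<alpha> R powr c * ?I j \<beta> R' powr (1 - c) \<le> ?I j ?\<gamma> ?R" by blast
qed

end

section \<open>Increments of tube masses and elimination of the mass near the origin\<close>

definition slabs :: "nat \<Rightarrow> nat \<Rightarrow> (nat \<Rightarrow> nat \<Rightarrow> real) \<Rightarrow> (nat \<Rightarrow> real) \<Rightarrow> (nat \<Rightarrow> real) set" where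
  "slabs d p u \<alpha> = {x. \<forall>i<p. \<bar>dot d (u i) x\<bar> \<le> \<alpha> i}"

lemma slabs_borel [measurable]: "slabs d p u \<alpha> \<in> sets borel"
  unfolding slabs_def by measurable

text \<open>Quantitative form of the principle that a concave function bounded below on a long
  interval is nearly constant at its end: \<open>g0\<close>, about which nothing is known, is
  bounded by the increments alone, and the bound tends to 0 with \<theta>. The logarithmic
  inequality ln g2 - ln g1 \<le> \<theta> (ln g2 - ln g0) is combined with 1 - 1/x \<le> ln x \<le>
  x - 1.\<close>

lemma log_concave_increment_bound:
  fixes g0 g1 g2 \<theta> :: real
  assumes g0: "0 \<le> g0" and g: "g0 \<le> g1" "g1 < g2" and \<theta>: "0 < \<theta>" "\<theta> < 1"
    and conc: "g0 powr \<theta> * g2 powr (1 - \<theta>) \<le> g1"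
  shows "g0 * ((g2 - g1) - \<theta> * (g2 - g0)) \<le> \<theta> * (g2 - g0)\<^sup>2"
proof (cases "g0 = 0")
  case False
  then have pos: "0 < g0" "0 < g1" "0 < g2" using g0 g by auto
  have "\<theta> * ln g0 + (1 - \<theta>) * ln g2 = ln (g0 powr \<theta> * g2 powr (1 - \<theta>))"
    using pos by (simp add: ln_mult ln_powr)
  also have "\<dots> \<le> ln g1" using conc pos by (intro iffD2[OF ln_le_cancel_iff]) auto
  finally have "ln g2 - ln g1 \<le> \<theta> * (ln g2 - ln g0)" by (simp add: algebra_simps)
  moreover have "ln g1 - ln g2 \<le> g1 / g2 - 1"
    using ln_le_minus_one[of "g1 / g2"] pos by (simp add: ln_div)
  moreover have "ln g2 - ln g0 \<le> g2 / g0 - 1"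
    using ln_le_minus_one[of "g2 / g0"] pos by (simp add: ln_div)
  then have "\<theta> * (ln g2 - ln g0) \<le> \<theta> * (g2 / g0 - 1)" using \<theta> by (intro mult_left_mono) auto
  ultimately have "1 - g1 / g2 \<le> \<theta> * (g2 / g0 - 1)" by linarith
  then have "(1 - g1 / g2) * (g0 * g2) \<le> \<theta> * (g2 / g0 - 1) * (g0 * g2)"
    using pos by (intro mult_right_mono) auto
  moreover have "(1 - g1 / g2) * (g0 * g2) = g0 * (g2 - g1)" "(g2 / g0 - 1) * (g0 * g2) = (g2 - g0) * g2"
    using pos by (simp_all add: field_simps)
  ultimately have "g0 * (g2 - g1) \<le> \<theta> * ((g2 - g0) * g2)" by (simp only: mult.assoc)
  then show ?thesis by (simp add: algebra_simps power2_eq_square)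
qed (use \<theta> in simp)

context tube
begin

lemma height_join: "height i (join (Suc p) z x) = dot d (u i) (x - z 0 *\<^sub>R m)"
  by (simp add: height_def join_def fun_diff_def fun_eq_iff dot_def)

lemma tset_mono: "R \<le> R' \<Longrightarrow> tset \<alpha> R \<subseteq> tset \<alpha> R'"
  by (auto simp: tset_def)

lemma G_mono: "R \<le> R' \<Longrightarrow> G \<alpha> R \<le> G \<alpha> R'"
  unfolding G_def using tset_mono[of R R' \<alpha>]
  by (intro integral_mono F_int_set) (auto simp: F_pos indicator_def)

text \<open>Translating by z_0 m and dilating by r in the x variable turns each section of the tube
  into the fixed set \<open>slabs d p u \<alpha>\<close>; the dilation contributes r^d, and
  \<open>F\<close> is evaluated close to the axis.\<close>

lemma G_increment:
  assumes r: "0 < r" and R: "R \<le> R'"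
  shows "ennreal (G (\<lambda>i. r * \<alpha> i) R' - G (\<lambda>i. r * \<alpha> i) R) = ennreal (r ^ d) *
    (\<integral>\<^sup>+x. indicator (slabs d p u \<alpha>) x * (\<integral>\<^sup>+z. indicator {z. R < \<bar>z 0\<bar> \<and> \<bar>z 0\<bar> \<le> R'} z *
       ennreal (F (join (Suc p) z (z 0 *\<^sub>R m + r *\<^sub>R x))) \<partial>lam (Suc p)) \<partial>lam d)"
proof -
  interpret M: sigma_finite_measure "lam (Suc p)" by (rule sigma_finite_lam)
  interpret D: sigma_finite_measure "lam d" by (rule sigma_finite_lam)
  interpret P: pair_sigma_finite "lam d" "lam (Suc p)" ..
  let ?\<alpha> = "\<lambda>i. r * \<alpha> i" and ?I = "\<lambda>z. indicator {z::nat\<Rightarrow>real. R < \<bar>z 0\<bar> \<and> \<bar>z 0\<bar> \<le> R'} z :: ennreal"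
  let ?T = "tset ?\<alpha> R' - tset ?\<alpha> R"
  have "G ?\<alpha> R' - G ?\<alpha> R = (\<integral>y. F y * indicator (tset ?\<alpha> R') y - F y * indicator (tset ?\<alpha> R) y \<partial>lam N)"
    unfolding G_def by (intro Bochner_Integration.integral_diff[symmetric] F_int_set) auto
  also have "\<dots> = (\<integral>y. F y * indicator ?T y \<partial>lam N)"
    using tset_mono[OF R, of ?\<alpha>] by (intro Bochner_Integration.integral_cong) (auto simp: indicator_def)
  finally have "ennreal (G ?\<alpha> R' - G ?\<alpha> R) = (\<integral>\<^sup>+y. ennreal (F y * indicator ?T y) \<partial>lam N)"
    by (simp add: nn_integral_eq_integral F_int_set F_pos)
  also have "\<dots> = (\<integral>\<^sup>+z. (\<integral>\<^sup>+x. ennreal (F (join (Suc p) z x) * indicator ?T (join (Suc p) z x)) \<partial>lam d) \<partial>lam (Suc p))"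
    unfolding N_eq by (rule nn_integral_lam_join) measurable
  also have "\<dots> = (\<integral>\<^sup>+z. (\<integral>\<^sup>+x. ennreal (r ^ d) * (indicator (slabs d p u \<alpha>) x * (?I z *
       ennreal (F (join (Suc p) z (z 0 *\<^sub>R m + r *\<^sub>R x))))) \<partial>lam d) \<partial>lam (Suc p))"
  proof (rule nn_integral_cong)
    fix z :: "nat \<Rightarrow> real"
    define \<phi> where "\<phi> x = ?I z * (ennreal (F (join (Suc p) z (z 0 *\<^sub>R m + x))) * indicator (slabs d p u ?\<alpha>) x)" for x
    have [measurable]: "\<phi> \<in> borel_measurable borel" unfolding \<phi>_def by measurable
    have "join (Suc p) z x \<in> ?T \<longleftrightarrow> R < \<bar>z 0\<bar> \<and> \<bar>z 0\<bar> \<le> R' \<and> x - z 0 *\<^sub>R m \<in> slabs d p u ?\<alpha>" for x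
      by (auto simp: tset_def height_join slabs_def) (auto simp: join_def)
    then have "ennreal (F (join (Suc p) z x) * indicator ?T (join (Suc p) z x)) = \<phi> (x + - (z 0 *\<^sub>R m))" for x
      by (auto simp: \<phi>_def indicator_def)
    then have "(\<integral>\<^sup>+x. ennreal (F (join (Suc p) z x) * indicator ?T (join (Suc p) z x)) \<partial>lam d) = (\<integral>\<^sup>+x. \<phi> (x + - (z 0 *\<^sub>R m)) \<partial>lam d)"
      by simp
    also have "\<dots> = (\<integral>\<^sup>+x. \<phi> x \<partial>lam d)"
      by (intro nn_integral_lam_translate Rn_uminus Rn_scale m_Rn) measurable
    also have "\<dots> = ennreal (r ^ d) * (\<integral>\<^sup>+x. \<phi> (r *\<^sub>R x) \<partial>lam d)"
      using r by (subst nn_integral_lam_scale) (auto simp: mult.assoc[symmetric] ennreal_mult[symmetric])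
    also have "\<dots> = (\<integral>\<^sup>+x. ennreal (r ^ d) * \<phi> (r *\<^sub>R x) \<partial>lam d)"
      by (rule nn_integral_cmult[symmetric]) measurable
    finally have eq: "(\<integral>\<^sup>+x. ennreal (F (join (Suc p) z x) * indicator ?T (join (Suc p) z x)) \<partial>lam d) =
      (\<integral>\<^sup>+x. ennreal (r ^ d) * \<phi> (r *\<^sub>R x) \<partial>lam d)" .
    have \<phi>r: "\<phi> (r *\<^sub>R x) = indicator (slabs d p u \<alpha>) x * (?I z * ennreal (F (join (Suc p) z (z 0 *\<^sub>R m + r *\<^sub>R x))))" for x
    proof -
      have "r *\<^sub>R x \<in> slabs d p u ?\<alpha> \<longleftrightarrow> x \<in> slabs d p u \<alpha>"
        using r by (simp add: slabs_def dot_scale abs_mult)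
      then show ?thesis by (simp add: \<phi>_def indicator_def)
    qed
    show "(\<integral>\<^sup>+x. ennreal (F (join (Suc p) z x) * indicator ?T (join (Suc p) z x)) \<partial>lam d) =
      (\<integral>\<^sup>+x. ennreal (r ^ d) * (indicator (slabs d p u \<alpha>) x * (?I z *
       ennreal (F (join (Suc p) z (z 0 *\<^sub>R m + r *\<^sub>R x))))) \<partial>lam d)"
      unfolding eq \<phi>r ..
  qed
  also have "\<dots> = (\<integral>\<^sup>+x. (\<integral>\<^sup>+z. ennreal (r ^ d) * (indicator (slabs d p u \<alpha>) x * (?I z *
       ennreal (F (join (Suc p) z (z 0 *\<^sub>R m + r *\<^sub>R x))))) \<partial>lam (Suc p)) \<partial>lam d)"
    by (rule P.Fubini') measurable
  also have "\<dots> = ennreal (r ^ d) * (\<integral>\<^sup>+x. (\<integral>\<^sup>+z. (indicator (slabs d p u \<alpha>) x * (?I z *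
       ennreal (F (join (Suc p) z (z 0 *\<^sub>R m + r *\<^sub>R x))))) \<partial>lam (Suc p)) \<partial>lam d)"
    by (simp add: nn_integral_cmult)
  also have "\<dots> = ennreal (r ^ d) * (\<integral>\<^sup>+x. indicator (slabs d p u \<alpha>) x * (\<integral>\<^sup>+z. (?I z *
       ennreal (F (join (Suc p) z (z 0 *\<^sub>R m + r *\<^sub>R x)))) \<partial>lam (Suc p)) \<partial>lam d)"
    by (intro arg_cong2[where f="(*)"] refl nn_integral_cong nn_integral_cmult) measurable
  finally show ?thesis .
qed

text \<open>In the application \<open>q k\<close> is the fibre integral over 1/k < |z_0| \<le> n, so
  \<open>conv\<close> says that a scaled increment tends to volume times \<open>q k\<close>. For
  \<gamma> the inner mass is bounded through the increments, while for \<open>a\<close> and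
  \<open>b\<close> dropping the inner mass only weakens the left side. First j tends to infinity,
  then k; the bound \<open>Q\<close> on \<open>q\<close> makes \<open>\<theta> k * q k\<close>
  vanish in the second limit.\<close>

lemma volume_limit:
  fixes r :: "nat \<Rightarrow> real" and q :: "nat \<Rightarrow> real" and a b :: "nat \<Rightarrow> real" and c :: real
  assumes \<gamma>_def: "\<gamma> = (\<lambda>i. a i powr c * b i powr (1 - c))"
    and a: "\<And>i. 0 < a i" and b: "\<And>i. 0 < b i" and c: "0 < c" "c < 1" and n: "2 \<le> n"
    and r: "\<And>j. 0 < r j"
    and conv: "\<And>X k. X \<in> {a, b, \<gamma>} \<Longrightarrow> n \<le> k \<Longrightarrow>
      (\<lambda>j. (G (\<lambda>i. r j * X i) (real n) - G (\<lambda>i. r j * X i) (1 / real k)) / r j ^ d) \<longlonglongrightarrow> V X * q k"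
    and q: "0 < q n" "\<And>k. n \<le> k \<Longrightarrow> q n \<le> q k \<and> q k \<le> Q"
    and V: "0 \<le> V a" "0 \<le> V b" "0 < V \<gamma>"
  shows "V a powr c * V b powr (1 - c) \<le> V \<gamma>"
proof -
  \<comment> \<open>The weight with (1/k)^\<theta> n^(1 - \<theta>) = 1/n, which puts the three
    radii 1/k, 1/n, n into the position of \<open>log_concave_increment_bound\<close>. It tends to 0
    as k grows.\<close>
  define \<theta> where "\<theta> k = ln (real n * real n) / ln (real n * real k)" for k
  define W where "W = V a powr c * V b powr (1 - c)"
  define B where "B X k j = (G (\<lambda>i. r j * X i) (real n) - G (\<lambda>i. r j * X i) (1 / real k)) / r j ^ d" for X k j
  have Bconv: "B X k \<longlonglongrightarrow> V X * q k" if "X \<in> {a, b, \<gamma>}" "n \<le> k" for X k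
    using conv[OF that] unfolding B_def .
  have powr_one: "x powr e * x powr (1 - e) = x" if "0 < x" for x e :: real
    using that by (simp add: powr_add[symmetric])
  have \<gamma>: "0 < \<gamma> i" for i using a[of i] b[of i] by (simp add: \<gamma>_def)
  have Bpos: "0 \<le> B X k j" if "n \<le> k" for X k j
  proof -
    have "1 / real k \<le> 1" using that n by simp
    also have "1 \<le> real n" using n by simp
    finally have "1 / real k \<le> real n" .
    then show ?thesis unfolding B_def using r[of j] by (intro divide_nonneg_nonneg) (auto intro: G_mono)
  qed
  have \<theta>: "0 < \<theta> k" "\<theta> k < 1" if "n < k" for k
  proof -
    have "1 < real n * real n" using n by (metis less_1_mult of_nat_1 of_nat_less_iff one_less_numeral_iff order_less_le_trans semiring_norm(76) of_nat_numeral numeral_le_real_of_nat_iff)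
    moreover have "real n * real n < real n * real k" using that n by simp
    ultimately have l: "0 < ln (real n * real n)" "ln (real n * real n) < ln (real n * real k)" by auto
    then show "0 < \<theta> k" "\<theta> k < 1" unfolding \<theta>_def by (auto simp: divide_less_eq_1)
  qed
  \<comment> \<open>Let g0 be the scaled mass of the \<gamma> tube at radius 1/k, and B_n, B_k its
    increments. The increment bound gives g0 (B_n - \<theta> B_k) \<le> \<theta> B_k^2, and
    log-concavity between \<open>a\<close> and \<open>b\<close> at radius n bounds their mean by B_k
    + g0. Multiplying the latter by the positive B_n - \<theta> B_k eliminates g0.\<close>
  have key: "(B \<gamma> n j - \<theta> k * B \<gamma> k j) * (B a k j powr c * B b k j powr (1 - c)) \<le>
     B \<gamma> k j * (B \<gamma> n j - \<theta> k * B \<gamma> k j) + \<theta> k * (B \<gamma> k j)\<^sup>2"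
    if k: "n < k" and pos: "0 < B \<gamma> n j - \<theta> k * B \<gamma> k j" for k j
  proof -
    define g where "g X R = G (\<lambda>i. r j * X i) R / r j ^ d" for X R
    have rd: "0 < r j ^ d" using r by simp
    have g0: "0 \<le> g X R" for X R unfolding g_def using G_nonneg rd by (intro divide_nonneg_pos)
    have Bg: "B X l j = g X (real n) - g X (1 / real l)" for X l by (simp add: B_def g_def diff_divide_distrib)
    have gconc: "g X R powr e * g Y R' powr (1 - e) \<le> g (\<lambda>i. X i powr e * Y i powr (1 - e)) (R powr e * R' powr (1 - e))"
      if "\<And>i. 0 < X i" "\<And>i. 0 < Y i" "0 < R" "0 < R'" "0 < e" "e < 1" for X Y R R' e
    proof -
      have "g X R powr e * g Y R' powr (1 - e) =
          G (\<lambda>i. r j * X i) R powr e * G (\<lambda>i. r j * Y i) R' powr (1 - e) / ((r j ^ d) powr e * (r j ^ d) powr (1 - e))"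
        unfolding g_def using G_nonneg rd by (subst (1 2) powr_divide) auto
      also have "\<dots> = G (\<lambda>i. r j * X i) R powr e * G (\<lambda>i. r j * Y i) R' powr (1 - e) / r j ^ d"
        by (simp only: powr_one[OF rd])
      also have "\<dots> \<le> G (\<lambda>i. (r j * X i) powr e * (r j * Y i) powr (1 - e)) (R powr e * R' powr (1 - e)) / r j ^ d"
        using that r[of j] rd by (intro divide_right_mono G_log_concave) auto
      also have "(\<lambda>i. (r j * X i) powr e * (r j * Y i) powr (1 - e)) = (\<lambda>i. r j * (X i powr e * Y i powr (1 - e)))"
      proof
        fix i
        have "(r j * X i) powr e * (r j * Y i) powr (1 - e) = (r j powr e * r j powr (1 - e)) * (X i powr e * Y i powr (1 - e))"
          using r[of j] that(1,2)[of i] by (simp add: powr_mult)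
        then show "(r j * X i) powr e * (r j * Y i) powr (1 - e) = r j * (X i powr e * Y i powr (1 - e))"
          by (simp only: powr_one[OF r])
      qed
      finally show ?thesis by (simp only: g_def)
    qed
    have n0: "0 < real n" "0 < real k" "0 < 1 / real k" using n k by auto
    have th: "0 < \<theta> k" "\<theta> k < 1" using \<theta> k by auto
    have Rth: "(1 / real k) powr \<theta> k * real n powr (1 - \<theta> k) = 1 / real n"
    proof -
      have l: "0 < ln (real n * real k)"
        using n k by (metis th(1) \<theta>_def ln_gt_zero less_1_mult of_nat_1 of_nat_less_iff order_less_trans one_less_numeral_iff semiring_norm(76) of_nat_numeral numeral_le_real_of_nat_iff order_less_le_trans)
      have "(1 / real k) powr \<theta> k * real n powr (1 - \<theta> k) = exp (\<theta> k * ln (1 / real k) + (1 - \<theta> k) * ln (real n))"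
        using n0 by (simp add: powr_def exp_add)
      also have "\<theta> k * ln (1 / real k) + (1 - \<theta> k) * ln (real n) = ln (real n) - \<theta> k * ln (real n * real k)"
        using n0 by (simp add: ln_div ln_mult algebra_simps)
      also have "\<theta> k * ln (real n * real k) = ln (real n * real n)"
        using l by (simp add: \<theta>_def)
      also have "ln (real n) - ln (real n * real n) = ln (1 / real n)"
        using n0 by (simp add: ln_div ln_mult)
      finally show ?thesis using n0 by simp
    qed
    have "g \<gamma> (1 / real k) powr \<theta> k * g \<gamma> (real n) powr (1 - \<theta> k) \<le>
       g (\<lambda>i. \<gamma> i powr \<theta> k * \<gamma> i powr (1 - \<theta> k)) ((1 / real k) powr \<theta> k * real n powr (1 - \<theta> k))"
      by (rule gconc) (use \<gamma> n0 th in auto)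
    then have c1: "g \<gamma> (1 / real k) powr \<theta> k * g \<gamma> (real n) powr (1 - \<theta> k) \<le> g \<gamma> (1 / real n)"
      by (simp only: Rth powr_one[OF \<gamma>])
    have "g \<gamma> (1 / real k) \<le> g \<gamma> (1 / real n)"
      unfolding g_def using k n rd by (intro divide_right_mono G_mono divide_left_mono) auto
    moreover have "0 < B \<gamma> n j"
      using pos th Bpos[of k \<gamma> j] k mult_nonneg_nonneg[of "\<theta> k" "B \<gamma> k j"] by linarith
    ultimately have "g \<gamma> (1 / real k) * (B \<gamma> n j - \<theta> k * B \<gamma> k j) \<le> \<theta> k * (B \<gamma> k j)\<^sup>2"
      unfolding Bg by (intro log_concave_increment_bound g0 th c1) auto
    moreover have "B a k j powr c * B b k j powr (1 - c) \<le> g \<gamma> (real n)"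
    proof -
      have "B a k j powr c * B b k j powr (1 - c) \<le> g a (real n) powr c * g b (real n) powr (1 - c)"
        using Bpos[of k a j] Bpos[of k b j] k c g0[of a "1/real k"] g0[of b "1/real k"]
        by (intro mult_mono powr_mono2) (auto simp: Bg)
      also have "\<dots> \<le> g \<gamma> (real n powr c * real n powr (1 - c))"
        unfolding \<gamma>_def by (rule gconc) (use a b c n0 in auto)
      finally show ?thesis by (simp only: powr_one[OF n0(1)])
    qed
    then have "(B \<gamma> n j - \<theta> k * B \<gamma> k j) * (B a k j powr c * B b k j powr (1 - c)) \<le> (B \<gamma> n j - \<theta> k * B \<gamma> k j) * g \<gamma> (real n)"
      using pos by (intro mult_left_mono) auto
    moreover have "g \<gamma> (real n) = B \<gamma> k j + g \<gamma> (1 / real k)" by (simp add: Bg)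
    ultimately show ?thesis by (simp add: algebra_simps)
  qed
  have \<theta>0: "\<theta> \<longlonglongrightarrow> 0"
  proof -
    have "filterlim (\<lambda>k. real n * real k) at_top sequentially"
      using n by (intro filterlim_tendsto_pos_mult_at_top[OF tendsto_const _ filterlim_real_sequentially]) auto
    from filterlim_compose[OF ln_at_top this]
    show ?thesis unfolding \<theta>_def by (rule real_tendsto_divide_at_top[OF tendsto_const])
  qed
  \<comment> \<open>After the limit over j the two terms \<theta> (V \<gamma> q k)^2 cancel, and the
    common factor V \<gamma> q k > 0 can be divided out.\<close>
  have lim: "(q n - \<theta> k * q k) * W \<le> V \<gamma> * q n" if k: "n < k" and pos: "\<theta> k * q k < q n" for k
  proof -
    have qk: "0 < q k" using q(1) q(2)[of k] k by linarith
    have lA: "(\<lambda>j. B \<gamma> n j - \<theta> k * B \<gamma> k j) \<longlonglongrightarrow> V \<gamma> * q n - \<theta> k * (V \<gamma> * q k)"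
      by (intro tendsto_diff tendsto_mult tendsto_const Bconv) (use k in auto)
    have "V \<gamma> * (\<theta> k * q k) < V \<gamma> * q n" using V pos by simp
    then have "0 < V \<gamma> * q n - \<theta> k * (V \<gamma> * q k)" by (simp add: algebra_simps)
    from order_tendstoD(1)[OF lA this]
    have ev: "\<forall>\<^sub>F j in sequentially. (B \<gamma> n j - \<theta> k * B \<gamma> k j) * (B a k j powr c * B b k j powr (1 - c)) \<le>
     B \<gamma> k j * (B \<gamma> n j - \<theta> k * B \<gamma> k j) + \<theta> k * (B \<gamma> k j)\<^sup>2"
      by eventually_elim (rule key[OF k])
    have l1: "(\<lambda>j. (B \<gamma> n j - \<theta> k * B \<gamma> k j) * (B a k j powr c * B b k j powr (1 - c))) \<longlonglongrightarrow>
      (V \<gamma> * q n - \<theta> k * (V \<gamma> * q k)) * ((V a * q k) powr c * (V b * q k) powr (1 - c))"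
      by (intro tendsto_mult[OF lA] tendsto_mult tendsto_powr' Bconv tendsto_const) (use c k Bpos in auto)
    have l2: "(\<lambda>j. B \<gamma> k j * (B \<gamma> n j - \<theta> k * B \<gamma> k j) + \<theta> k * (B \<gamma> k j)\<^sup>2) \<longlonglongrightarrow>
      (V \<gamma> * q k) * (V \<gamma> * q n - \<theta> k * (V \<gamma> * q k)) + \<theta> k * (V \<gamma> * q k)\<^sup>2"
      by (intro tendsto_add tendsto_mult[OF _ lA] tendsto_mult tendsto_power tendsto_const Bconv) (use k in auto)
    have "(V a * q k) powr c * (V b * q k) powr (1 - c) = W * (q k powr c * q k powr (1 - c))"
      using V qk by (simp add: powr_mult W_def)
    then have w: "(V a * q k) powr c * (V b * q k) powr (1 - c) = W * q k" by (simp only: powr_one[OF qk])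
    have "(V \<gamma> * q n - \<theta> k * (V \<gamma> * q k)) * (W * q k) \<le>
      (V \<gamma> * q k) * (V \<gamma> * q n - \<theta> k * (V \<gamma> * q k)) + \<theta> k * (V \<gamma> * q k)\<^sup>2"
      by (rule tendsto_le[OF sequentially_bot l2 l1[unfolded w] ev])
    then have "(V \<gamma> * q k) * ((q n - \<theta> k * q k) * W) \<le> (V \<gamma> * q k) * (V \<gamma> * q n)"
      by (simp add: algebra_simps power2_eq_square)
    then show ?thesis using V qk by (simp add: mult_le_cancel_left_pos)
  qed
  have tq: "(\<lambda>k. \<theta> k * q k) \<longlonglongrightarrow> 0"
  proof (rule tendsto_sandwich[OF _ _ tendsto_const])
    show "\<forall>\<^sub>F k in sequentially. 0 \<le> \<theta> k * q k"
      using eventually_gt_at_top[of n]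
    proof eventually_elim
      case (elim k) then show ?case using \<theta>[of k] q(1) q(2)[of k] by simp
    qed
    show "\<forall>\<^sub>F k in sequentially. \<theta> k * q k \<le> \<theta> k * Q"
      using eventually_gt_at_top[of n]
    proof eventually_elim
      case (elim k) then show ?case using \<theta>[of k] q(2)[of k] by simp
    qed
    show "(\<lambda>k. \<theta> k * Q) \<longlonglongrightarrow> 0" using tendsto_mult[OF \<theta>0 tendsto_const[of Q]] by simp
  qed
  have "(\<lambda>k. (q n - \<theta> k * q k) * W) \<longlonglongrightarrow> (q n - 0) * W"
    by (intro tendsto_intros tq)
  moreover have "\<forall>\<^sub>F k in sequentially. (q n - \<theta> k * q k) * W \<le> V \<gamma> * q n"
    using order_tendstoD(2)[OF tq q(1)] eventually_gt_at_top[of n] by eventually_elim (rule lim)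
  ultimately have "(q n - 0) * W \<le> V \<gamma> * q n"
    by (rule tendsto_upperbound) simp
  then show ?thesis using q(1) by (simp add: W_def mult.commute)
qed

end

subsection \<open>Fibres through almost every direction\<close>

lemma AE_lam_coord_nonzero:
  assumes "i < n" shows "AE x in lam n. x i \<noteq> 0"
proof -
  let ?b = "\<lambda>k::nat. symbox n (\<lambda>j. if j = i then 0 else real k)"
  have "?b k \<in> null_sets (lam n)" for k
  proof -
    have "(\<Prod>j<n. 2 * (if j = i then 0 else real k)) = 0" using assms by (intro prod_zero) auto
    then have "emeasure (lam n) (?b k) = 0" by (subst emeasure_lam_symbox) (simp_all del: prod_zero_iff)
    then show ?thesis by (intro null_setsI) simp_all
  qed
  then have "(\<Union>k. ?b k) \<in> null_sets (lam n)" by blast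
  then have "AE x in lam n. x \<notin> (\<Union>k. ?b k)" by (rule AE_not_in)
  with AE_lam_Rn[of n] show ?thesis
  proof eventually_elim
    case (elim x)
    obtain k where k: "x \<in> symbox n (\<lambda>_. real k)" using elim(1) Rn_UN_symbox[of n] by auto
    show ?case
    proof
      assume "x i = 0"
      then have "x \<in> ?b k" using k by (simp add: symbox_def)
      then show False using elim(2) by blast
    qed
  qed
qed

lemma AE_lam_GL:
  assumes T: "T \<in> GL n" and P: "AE x in lam n. P x"
  shows "AE x in lam n. P (lin_on n T x)"
proof -
  obtain Z where Z: "{x. \<not> P x} \<subseteq> Z" "emeasure (lam n) Z = 0" "Z \<in> sets borel"
    using AE_E[OF P] by auto
  obtain k where "\<And>f. f \<in> borel_measurable borel \<Longrightarrow> (\<integral>\<^sup>+x. f (lin_on n T x) \<partial>lam n) = k * (\<integral>\<^sup>+x. f x \<partial>lam n)"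
    using lam_GL[OF T] by metis
  from this[of "indicator Z"] have "(\<integral>\<^sup>+x. indicator Z (lin_on n T x) \<partial>lam n) = 0"
    using Z by simp
  then have "AE x in lam n. indicator Z (lin_on n T x) = (0::ennreal)"
    using Z(3) by (subst (asm) nn_integral_0_iff_AE) (auto intro: measurable_compose[OF measurable_lin_on])
  then show ?thesis
    by eventually_elim (use Z(1) in \<open>auto simp: indicator_def split: if_splits\<close>)
qed

lemma dot_join: "dot (m + d) (join m z x) (join m z' x') = dot m z z' + dot d x x'"
proof (induction d)
  case 0
  then show ?case by (simp add: dot_def join_def)
next
  case (Suc d)
  then show ?case by (simp add: dot_def join_def)
qed

lemma dot_axis: "i < n \<Longrightarrow> dot n (axis_vec i) x = x i"
  by (simp add: dot_def axis_vec_def if_distrib[of "\<lambda>t. t * _"] cong: if_cong)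

lemma dot_commute: "dot n x y = dot n y x"
  by (simp add: dot_def mult.commute)

text \<open>The fibre through \<open>m\<close> consists of the points \<open>(z, z\<^sub>0 m)\<close>; averaging over \<open>m\<close> sweeps out
  the whole space because \<open>m \<mapsto> z\<^sub>0 m\<close> is a dilation for each \<open>z\<close> with \<open>z\<^sub>0 \<noteq> 0\<close>.\<close>

lemma nn_integral_fibres:
  assumes [measurable]: "h \<in> borel_measurable borel" "w \<in> borel_measurable borel"
    and w: "\<And>z. z 0 = 0 \<Longrightarrow> w z = 0"
  shows "(\<integral>\<^sup>+m. (\<integral>\<^sup>+z. w z * h (join M z (z 0 *\<^sub>R m)) \<partial>lam M) \<partial>lam d) =
    (\<integral>\<^sup>+z. w z * (ennreal (1 / \<bar>z 0\<bar> ^ d) * (\<integral>\<^sup>+x. h (join M z x) \<partial>lam d)) \<partial>lam M)"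
proof -
  interpret M: sigma_finite_measure "lam M" by (rule sigma_finite_lam)
  interpret D: sigma_finite_measure "lam d" by (rule sigma_finite_lam)
  interpret P: pair_sigma_finite "lam d" "lam M" ..
  have "(\<integral>\<^sup>+m. (\<integral>\<^sup>+z. w z * h (join M z (z 0 *\<^sub>R m)) \<partial>lam M) \<partial>lam d) =
    (\<integral>\<^sup>+z. (\<integral>\<^sup>+m. w z * h (join M z (z 0 *\<^sub>R m)) \<partial>lam d) \<partial>lam M)"
    by (rule P.Fubini'[symmetric]) measurable
  also have "\<dots> = (\<integral>\<^sup>+z. w z * (ennreal (1 / \<bar>z 0\<bar> ^ d) * (\<integral>\<^sup>+x. h (join M z x) \<partial>lam d)) \<partial>lam M)"
  proof (rule nn_integral_cong)
    fix z :: "nat \<Rightarrow> real"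
    show "(\<integral>\<^sup>+m. w z * h (join M z (z 0 *\<^sub>R m)) \<partial>lam d) =
        w z * (ennreal (1 / \<bar>z 0\<bar> ^ d) * (\<integral>\<^sup>+x. h (join M z x) \<partial>lam d))"
    proof (cases "z 0 = 0")
      case False
      have "(\<integral>\<^sup>+m. w z * h (join M z (z 0 *\<^sub>R m)) \<partial>lam d) = w z * (\<integral>\<^sup>+m. h (join M z (z 0 *\<^sub>R m)) \<partial>lam d)"
        by (rule nn_integral_cmult) measurable
      then show ?thesis using nn_integral_lam_scale[OF False, of "\<lambda>x. h (join M z x)" d] by simp
    qed (simp add: w)
  qed
  finally show ?thesis .
qed

text \<open>The cutoff |z_0| > R bounds the factor |z_0|^(-d) of the dilation by R^(-d).\<close>

lemma nn_integral_fibres_le: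
  assumes [measurable]: "h \<in> borel_measurable borel" and R: "0 < R"
  shows "(\<integral>\<^sup>+m. (\<integral>\<^sup>+z. indicator {z. R < \<bar>z 0\<bar>} z * h (join M z (z 0 *\<^sub>R m)) \<partial>lam M) \<partial>lam d) \<le>
    ennreal (1 / R ^ d) * (\<integral>\<^sup>+y. h y \<partial>lam (M + d))"
proof -
  interpret D: sigma_finite_measure "lam d" by (rule sigma_finite_lam)
  have "(\<integral>\<^sup>+m. (\<integral>\<^sup>+z. indicator {z. R < \<bar>z 0\<bar>} z * h (join M z (z 0 *\<^sub>R m)) \<partial>lam M) \<partial>lam d) =
    (\<integral>\<^sup>+z. indicator {z. R < \<bar>z 0\<bar>} z * (ennreal (1 / \<bar>z 0\<bar> ^ d) * (\<integral>\<^sup>+x. h (join M z x) \<partial>lam d)) \<partial>lam M)"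
    using R by (intro nn_integral_fibres) auto
  also have "\<dots> \<le> (\<integral>\<^sup>+z. ennreal (1 / R ^ d) * (\<integral>\<^sup>+x. h (join M z x) \<partial>lam d) \<partial>lam M)"
  proof (rule nn_integral_mono)
    fix z :: "nat \<Rightarrow> real"
    have "ennreal (1 / \<bar>z 0\<bar> ^ d) \<le> ennreal (1 / R ^ d)" if "R < \<bar>z 0\<bar>"
      using that R by (intro ennreal_leI divide_left_mono power_mono) auto
    then show "indicator {z. R < \<bar>z 0\<bar>} z * (ennreal (1 / \<bar>z 0\<bar> ^ d) * (\<integral>\<^sup>+x. h (join M z x) \<partial>lam d)) \<le>
        ennreal (1 / R ^ d) * (\<integral>\<^sup>+x. h (join M z x) \<partial>lam d)"
      by (auto simp: indicator_def intro: mult_right_mono)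
  qed
  also have "\<dots> = ennreal (1 / R ^ d) * (\<integral>\<^sup>+z. (\<integral>\<^sup>+x. h (join M z x) \<partial>lam d) \<partial>lam M)"
    by (rule nn_integral_cmult) measurable
  also have "\<dots> = ennreal (1 / R ^ d) * (\<integral>\<^sup>+y. h y \<partial>lam (M + d))"
    by (simp add: nn_integral_lam_join)
  finally show ?thesis .
qed

text \<open>For each cutoff 1 / (k + 1) the sweep bound shows that almost every fibre misses a given
  null set up to a null set of its own; countably many cutoffs exhaust z_0 \<noteq> 0.\<close>

lemma fibres_AE:
  assumes M: "0 < M" and P: "AE y in lam (M + d). P y"
  shows "AE m in lam d. AE z in lam (M). P (join (M) z (z 0 *\<^sub>R m))"
proof -
  interpret M: sigma_finite_measure "lam (M)" by (rule sigma_finite_lam)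
  obtain Z where Z: "{y. \<not> P y} \<subseteq> Z" "emeasure (lam (M + d)) Z = 0" and [measurable]: "Z \<in> sets borel"
    using AE_E[OF P] by auto
  let ?I = "\<lambda>k::nat. \<lambda>m. \<integral>\<^sup>+z. indicator {z. 1 / real (Suc k) < \<bar>z 0\<bar>} z * indicator Z (join (M) z (z 0 *\<^sub>R m)) \<partial>lam (M) :: ennreal"
  have "(\<integral>\<^sup>+m. ?I k m \<partial>lam d) \<le> 0" for k
    using nn_integral_fibres_le[where h="indicator Z" and R="1 / real (Suc k)" and M=M and d=d] Z by simp
  then have "(\<integral>\<^sup>+m. ?I k m \<partial>lam d) = 0" for k by simp
  then have "AE m in lam d. ?I k m = 0" for k
    by (subst (asm) nn_integral_0_iff_AE) measurable
  then have "AE m in lam d. \<forall>k. ?I k m = 0" unfolding AE_all_countable by (rule allI)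
  then show ?thesis
  proof eventually_elim
    case (elim m)
    have "AE z in lam (M). indicator {z. 1 / real (Suc k) < \<bar>z 0\<bar>} z * indicator Z (join (M) z (z 0 *\<^sub>R m)) = (0::ennreal)" for k
      using elim[rule_format, of k] by (subst (asm) nn_integral_0_iff_AE) measurable
    then have "AE z in lam (M). \<forall>k. indicator {z. 1 / real (Suc k) < \<bar>z 0\<bar>} z * indicator Z (join (M) z (z 0 *\<^sub>R m)) = (0::ennreal)"
      unfolding AE_all_countable by (rule allI)
    with AE_lam_coord_nonzero[OF M] show ?case
    proof eventually_elim
      case (elim z)
      obtain k :: nat where "1 / real (Suc k) < \<bar>z 0\<bar>"
        using reals_Archimedean[of "\<bar>z 0\<bar>"] elim(1) by (auto simp: inverse_eq_divide)
      then have "join (M) z (z 0 *\<^sub>R m) \<notin> Z" using elim(2)[rule_format, of k] by (auto simp: indicator_def split: if_splits)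
      then show ?case using Z(1) by blast
    qed
  qed
qed

text \<open>The points (z, z_0 m) form a subspace of dimension \<open>M\<close>, on which
  \<open>f\<close> is integrable by hypothesis. As this subspace may be a null set, integrability
  passes to \<open>F\<close> only on fibres where \<open>f\<close> and \<open>F\<close> agree almost
  everywhere, which \<open>fibres_AE\<close> supplies.\<close>

lemma fibre_integral_finite:
  assumes M: "0 < M" and [measurable]: "F \<in> borel_measurable borel" and F_pos: "\<And>x. 0 \<le> F x"
    and rep: "AE y in lam (M + d). f y = F y"
    and f: "integrable_on_all_subspaces (M + d) f"
  shows "AE m in lam d. (\<integral>\<^sup>+z. ennreal (F (join (M) z (z 0 *\<^sub>R m))) \<partial>lam (M)) < \<infinity>"
  using fibres_AE[OF M rep] AE_lam_Rn
proof eventually_elim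
  case (elim m)
  obtain p where p: "M = Suc p" using M by (cases M) auto
  let ?M = M and ?N = "M + d"
  \<comment> \<open>The length of (e_0, m). This vector is orthogonal to the (e_i, 0) with 0 < i, so
    dividing it by \<open>q\<close> completes an orthonormal basis of the fibre.\<close>
  define q where "q = sqrt (1 + dot d m m)"
  have "0 \<le> dot d m m" by (simp add: dot_def sum_nonneg)
  then have q: "q > 0" "q * q = 1 + dot d m m" by (auto simp: q_def)
  define v where "v i = (if i = 0 then (1 / q) *\<^sub>R join ?M (axis_vec 0) m else join ?M (axis_vec i) 0)" for i
  \<comment> \<open>Isometric coordinates y and fibre coordinates z are related by z = D y; the
    stretch of coordinate 0 changes integrals only by a positive factor.\<close>
  define D where "D y = (\<lambda>i. if i = 0 then y 0 / q else y i)" for y :: "nat \<Rightarrow> real"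
  have v_Rn: "v i \<in> Rn ?N" if "i < ?M" for i
    using that elim(2) by (auto simp: v_def Rn_eq join_def axis_vec_def)
  have dotv: "dot ?N (join ?M (axis_vec i) x) (join ?M (axis_vec j) y) = (if i = j then 1 else 0) + dot d x y"
    if "i < ?M" "j < ?M" for i j x y
    using that by (simp add: dot_join[of ?M d] dot_axis) (simp add: axis_vec_def)
  have dot0: "dot d 0 x = 0" "dot d x 0 = 0" for x by (simp_all add: dot_def)
  have dl: "dot ?N (r *\<^sub>R x) y = r * dot ?N x y" for r x y
    by (metis dot_commute dot_scale)
  have orth: "orthonormal ?N ?M v"
    unfolding orthonormal_def
  proof (intro conjI allI impI v_Rn)
    fix i j assume ij: "i < ?M" "j < ?M"
    have "(1 / q) * ((1 / q) * (1 + dot d m m)) = 1"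
      using q by (simp add: q(2)[symmetric])
    then show "dot ?N (v i) (v j) = (if i = j then 1 else 0)"
      using ij by (auto simp: v_def dl dot_scale dotv dot0)
  qed
  have "span (v ` {..<?M}) \<subseteq> Rn ?N"
    by (rule span_minimal[OF _ subspace_Rn]) (use v_Rn in auto)
  then have int: "integrable (leb ?M) (\<lambda>y. f (\<Sum>i<?M. y i *\<^sub>R v i))"
    using f orth unfolding integrable_on_all_subspaces_def integrable_on_subspace_def by blast
  have comb: "(\<Sum>i<?M. y i *\<^sub>R v i) = join ?M (D y) (D y 0 *\<^sub>R m)" if y: "y \<in> Rn ?M" for y
  proof
    fix j
    have "(\<Sum>i<?M. y i *\<^sub>R v i) j = y 0 * v 0 j + (\<Sum>i<p. y (Suc i) * v (Suc i) j)"
      by (simp add: p sum_fun_apply sum.lessThan_Suc_shift del: sum.lessThan_Suc)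
    also have "\<dots> = join ?M (D y) (D y 0 *\<^sub>R m) j"
    proof -
      consider "j = 0" | k where "j = Suc k" "k < p" | "j \<ge> ?M"
        unfolding p by (cases j) (auto simp: not_less[symmetric])
      then show ?thesis
      proof cases
        case (2 k)
        have "(\<Sum>i<p. y (Suc i) * v (Suc i) j) = (\<Sum>i<p. if i = k then y (Suc k) else 0)"
          using 2 by (intro sum.cong) (auto simp: p v_def join_def axis_vec_def)
        then show ?thesis using 2 by (simp add: p v_def join_def axis_vec_def D_def)
      qed (auto simp: p v_def join_def axis_vec_def D_def)
    qed
    finally show "(\<Sum>i<?M. y i *\<^sub>R v i) j = join ?M (D y) (D y 0 *\<^sub>R m) j" .
  qed
  have D: "D \<in> GL ?M"
  proof -
    have "linear D" by (rule linearI) (auto simp: D_def fun_eq_iff add_divide_distrib)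
    moreover have "bij_betw D (Rn ?M) (Rn ?M)"
      using q by (intro bij_betw_byWitness[where f'="\<lambda>y i. if i = 0 then q * y 0 else y i"])
        (use M in \<open>auto simp: D_def Rn_eq\<close>)
    ultimately show ?thesis by (simp add: GL_def)
  qed
  then have linD: "linear D" by (simp add: GL_def)
  obtain k where k: "0 < k" "\<And>f. f \<in> borel_measurable borel \<Longrightarrow> (\<integral>\<^sup>+x. f (lin_on ?M D x) \<partial>lam ?M) = k * (\<integral>\<^sup>+x. f x \<partial>lam ?M)"
    using lam_GL[OF D] by metis
  define H where "H z = ennreal (F (join ?M z (z 0 *\<^sub>R m)))" for z
  have [measurable]: "H \<in> borel_measurable borel" unfolding H_def by measurable
  have "AE y in lam ?M. H (lin_on ?M D y) = ennreal (norm (f (\<Sum>i<?M. y i *\<^sub>R v i)))"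
    using AE_lam_GL[OF D elim(1)] AE_lam_Rn[of ?M]
  proof eventually_elim
    case (elim y)
    then show ?case by (simp add: H_def comb lin_on_eq[OF linD] F_pos)
  qed
  then have "(\<integral>\<^sup>+y. H (lin_on ?M D y) \<partial>leb ?M) = (\<integral>\<^sup>+y. ennreal (norm (f (\<Sum>i<?M. y i *\<^sub>R v i))) \<partial>leb ?M)"
    by (intro nn_integral_cong_AE) (simp add: AE_leb_iff)
  also have "\<dots> < \<infinity>" using int by (auto simp: integrable_iff_bounded)
  finally have "(\<integral>\<^sup>+y. H (lin_on ?M D y) \<partial>lam ?M) < \<infinity>" by (subst (asm) nn_integral_leb) auto
  then have "k * (\<integral>\<^sup>+z. H z \<partial>lam ?M) < \<infinity>" by (simp add: k(2))
  then show ?case using k(1) by (auto simp: H_def ennreal_mult_less_top)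
qed

text \<open>Averaging the fibre integrals over m gives the section integrals of \<open>F\<close>
  with the positive weight |z_0|^(-d). The windows 1/n < |z_0| \<le> n exhaust z_0 \<noteq> 0, so if
  none carried mass, \<open>F\<close> would vanish almost everywhere.\<close>

lemma fibre_integral_positive:
  assumes M: "0 < M" and [measurable]: "F \<in> borel_measurable borel" and F_pos: "\<And>x. 0 \<le> F x"
    and nz: "\<not> (AE y in lam (M + d). F y = 0)"
  shows "\<not> (AE m in lam d. \<forall>n::nat.
    (\<integral>\<^sup>+z. indicator {z. 1 / real n < \<bar>z 0\<bar> \<and> \<bar>z 0\<bar> \<le> real n} z * ennreal (F (join (M) z (z 0 *\<^sub>R m))) \<partial>lam (M)) = 0)"
proof
  let ?w = "\<lambda>n::nat. indicator {z::nat \<Rightarrow> real. 1 / real n < \<bar>z 0\<bar> \<and> \<bar>z 0\<bar> \<le> real n} :: _ \<Rightarrow> ennreal"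
  interpret M: sigma_finite_measure "lam (M)" by (rule sigma_finite_lam)
  interpret D: sigma_finite_measure "lam d" by (rule sigma_finite_lam)
  assume A: "AE m in lam d. \<forall>n. (\<integral>\<^sup>+z. ?w n z * ennreal (F (join (M) z (z 0 *\<^sub>R m))) \<partial>lam (M)) = 0"
  define \<Phi> where "\<Phi> z = (\<integral>\<^sup>+x. ennreal (F (join (M) z x)) \<partial>lam d)" for z
  have [measurable]: "\<Phi> \<in> borel_measurable borel" unfolding \<Phi>_def by measurable
  have "AE z in lam (M). ?w n z * (ennreal (1 / \<bar>z 0\<bar> ^ d) * \<Phi> z) = 0" for n
  proof -
    have "(\<integral>\<^sup>+z. ?w n z * (ennreal (1 / \<bar>z 0\<bar> ^ d) * \<Phi> z) \<partial>lam (M)) =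
      (\<integral>\<^sup>+m. (\<integral>\<^sup>+z. ?w n z * ennreal (F (join (M) z (z 0 *\<^sub>R m))) \<partial>lam (M)) \<partial>lam d)"
      unfolding \<Phi>_def by (rule nn_integral_fibres[symmetric]) (auto simp: indicator_def)
    also have "\<dots> = (\<integral>\<^sup>+m. 0 \<partial>lam d)"
      by (intro nn_integral_cong_AE) (use A in eventually_elim, simp)
    finally have "(\<integral>\<^sup>+z. ?w n z * (ennreal (1 / \<bar>z 0\<bar> ^ d) * \<Phi> z) \<partial>lam (M)) = 0" by simp
    then show ?thesis by (subst (asm) nn_integral_0_iff_AE) auto
  qed
  then have "AE z in lam (M). \<forall>n. ?w n z * (ennreal (1 / \<bar>z 0\<bar> ^ d) * \<Phi> z) = 0"
    unfolding AE_all_countable by (rule allI)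
  with AE_lam_coord_nonzero[OF M] have "AE z in lam (M). \<Phi> z = 0"
  proof eventually_elim
    case (elim z)
    obtain n1 :: nat where n1: "\<bar>z 0\<bar> \<le> real n1" using real_arch_simple by blast
    obtain n2 :: nat where n2: "1 / \<bar>z 0\<bar> < real n2" using reals_Archimedean2 by blast
    define n where "n = max n1 n2"
    have "\<bar>z 0\<bar> \<le> real n" "1 / \<bar>z 0\<bar> < real n" using n1 n2 by (auto simp: n_def)
    moreover have "0 < real n" using calculation(1) elim(1) by linarith
    ultimately have "1 / real n < \<bar>z 0\<bar>" "\<bar>z 0\<bar> \<le> real n" using elim(1) by (auto simp: field_simps)
    then have "?w n z = 1" by (intro indicator_simps(1)) blast
    then have "ennreal (1 / \<bar>z 0\<bar> ^ d) * \<Phi> z = 0"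
      using elim(2)[rule_format, of n] by (simp only: mult_1_left)
    moreover have "ennreal (1 / \<bar>z 0\<bar> ^ d) \<noteq> 0" using elim(1) by (simp add: ennreal_eq_0_iff not_le)
    ultimately show ?case by (simp only: mult_eq_0_iff simp_thms)
  qed
  then have "(\<integral>\<^sup>+z. \<Phi> z \<partial>lam (M)) = 0" by (subst nn_integral_0_iff_AE) auto
  then have "(\<integral>\<^sup>+y. ennreal (F y) \<partial>lam (M + d)) = 0"
    by (subst nn_integral_lam_join) (auto simp: \<Phi>_def)
  then have "AE y in lam (M + d). F y = 0"
    by (subst (asm) nn_integral_0_iff_AE) (auto elim!: eventually_mono simp: F_pos ennreal_eq_0_iff order.antisym)
  then show False using nz by blast
qed

subsection \<open>Slabs and Lebesgue measure\<close>

lemma join_add_zero: "join M z x + join M 0 w = join M z (x + w)"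
  by (auto simp: join_def fun_eq_iff)

lemma join_Rn: "x \<in> Rn d \<Longrightarrow> join M 0 x \<in> Rn (M + d)"
  by (auto simp: join_def Rn_eq)

text \<open>For fixed x this is continuity of translations in the mean. The inner integral never
  exceeds twice the integral of |F|, a constant that is integrable over the set \<open>K\<close> of
  finite measure.\<close>

lemma translation_average_tendsto:
  assumes F [measurable]: "integrable (lam (M + d)) F" and K [measurable]: "K \<in> sets borel"
    and fin: "emeasure (lam d) K < \<infinity>"
  shows "(\<lambda>j. \<integral>\<^sup>+x. indicator K x * (\<integral>\<^sup>+y. ennreal \<bar>F (y + join M 0 ((1 / real (Suc j)) *\<^sub>R x)) - F y\<bar> \<partial>lam (M + d)) \<partial>lam d) \<longlonglongrightarrow> 0"
proof -
  interpret N: sigma_finite_measure "lam (M + d)" by (rule sigma_finite_lam)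
  have [measurable]: "F \<in> borel_measurable borel" using F by (auto cong: measurable_cong_sets)
  let ?h = "\<lambda>j x. \<integral>\<^sup>+y. ennreal \<bar>F (y + join M 0 ((1 / real (Suc j)) *\<^sub>R x)) - F y\<bar> \<partial>lam (M + d)"
  define C where "C = 2 * (\<integral>\<^sup>+y. ennreal \<bar>F y\<bar> \<partial>lam (M + d))"
  have "(\<integral>\<^sup>+y. ennreal \<bar>F y\<bar> \<partial>lam (M + d)) < \<infinity>"
    using F by (auto simp: integrable_iff_bounded)
  then have C: "C < \<infinity>" by (simp add: C_def ennreal_mult_less_top)
  have "(\<lambda>j. \<integral>\<^sup>+x. indicator K x * ?h j x \<partial>lam d) \<longlonglongrightarrow> (\<integral>\<^sup>+x. 0 \<partial>lam d)"
  proof (rule nn_integral_dominated_convergence[where w="\<lambda>x. C * indicator K x"])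
    show "(\<integral>\<^sup>+x. C * indicator K x \<partial>lam d) < \<infinity>"
      using C fin by (simp add: nn_integral_cmult_indicator ennreal_mult_less_top)
    show "AE x in lam d. indicator K x * ?h j x \<le> C * indicator K x" for j
      using AE_lam_Rn
    proof eventually_elim
      case (elim x)
      let ?w = "join M 0 ((1 / real (Suc j)) *\<^sub>R x)"
      have "?h j x \<le> (\<integral>\<^sup>+y. ennreal \<bar>F (y + ?w)\<bar> + ennreal \<bar>F y\<bar> \<partial>lam (M + d))"
        by (intro nn_integral_mono) (simp flip: ennreal_plus)
      also have "\<dots> = (\<integral>\<^sup>+y. ennreal \<bar>F (y + ?w)\<bar> \<partial>lam (M + d)) + (\<integral>\<^sup>+y. ennreal \<bar>F y\<bar> \<partial>lam (M + d))"
        by (rule nn_integral_add) measurable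
      also have "(\<integral>\<^sup>+y. ennreal \<bar>F (y + ?w)\<bar> \<partial>lam (M + d)) = (\<integral>\<^sup>+y. ennreal \<bar>F y\<bar> \<partial>lam (M + d))"
        by (rule nn_integral_lam_translate[where f="\<lambda>y. ennreal \<bar>F y\<bar>"]) (auto intro!: join_Rn Rn_scale elim)
      finally have "?h j x \<le> C" by (simp only: C_def mult_2)
      then show ?case by (auto simp: indicator_def)
    qed
    show "AE x in lam d. (\<lambda>j. indicator K x * ?h j x) \<longlonglongrightarrow> 0"
      using AE_lam_Rn
    proof eventually_elim
      case (elim x)
      let ?v = "\<lambda>j. join M 0 ((1 / real (Suc j)) *\<^sub>R x)"
      have v: "?v j \<in> Rn (M + d)" for j by (intro join_Rn Rn_scale elim)
      have "(\<lambda>j. ?v j i) \<longlonglongrightarrow> 0" for i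
      proof -
        have "(\<lambda>j. 1 / real (Suc j)) \<longlonglongrightarrow> 0" using LIMSEQ_inverse_real_of_nat by (simp add: inverse_eq_divide)
        from tendsto_mult[OF this tendsto_const[of "x (i - M)"]]
        show ?thesis by (cases "i < M") (simp_all add: join_def)
      qed
      from translation_mean_tendsto[OF F v this]
      have "(\<lambda>j. ennreal (\<integral>y. \<bar>F (y + ?v j) - F y\<bar> \<partial>lam (M + d))) \<longlonglongrightarrow> ennreal 0"
        by (rule tendsto_ennrealI)
      moreover have "ennreal (\<integral>y. \<bar>F (y + ?v j) - F y\<bar> \<partial>lam (M + d)) = ?h j x" for j
      proof -
        have "integrable (lam (M + d)) (\<lambda>y. F (y + ?v j))"
          using F v by (subst (asm) lam_translate[of "?v j", symmetric]) (auto simp: integrable_distr_eq)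
        then show ?thesis using F by (intro nn_integral_eq_integral[symmetric]) auto
      qed
      ultimately have "(\<lambda>j. ?h j x) \<longlonglongrightarrow> 0" by simp
      then show ?case by (cases "x \<in> K") auto
    qed
  qed measurable
  then show ?thesis by simp
qed

text \<open>Convergence in the mean controls no individual fibre. The radii are chosen so small that
  the averaged error is at most 2^(-j); the sum of the errors then has a finite integral over m,
  hence for almost every m they are summable and tend to 0. The radii depend neither on m nor on the
  cutoff.\<close>

lemma fibre_convergence:
  assumes F [measurable]: "integrable (lam (M + d)) F" and K [measurable]: "K \<in> sets borel"
    and fin: "emeasure (lam d) K < \<infinity>"
  obtains r where "\<And>j::nat. 0 < (r j :: real)"
    "AE m in lam d. \<forall>n. (\<lambda>j. \<integral>\<^sup>+x. indicator K x * (\<integral>\<^sup>+z. indicator {z. 1 / real (Suc n) < \<bar>z 0\<bar>} z *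
        ennreal \<bar>F (join M z (z 0 *\<^sub>R m + r j *\<^sub>R x)) - F (join M z (z 0 *\<^sub>R m))\<bar> \<partial>lam M) \<partial>lam d) \<longlonglongrightarrow> 0"
proof -
  interpret M: sigma_finite_measure "lam M" by (rule sigma_finite_lam)
  interpret D: sigma_finite_measure "lam d" by (rule sigma_finite_lam)
  interpret N: sigma_finite_measure "lam (M + d)" by (rule sigma_finite_lam)
  interpret P: pair_sigma_finite "lam d" "lam d" ..
  have [measurable]: "F \<in> borel_measurable borel" using F by (auto cong: measurable_cong_sets)
  define \<omega> where "\<omega> t = (\<integral>\<^sup>+x. indicator K x * (\<integral>\<^sup>+y. ennreal \<bar>F (y + join M 0 (t *\<^sub>R x)) - F y\<bar> \<partial>lam (M + d)) \<partial>lam d)" for t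
  have "\<exists>i. \<omega> (1 / real (Suc i)) \<le> ennreal ((1 / 2) ^ j)" for j
  proof -
    have "\<forall>\<^sub>F i in sequentially. \<omega> (1 / real (Suc i)) < ennreal ((1 / 2) ^ j)"
      unfolding \<omega>_def by (rule order_tendstoD(2)[OF translation_average_tendsto[OF F K fin]]) simp
    then show ?thesis by (auto simp: eventually_sequentially intro: less_imp_le)
  qed
  then obtain s where s: "\<And>j. \<omega> (1 / real (Suc (s j))) \<le> ennreal ((1 / 2) ^ j)" by metis
  define r where "r j = 1 / real (Suc (s j))" for j
  define err where "err n j m = (\<integral>\<^sup>+x. indicator K x * (\<integral>\<^sup>+z. indicator {z. 1 / real (Suc n) < \<bar>z 0\<bar>} z *
        ennreal \<bar>F (join M z (z 0 *\<^sub>R m + r j *\<^sub>R x)) - F (join M z (z 0 *\<^sub>R m))\<bar> \<partial>lam M) \<partial>lam d)" for n j m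
  have [measurable]: "err n j \<in> borel_measurable borel" for n j unfolding err_def by measurable
  have err_le: "(\<integral>\<^sup>+m. err n j m \<partial>lam d) \<le> ennreal (real (Suc n) ^ d) * ennreal ((1 / 2) ^ j)" for n j
  proof -
    have "(\<integral>\<^sup>+m. err n j m \<partial>lam d) = (\<integral>\<^sup>+x. (\<integral>\<^sup>+m. indicator K x * (\<integral>\<^sup>+z. indicator {z. 1 / real (Suc n) < \<bar>z 0\<bar>} z *
        ennreal \<bar>F (join M z (z 0 *\<^sub>R m + r j *\<^sub>R x)) - F (join M z (z 0 *\<^sub>R m))\<bar> \<partial>lam M) \<partial>lam d) \<partial>lam d)"
      unfolding err_def by (rule P.Fubini') measurable
    also have "\<dots> = (\<integral>\<^sup>+x. indicator K x * (\<integral>\<^sup>+m. (\<integral>\<^sup>+z. indicator {z. 1 / real (Suc n) < \<bar>z 0\<bar>} z *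
        ennreal \<bar>F (join M z (z 0 *\<^sub>R m + r j *\<^sub>R x)) - F (join M z (z 0 *\<^sub>R m))\<bar> \<partial>lam M) \<partial>lam d) \<partial>lam d)"
      by (intro nn_integral_cong nn_integral_cmult) measurable
    also have "\<dots> \<le> (\<integral>\<^sup>+x. indicator K x * (ennreal (real (Suc n) ^ d) *
        (\<integral>\<^sup>+y. ennreal \<bar>F (y + join M 0 (r j *\<^sub>R x)) - F y\<bar> \<partial>lam (M + d))) \<partial>lam d)"
    proof (intro nn_integral_mono mult_left_mono)
      fix x
      show "(\<integral>\<^sup>+m. (\<integral>\<^sup>+z. indicator {z. 1 / real (Suc n) < \<bar>z 0\<bar>} z *
          ennreal \<bar>F (join M z (z 0 *\<^sub>R m + r j *\<^sub>R x)) - F (join M z (z 0 *\<^sub>R m))\<bar> \<partial>lam M) \<partial>lam d) \<le>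
        ennreal (real (Suc n) ^ d) * (\<integral>\<^sup>+y. ennreal \<bar>F (y + join M 0 (r j *\<^sub>R x)) - F y\<bar> \<partial>lam (M + d))"
        using nn_integral_fibres_le[where h="\<lambda>y. ennreal \<bar>F (y + join M 0 (r j *\<^sub>R x)) - F y\<bar>"
            and R="1 / real (Suc n)" and M=M and d=d]
        by (simp add: join_add_zero power_one_over del: of_nat_Suc)
    qed simp
    also have "\<dots> = (\<integral>\<^sup>+x. ennreal (real (Suc n) ^ d) * (indicator K x *
        (\<integral>\<^sup>+y. ennreal \<bar>F (y + join M 0 (r j *\<^sub>R x)) - F y\<bar> \<partial>lam (M + d))) \<partial>lam d)"
      by (simp only: mult_ac)
    also have "\<dots> = ennreal (real (Suc n) ^ d) * \<omega> (r j)"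
      unfolding \<omega>_def by (rule nn_integral_cmult) measurable
    also have "\<dots> \<le> ennreal (real (Suc n) ^ d) * ennreal ((1 / 2) ^ j)"
      using s[of j] by (intro mult_left_mono) (auto simp: r_def)
    finally show ?thesis .
  qed
  have "AE m in lam d. (\<lambda>j. err n j m) \<longlonglongrightarrow> 0" for n
  proof -
    have "(\<integral>\<^sup>+m. (\<Sum>j. err n j m) \<partial>lam d) = (\<Sum>j. \<integral>\<^sup>+m. err n j m \<partial>lam d)"
      by (rule nn_integral_suminf) measurable
    also have "\<dots> \<le> (\<Sum>j. ennreal (real (Suc n) ^ d) * ennreal ((1 / 2) ^ j))"
      by (intro suminf_le err_le) auto
    also have "\<dots> = ennreal (real (Suc n) ^ d) * (\<Sum>j. ennreal ((1 / 2) ^ j))" by simp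
    also have "(\<Sum>j. ennreal ((1 / 2) ^ j)) = ennreal (\<Sum>j. (1 / 2) ^ j)"
      by (rule suminf_ennreal2) (auto intro: summable_geometric)
    also have "ennreal (real (Suc n) ^ d) * ennreal (\<Sum>j. (1 / 2) ^ j) < \<infinity>"
      by (simp add: ennreal_mult_less_top)
    finally have "AE m in lam d. (\<Sum>j. err n j m) \<noteq> \<infinity>"
      by (intro nn_integral_PInf_AE) auto
    then show ?thesis
    proof eventually_elim
      case (elim m)
      have ne: "err n j m \<noteq> top" for j
      proof
        assume "err n j m = top"
        moreover have "err n j m \<le> (\<Sum>j. err n j m)"
          using sum_le_suminf[of "\<lambda>j. err n j m" "{j}"] by simp
        ultimately show False using elim by (simp add: top_unique)
      qed
      then have e: "err n j m = ennreal (enn2real (err n j m))" for j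
        by (simp add: ennreal_enn2real_if)
      have "summable (\<lambda>j. enn2real (err n j m))"
        using elim by (intro summable_suminf_not_top) (simp_all add: e[symmetric])
      from tendsto_ennrealI[OF summable_LIMSEQ_zero[OF this]]
      show ?case by (simp add: e[symmetric])
    qed
  qed
  then have "AE m in lam d. \<forall>n. (\<lambda>j. err n j m) \<longlonglongrightarrow> 0"
    unfolding AE_all_countable by (rule allI)
  then show thesis by (intro that[of r]) (auto simp: err_def r_def)
qed

lemma integrable_on_whole_space:
  assumes [measurable]: "F \<in> borel_measurable borel"
    and rep: "AE y in lam n. f y = F y" and f: "integrable_on_all_subspaces n f"
  shows "integrable (lam n) F"
proof -
  have "(\<Sum>i<n. y i *\<^sub>R axis_vec i) \<in> span (axis_vec ` {..<n})" for y
    by (intro span_sum span_scale span_base) auto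
  then have "span (axis_vec ` {..<n}) = Rn n"
    by (intro antisym span_minimal subspace_Rn) (auto simp: axis_vec_Rn dest: axis_expansion, metis axis_expansion)
  moreover have "orthonormal n n axis_vec"
    by (auto simp: orthonormal_def axis_vec_Rn dot_axis) (auto simp: axis_vec_def)
  ultimately have "integrable (leb n) (\<lambda>y. f (\<Sum>i<n. y i *\<^sub>R axis_vec i))"
    using f subspace_Rn unfolding integrable_on_all_subspaces_def integrable_on_subspace_def by blast
  then have "(\<integral>\<^sup>+y. ennreal (norm (f (\<Sum>i<n. y i *\<^sub>R axis_vec i))) \<partial>leb n) < \<infinity>"
    by (auto simp: integrable_iff_bounded)
  also have "(\<integral>\<^sup>+y. ennreal (norm (f (\<Sum>i<n. y i *\<^sub>R axis_vec i))) \<partial>leb n) = (\<integral>\<^sup>+y. ennreal (norm (F y)) \<partial>leb n)"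
    using rep AE_lam_Rn[of n] by (intro nn_integral_cong_AE) (auto simp: AE_leb_iff axis_expansion elim!: eventually_elim2)
  also have "\<dots> = (\<integral>\<^sup>+y. ennreal (norm (F y)) \<partial>lam n)" by (rule nn_integral_leb) measurable
  finally show ?thesis by (simp add: integrable_iff_bounded)
qed

text \<open>A small cube lies inside the slabs. The positivity permits the division by V \<gamma> in
  \<open>volume_limit\<close>.\<close>

lemma slabs_emeasure_pos:
  assumes "\<And>i. 0 < \<gamma> i" shows "0 < emeasure (lam d) (slabs d p u \<gamma>)"
proof -
  have "\<exists>e>0. \<forall>i<p. e * (\<Sum>l<d. \<bar>u i l\<bar>) \<le> \<gamma> i"
  proof (induction p)
    case (Suc p)
    then obtain e where e: "e > 0" "\<forall>i<p. e * (\<Sum>l<d. \<bar>u i l\<bar>) \<le> \<gamma> i" by blast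
    define S where "S = (\<Sum>l<d. \<bar>u p l\<bar>)"
    have S: "0 \<le> S" by (simp add: S_def sum_nonneg)
    define e' where "e' = min e (\<gamma> p / (1 + S))"
    have e': "0 < e'" "e' \<le> e" "e' \<le> \<gamma> p / (1 + S)" using e S assms[of p] by (auto simp: e'_def)
    have "e' * S \<le> \<gamma> p / (1 + S) * S" using e' S by (intro mult_right_mono) auto
    also have "\<dots> \<le> \<gamma> p" using S assms[of p] by (simp add: field_simps)
    finally have "e' * S \<le> \<gamma> p" .
    moreover have "e' * (\<Sum>l<d. \<bar>u i l\<bar>) \<le> \<gamma> i" if "i < p" for i
    proof -
      have "e' * (\<Sum>l<d. \<bar>u i l\<bar>) \<le> e * (\<Sum>l<d. \<bar>u i l\<bar>)"
        using e' by (intro mult_right_mono) (auto intro: sum_nonneg)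
      then show ?thesis using e(2) that by fastforce
    qed
    ultimately show ?case using e' by (intro exI[of _ e']) (auto simp: less_Suc_eq S_def)
  qed (auto intro: exI[of _ 1])
  then obtain e where e: "e > 0" "\<And>i. i < p \<Longrightarrow> e * (\<Sum>l<d. \<bar>u i l\<bar>) \<le> \<gamma> i" by blast
  have "symbox d (\<lambda>_. e) \<subseteq> slabs d p u \<gamma>"
  proof
    fix x assume x: "x \<in> symbox d (\<lambda>_. e)"
    have "\<bar>dot d (u i) x\<bar> \<le> e * (\<Sum>l<d. \<bar>u i l\<bar>)" for i
      unfolding dot_def sum_distrib_left
      using x by (intro order.trans[OF sum_abs] sum_mono)
        (auto simp: abs_mult symbox_def mult.commute[of e] intro!: mult_left_mono)
    then show "x \<in> slabs d p u \<gamma>" using e(2) by (auto simp: slabs_def intro: order.trans)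
  qed
  then have "emeasure (lam d) (symbox d (\<lambda>_. e)) \<le> emeasure (lam d) (slabs d p u \<gamma>)"
    by (intro emeasure_mono) auto
  moreover have "0 < emeasure (lam d) (symbox d (\<lambda>_. e))"
    using e by (subst emeasure_lam_symbox) auto
  ultimately show ?thesis by (rule order.strict_trans2[rotated])
qed

text \<open>For a slope \<open>m\<close> with finite and non-zero fibre integral, scaled increments
  of \<open>G\<close> tend to volume times that integral; \<open>volume_limit\<close> then disposes
  of both the fibre factor and the mass near the origin.\<close>

theorem log_BM_slabs:
  fixes a b :: "nat \<Rightarrow> real" and c :: real
  defines "\<gamma> \<equiv> \<lambda>i. a i powr c * b i powr (1 - c)"
  assumes dens: "density_fun (Suc p + d) f" and sub: "integrable_on_all_subspaces (Suc p + d) f"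
    and ineq: "box_ineq (Suc p + d) f"
    and a: "\<And>i. 0 < a i" and b: "\<And>i. 0 < b i" and c: "0 < c" "c < 1"
    and fin: "\<And>X. X \<in> {a, b, \<gamma>} \<Longrightarrow> emeasure (lam d) (slabs d p u X) < \<infinity>"
  shows "measure (lam d) (slabs d p u a) powr c * measure (lam d) (slabs d p u b) powr (1 - c) \<le>
    measure (lam d) (slabs d p u \<gamma>)"
proof -
  define M where "M = Suc p"
  have M: "0 < M" by (simp add: M_def)
  note dens = dens[folded M_def] and sub = sub[folded M_def] and ineq = ineq[folded M_def]
  interpret M: sigma_finite_measure "lam M" by (rule sigma_finite_lam)
  have "f \<in> borel_measurable (leb (M + d))" "\<And>x. x \<in> Rn (M + d) \<Longrightarrow> 0 \<le> f x"
    using dens by (auto simp: density_fun_def)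
  note fF = leb_borel_rep[OF this]
  obtain F where F [measurable]: "F \<in> borel_measurable borel" and F_pos: "\<And>x. 0 \<le> F x"
    and rep: "AE y in lam (M + d). f y = F y"
    using fF by blast
  have F_int: "integrable (lam (M + d)) F" by (rule integrable_on_whole_space[OF F rep sub])
  have F_nz: "\<not> (AE y in lam (M + d). F y = 0)"
  proof
    assume "AE y in lam (M + d). F y = 0"
    with rep have "AE y in lam (M + d). f y = 0" by eventually_elim simp
    then show False using dens by (simp add: density_fun_def AE_leb_iff)
  qed
  define S where "S X = slabs d p u X" for X
  have [measurable]: "S X \<in> sets borel" for X by (simp add: S_def)
  \<comment> \<open>One sequence of radii and one slope must serve three bodies at once, hence their
    union.\<close>
  define K where "K = S a \<union> S b \<union> S \<gamma>"
  have [measurable]: "K \<in> sets borel" by (simp add: K_def)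
  have "emeasure (lam d) K \<le> emeasure (lam d) (S a) + emeasure (lam d) (S b) + emeasure (lam d) (S \<gamma>)"
    unfolding K_def by (intro order.trans[OF emeasure_subadditive] add_mono emeasure_subadditive) auto
  also have "\<dots> < \<infinity>" using fin[of a] fin[of b] fin[of \<gamma>] by (simp add: S_def)
  finally have Kfin: "emeasure (lam d) K < \<infinity>" .
  obtain r where r: "\<And>j::nat. 0 < (r j :: real)" and
    conv: "AE m in lam d. \<forall>n. (\<lambda>j. \<integral>\<^sup>+x. indicator K x * (\<integral>\<^sup>+z. indicator {z. 1 / real (Suc n) < \<bar>z 0\<bar>} z *
        ennreal \<bar>F (join M z (z 0 *\<^sub>R m + r j *\<^sub>R x)) - F (join M z (z 0 *\<^sub>R m))\<bar> \<partial>lam M) \<partial>lam d) \<longlonglongrightarrow> 0"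
    using fibre_convergence[OF F_int _ Kfin] by auto
  define w where "w k n = (indicator {z. 1 / real k < \<bar>z 0\<bar> \<and> \<bar>z 0\<bar> \<le> real n} :: (nat \<Rightarrow> real) \<Rightarrow> ennreal)" for k n :: nat
  have [measurable]: "w k n \<in> borel_measurable borel" for k n unfolding w_def by measurable
  define qe where "qe m k n = (\<integral>\<^sup>+z. w k n z * ennreal (F (join M z (z 0 *\<^sub>R m))) \<partial>lam M)" for m k n
  obtain m n where m_Rn: "m \<in> Rn d" and
    mconv: "\<And>n. (\<lambda>j. \<integral>\<^sup>+x. indicator K x * (\<integral>\<^sup>+z. indicator {z. 1 / real (Suc n) < \<bar>z 0\<bar>} z *
        ennreal \<bar>F (join M z (z 0 *\<^sub>R m + r j *\<^sub>R x)) - F (join M z (z 0 *\<^sub>R m))\<bar> \<partial>lam M) \<partial>lam d) \<longlonglongrightarrow> 0" and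
    mfin: "(\<integral>\<^sup>+z. ennreal (F (join M z (z 0 *\<^sub>R m))) \<partial>lam M) < \<infinity>" and
    mpos: "qe m n n \<noteq> 0"
  proof (rule ccontr)
    assume "\<not> thesis"
    note no = this[unfolded not_def, rule_format, OF that]
    have "AE m in lam d. \<forall>n. qe m n n = 0"
      using conv fibre_integral_finite[OF M F F_pos rep sub] AE_lam_Rn
    proof eventually_elim
      case (elim m) then show ?case using no by blast
    qed
    then show False using fibre_integral_positive[OF M F F_pos F_nz] by (simp add: qe_def w_def)
  qed
  \<comment> \<open>\<open>n\<close> is the outer radius and 1/n the inner cutoff. For n = 1 the
    window is empty; for n = 0 as well, where 1 / 0 = 0 leaves 0 < |z_0| \<le> 0.\<close>
  have n2: "2 \<le> n"
  proof (rule ccontr)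
    assume "\<not> 2 \<le> n"
    then have "n = 0 \<or> n = 1" by auto
    then have "w n n z = 0" for z by (auto simp: w_def indicator_def)
    then show False using mpos by (simp add: qe_def)
  qed
  define Qe where "Qe = (\<integral>\<^sup>+z. ennreal (F (join M z (z 0 *\<^sub>R m))) \<partial>lam M)"
  have qe_le: "qe m k n \<le> Qe" for k
    unfolding qe_def Qe_def by (intro nn_integral_mono) (auto simp: w_def indicator_def)
  have qe_fin: "qe m k n < \<infinity>" for k using qe_le[of k] mfin by (simp add: Qe_def le_less_trans)
  define q where "q k = enn2real (qe m k n)" for k
  have q_eq: "ennreal (q k) = qe m k n" for k using qe_fin[of k] by (simp add: q_def ennreal_enn2real_if less_top)
  define V where "V X = measure (lam d) (S X)" for X
  have V_eq: "ennreal (V X) = emeasure (lam d) (S X)" if "X \<in> {a, b, \<gamma>}" for X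
    using fin[OF that] by (simp add: V_def S_def emeasure_eq_ennreal_measure less_top)
  interpret tube d p "M + d" u m f F
    by unfold_locales (use F_pos F_int rep ineq m_Rn in \<open>auto simp: M_def\<close>)
  have "V a powr c * V b powr (1 - c) \<le> V \<gamma>"
  proof (rule volume_limit[where V=V and q=q and Q="enn2real Qe", OF _ a b c n2 r])
    show "\<gamma> = (\<lambda>i. a i powr c * b i powr (1 - c))" by (simp add: \<gamma>_def)
    show "0 < q n" using mpos qe_fin[of n] by (simp add: q_def enn2real_positive_iff zero_less_iff_neq_zero)
    show "q n \<le> q k \<and> q k \<le> enn2real Qe" if "n \<le> k" for k
    proof
      have "1 / real k \<le> 1 / real n" using that n2 by (simp add: field_simps)
      then have "qe m n n \<le> qe m k n"
        unfolding qe_def by (intro nn_integral_mono mult_right_mono) (auto simp: w_def indicator_def)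
      then show "q n \<le> q k" using qe_fin[of k] by (simp add: q_def enn2real_mono)
      show "q k \<le> enn2real Qe" unfolding q_def using qe_le[of k] mfin by (intro enn2real_mono) (auto simp: Qe_def)
    qed
    show "0 \<le> V a" "0 \<le> V b" by (auto simp: V_def)
    have "0 < emeasure (lam d) (S \<gamma>)"
      unfolding S_def using a b by (intro slabs_emeasure_pos) (simp add: \<gamma>_def less_imp_neq[THEN not_sym])
    then show "0 < V \<gamma>" using V_eq[of \<gamma>] by (metis ennreal_less_zero_iff insertCI)
    fix X k assume X: "X \<in> {a, b, \<gamma>}" and k: "n \<le> k"
    obtain k' where k': "k = Suc k'" using k n2 by (cases k) auto
    define B where "B j = (G (\<lambda>i. r j * X i) (real n) - G (\<lambda>i. r j * X i) (1 / real k)) / r j ^ d" for j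
    define err where "err j = (\<integral>\<^sup>+x. indicator K x * (\<integral>\<^sup>+z. indicator {z. 1 / real (Suc k') < \<bar>z 0\<bar>} z *
        ennreal \<bar>F (join M z (z 0 *\<^sub>R m + r j *\<^sub>R x)) - F (join M z (z 0 *\<^sub>R m))\<bar> \<partial>lam M) \<partial>lam d)" for j
    have err0: "err \<longlonglongrightarrow> 0" using mconv[of k'] unfolding err_def .
    define I where "I j = (\<integral>\<^sup>+x. indicator (S X) x * (\<integral>\<^sup>+z. w k n z * ennreal (F (join M z (z 0 *\<^sub>R m + r j *\<^sub>R x))) \<partial>lam M) \<partial>lam d)" for j
    have kn: "1 / real k \<le> real n"
    proof -
      have "1 / real k \<le> 1" using k n2 by simp
      also have "1 \<le> real n" using n2 by simp
      finally show ?thesis .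
    qed
    have B_pos: "0 \<le> B j" for j
      unfolding B_def using r[of j] kn by (intro divide_nonneg_nonneg) (auto intro: G_mono)
    have B_eq: "ennreal (B j) = I j" for j
    proof -
      have "ennreal (G (\<lambda>i. r j * X i) (real n) - G (\<lambda>i. r j * X i) (1 / real k)) = ennreal (r j ^ d) * I j"
        using G_increment[OF r kn, of j X] by (simp add: I_def S_def w_def M_def)
      then have "ennreal (1 / r j ^ d) * ennreal (G (\<lambda>i. r j * X i) (real n) - G (\<lambda>i. r j * X i) (1 / real k)) =
         ennreal (1 / r j ^ d) * ennreal (r j ^ d) * I j" by (simp add: mult.assoc)
      moreover have "ennreal (1 / r j ^ d) * ennreal (r j ^ d) = 1"
        using r[of j] by (simp add: ennreal_mult[symmetric])
      moreover have "ennreal (1 / r j ^ d) * ennreal (G (\<lambda>i. r j * X i) (real n) - G (\<lambda>i. r j * X i) (1 / real k)) = ennreal (B j)"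
        using r[of j] kn by (subst ennreal_mult[symmetric]) (auto simp: B_def intro: G_mono)
      ultimately show ?thesis by simp
    qed
    let ?F0 = "\<lambda>z. ennreal (F (join M z (z 0 *\<^sub>R m)))"
    let ?F1 = "\<lambda>j x z. ennreal (F (join M z (z 0 *\<^sub>R m + r j *\<^sub>R x)))"
    let ?E = "\<lambda>j x z. indicator {z. 1 / real (Suc k') < \<bar>z 0\<bar>} z *
        ennreal \<bar>F (join M z (z 0 *\<^sub>R m + r j *\<^sub>R x)) - F (join M z (z 0 *\<^sub>R m))\<bar>"
    have pt: "s \<le> t + \<bar>s - t\<bar>" for s t :: real by linarith
    have le1: "w k n z * ?F1 j x z \<le> w k n z * ?F0 z + ?E j x z"
      and le2: "w k n z * ?F0 z \<le> w k n z * ?F1 j x z + ?E j x z" for j x z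
      using F_pos[of "join M z (z 0 *\<^sub>R m + r j *\<^sub>R x)"] F_pos[of "join M z (z 0 *\<^sub>R m)"]
      by (auto simp: w_def indicator_def k' abs_minus_commute simp flip: ennreal_plus intro!: ennreal_leI pt)
    have const: "(\<integral>\<^sup>+x. indicator (S X) x * (\<integral>\<^sup>+z. w k n z * ?F0 z \<partial>lam M) \<partial>lam d) = ennreal (V X) * ennreal (q k)"
      by (simp add: nn_integral_multc V_eq[OF X] q_eq qe_def)
    have SK: "indicator (S X) x \<le> (indicator K x :: ennreal)" for x
      using X by (auto simp: K_def indicator_def)
    \<comment> \<open>Values of \<open>F\<close> beside the axis and on the axis are each at most
      the other plus the error \<open>?E\<close>; this estimate is applied in both orders, which
      gives a two-sided bound without subtraction in \<open>ennreal\<close>.\<close>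
    have comb: "(\<integral>\<^sup>+x. indicator (S X) x * (\<integral>\<^sup>+z. f1 x z \<partial>lam M) \<partial>lam d) \<le>
        (\<integral>\<^sup>+x. indicator (S X) x * (\<integral>\<^sup>+z. f2 x z \<partial>lam M) \<partial>lam d) + err j"
      if le: "\<And>x z. f1 x z \<le> f2 x z + ?E j x z"
        and [measurable]: "(\<lambda>(x, z). f2 x z) \<in> borel_measurable (borel \<Otimes>\<^sub>M borel)" for f1 f2 j
    proof -
      have "(\<integral>\<^sup>+x. indicator (S X) x * (\<integral>\<^sup>+z. f1 x z \<partial>lam M) \<partial>lam d) \<le>
          (\<integral>\<^sup>+x. indicator (S X) x * (\<integral>\<^sup>+z. f2 x z \<partial>lam M) + indicator K x * (\<integral>\<^sup>+z. ?E j x z \<partial>lam M) \<partial>lam d)"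
      proof (rule nn_integral_mono)
        fix x
        have "(\<integral>\<^sup>+z. f1 x z \<partial>lam M) \<le> (\<integral>\<^sup>+z. f2 x z + ?E j x z \<partial>lam M)"
          by (intro nn_integral_mono le)
        also have "\<dots> = (\<integral>\<^sup>+z. f2 x z \<partial>lam M) + (\<integral>\<^sup>+z. ?E j x z \<partial>lam M)"
          by (rule nn_integral_add) measurable
        finally have "indicator (S X) x * (\<integral>\<^sup>+z. f1 x z \<partial>lam M) \<le>
            indicator (S X) x * ((\<integral>\<^sup>+z. f2 x z \<partial>lam M) + (\<integral>\<^sup>+z. ?E j x z \<partial>lam M))"
          by (rule mult_left_mono) simp
        also have "\<dots> \<le> indicator (S X) x * (\<integral>\<^sup>+z. f2 x z \<partial>lam M) + indicator K x * (\<integral>\<^sup>+z. ?E j x z \<partial>lam M)"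
          unfolding distrib_left by (intro add_left_mono mult_right_mono SK) simp
        finally show "indicator (S X) x * (\<integral>\<^sup>+z. f1 x z \<partial>lam M) \<le>
          indicator (S X) x * (\<integral>\<^sup>+z. f2 x z \<partial>lam M) + indicator K x * (\<integral>\<^sup>+z. ?E j x z \<partial>lam M)" .
      qed
      also have "\<dots> = (\<integral>\<^sup>+x. indicator (S X) x * (\<integral>\<^sup>+z. f2 x z \<partial>lam M) \<partial>lam d) + err j"
        unfolding err_def by (rule nn_integral_add) measurable
      finally show ?thesis .
    qed
    have u1: "I j \<le> ennreal (V X) * ennreal (q k) + err j" for j
      using comb[of "\<lambda>x z. w k n z * ?F1 j x z" "\<lambda>x z. w k n z * ?F0 z" j] le1 unfolding const I_def by simp
    have u2: "ennreal (V X) * ennreal (q k) \<le> I j + err j" for j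
      using comb[of "\<lambda>x z. w k n z * ?F0 z" "\<lambda>x z. w k n z * ?F1 j x z" j] le2 unfolding const I_def by simp
    have Vq: "0 \<le> V X * q k" by (simp add: V_def q_def)
    have "\<forall>\<^sub>F j in sequentially. err j < 1" using order_tendstoD(2)[OF err0, of 1] by simp
    then have ev: "\<forall>\<^sub>F j in sequentially. norm (B j - V X * q k) \<le> enn2real (err j)"
    proof eventually_elim
      case (elim j)
      then have e: "err j = ennreal (enn2real (err j))"
        by (metis ennreal_enn2real_if infinity_ennreal_def order_less_imp_not_eq top_greatest order_less_le_trans linorder_not_le)
      have v: "ennreal (V X) * ennreal (q k) = ennreal (V X * q k)"
        by (simp add: V_def q_def ennreal_mult)
      have "ennreal (B j) \<le> ennreal (V X * q k + enn2real (err j))"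
        using u1[of j] Vq by (subst (asm) e) (simp add: B_eq v)
      moreover have "ennreal (V X * q k) \<le> ennreal (B j + enn2real (err j))"
        using u2[of j] B_pos[of j] by (subst (asm) e) (simp add: B_eq[symmetric] v)
      ultimately have "B j \<le> V X * q k + enn2real (err j)" "V X * q k \<le> B j + enn2real (err j)"
        using Vq B_pos[of j] by (simp_all only: ennreal_le_iff add_nonneg_nonneg enn2real_nonneg)
      then show ?case by (simp add: abs_le_iff)
    qed
    have "(\<lambda>j. enn2real (err j)) \<longlonglongrightarrow> 0"
      using tendsto_enn2real[of err 0 sequentially] err0 by simp
    from Lim_null_comparison[OF ev this] have "B \<longlonglongrightarrow> V X * q k" by (rule LIM_zero_cancel)
    then show "(\<lambda>j. (G (\<lambda>i. r j * X i) (real n) - G (\<lambda>i. r j * X i) (1 / real k)) / r j ^ d) \<longlonglongrightarrow> V X * q k"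
      unfolding B_def .
  qed
  then show ?thesis by (simp add: V_def S_def)
qed

subsection \<open>Boxes and one-parameter dilations\<close>

lemma ennpow_pos: "x \<noteq> 0 \<Longrightarrow> ennpow x c \<noteq> 0"
  by (cases x rule: ennreal_cases) (auto simp: ennpow_def ennreal_eq_0_iff)

lemma ennpow_0 [simp]: "ennpow 0 c = 0"
  by (simp add: ennpow_def)

text \<open>The logarithmic form is void when an endpoint has logarithm -\<infinity>; in the same
  cases the product form is void because 0 times \<infinity> is 0. Hence both agree even for
  infinite values.\<close>

lemma ennpow_mult_le_iff_elog:
  assumes c: "0 < c" "c < 1"
  shows "ennpow X c * ennpow Y (1 - c) \<le> Z \<longleftrightarrow>
    (elog X \<noteq> -\<infinity> \<and> elog Y \<noteq> -\<infinity> \<longrightarrow> ereal c * elog X + ereal (1 - c) * elog Y \<le> elog Z)"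
proof (cases "X = 0 \<or> Y = 0")
  case False
  show ?thesis
  proof (cases "X = \<infinity> \<or> Y = \<infinity>")
    case True
    have inf: "ennpow top e = top" for e by (simp add: ennpow_def)
    have "ennpow X c \<noteq> 0" "ennpow Y (1 - c) \<noteq> 0" using False by (auto dest: ennpow_pos)
    with True have "ennpow X c * ennpow Y (1 - c) = \<infinity>"
      by (auto simp: inf ennreal_top_mult ennreal_mult_top)
    moreover have "ereal c * elog X + ereal (1 - c) * elog Y = \<infinity>"
      using True False c by (auto simp: elog_def)
    moreover have "elog Z = \<infinity> \<longleftrightarrow> Z = \<infinity>" by (auto simp: elog_def)
    ultimately show ?thesis using False by (auto simp: elog_def top_unique)
  next
    case fin: False
    obtain x where x: "X = ennreal x" "0 < x"
      using False fin by (cases X rule: ennreal_cases) (auto simp: ennreal_eq_0_iff not_le)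
    obtain y where y: "Y = ennreal y" "0 < y"
      using False fin by (cases Y rule: ennreal_cases) (auto simp: ennreal_eq_0_iff not_le)
    have L: "ennpow X c * ennpow Y (1 - c) = ennreal (x powr c * y powr (1 - c))"
      using x y by (simp add: ennpow_ennreal ennreal_mult)
    have R: "ereal c * elog X + ereal (1 - c) * elog Y = ereal (ln (x powr c * y powr (1 - c)))"
      using x y by (simp add: elog_def ennreal_eq_0_iff ln_mult ln_powr)
    have p: "0 < x powr c * y powr (1 - c)" using x y by simp
    have ne: "elog X \<noteq> -\<infinity>" "elog Y \<noteq> -\<infinity>" using x y by (auto simp: elog_def ennreal_eq_0_iff)
    show ?thesis
    proof (cases Z rule: ennreal_cases)
      case (real z)
      show ?thesis
      proof (cases "z = 0")
        case True then show ?thesis using ne real p unfolding L R by (simp add: elog_def ennreal_eq_0_iff not_le)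
      next
        case False
        then have "0 < z" using real by simp
        then show ?thesis using ne real p unfolding L R by (simp add: elog_def ennreal_eq_0_iff ln_le_cancel_iff)
      qed
    next
      case top then show ?thesis using ne unfolding L R by (simp add: elog_def)
    qed
  qed
qed (auto simp: elog_def)

text \<open>Both sides are homogeneous of degree c + (1 - c) = 1, which removes the unevaluated
  determinant factor of \<open>lam_GL\<close>.\<close>

lemma ennpow_scale_iff:
  assumes k: "0 < k" "k < \<infinity>"
  shows "ennpow (k * X) c * ennpow (k * Y) (1 - c) \<le> k * Z \<longleftrightarrow> ennpow X c * ennpow Y (1 - c) \<le> Z"
proof -
  obtain r where r: "k = ennreal r" "0 < r"
    using k by (cases k rule: ennreal_cases) auto
  have m: "ennpow (k * X) e = ennpow k e * ennpow X e" for X e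
  proof (cases X rule: ennreal_cases)
    case (real x)
    then show ?thesis using r by (simp add: ennpow_ennreal ennreal_mult[symmetric] powr_mult)
  next
    case top
    then show ?thesis using r ennpow_pos[of k e] k by (simp add: ennpow_def ennreal_mult_top)
  qed
  have kk: "ennpow k c * ennpow k (1 - c) = k"
    using r by (simp add: ennpow_ennreal ennreal_mult[symmetric] powr_add[symmetric])
  have "ennpow (k * X) c * ennpow (k * Y) (1 - c) = (ennpow k c * ennpow k (1 - c)) * (ennpow X c * ennpow Y (1 - c))"
    unfolding m by (simp only: mult_ac)
  then have "ennpow (k * X) c * ennpow (k * Y) (1 - c) = k * (ennpow X c * ennpow Y (1 - c))"
    unfolding kk .
  then show ?thesis using k by (simp add: ennreal_mult_le_mult_iff)
qed

lemma int_over_GL: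
  assumes f: "f \<in> borel_measurable (leb n)" "\<And>x. x \<in> Rn n \<Longrightarrow> 0 \<le> f x" and T: "T \<in> GL n"
  obtains k where "0 < k" "k < \<infinity>"
    "\<And>S. S \<in> sets borel \<Longrightarrow> S \<subseteq> Rn n \<Longrightarrow> int_over n (\<lambda>x. f (T x)) S = k * int_over n f (T ` S)"
proof -
  obtain F where [measurable]: "F \<in> borel_measurable borel" and F_pos: "\<And>x. 0 \<le> F x"
    and rep: "AE x in lam n. f x = F x"
    using leb_borel_rep[OF f] by blast
  obtain U where U: "U \<in> GL n" "\<And>x. x \<in> Rn n \<Longrightarrow> U (T x) = x" "\<And>x. x \<in> Rn n \<Longrightarrow> T (U x) = x"
    using GL_inverse[OF T] by blast
  have lin: "linear T" "linear U" and TR: "\<And>x. x \<in> Rn n \<Longrightarrow> T x \<in> Rn n"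
    and UR: "\<And>x. x \<in> Rn n \<Longrightarrow> U x \<in> Rn n"
    using T U(1) by (auto simp: GL_def bij_betw_def)
  obtain k where k: "0 < k" "k < \<infinity>"
    "\<And>f. f \<in> borel_measurable borel \<Longrightarrow> (\<integral>\<^sup>+x. f (lin_on n T x) \<partial>lam n) = k * (\<integral>\<^sup>+x. f x \<partial>lam n)"
    using lam_GL[OF T] by metis
  show thesis
  proof (rule that[OF k(1,2)])
    fix S assume [measurable]: "S \<in> sets borel" and S: "S \<subseteq> Rn n"
    have TS: "T ` S = Rn n \<inter> lin_on n U -` S"
    proof safe
      fix x assume x: "x \<in> S"
      then have "x \<in> Rn n" using S by auto
      then show "T x \<in> Rn n" "T x \<in> lin_on n U -` S" using x by (auto simp: TR lin_on_eq[OF lin(2)] U)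
    next
      fix y assume y: "y \<in> Rn n" "lin_on n U y \<in> S"
      then show "y \<in> T ` S" by (intro image_eqI[of _ _ "U y"]) (auto simp: lin_on_eq[OF lin(2)] U)
    qed
    have TSm [measurable]: "T ` S \<in> sets borel"
      unfolding TS using measurable_sets_borel[OF measurable_lin_on, of S n U] by auto
    have "AE x in lam n. f (T x) = F (lin_on n T x)"
      using AE_lam_GL[OF T rep] AE_lam_Rn by eventually_elim (simp add: lin_on_eq[OF lin(1)])
    then have "int_over n (\<lambda>x. f (T x)) S = (\<integral>\<^sup>+x. ennreal (F (lin_on n T x)) * indicator S x \<partial>lam n)"
      by (intro int_over_rep) measurable
    also have "\<dots> = (\<integral>\<^sup>+x. ennreal (F (lin_on n T x)) * indicator (T ` S) (lin_on n T x) \<partial>lam n)"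
    proof (intro nn_integral_cong_AE, use AE_lam_Rn in eventually_elim)
      fix x assume x: "x \<in> Rn n"
      then have "lin_on n T x \<in> T ` S \<longleftrightarrow> x \<in> S"
        unfolding TS by (auto simp: lin_on_eq[OF lin(1)] lin_on_eq[OF lin(2)] TR U)
      then show "ennreal (F (lin_on n T x)) * indicator S x = ennreal (F (lin_on n T x)) * indicator (T ` S) (lin_on n T x)"
        by (simp add: indicator_def)
    qed
    also have "\<dots> = k * (\<integral>\<^sup>+x. ennreal (F x) * indicator (T ` S) x \<partial>lam n)"
      by (rule k(3)[of "\<lambda>y. ennreal (F y) * indicator (T ` S) y"]) measurable
    also have "\<dots> = k * int_over n f (T ` S)"
      using int_over_rep[OF _ TSm rep] by simp
    finally show "int_over n (\<lambda>x. f (T x)) S = k * int_over n f (T ` S)" .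
  qed
qed

lemma diag_map_GL: "(\<And>i. 0 < b i) \<Longrightarrow> diag_map b \<in> GL n"
proof -
  assume b: "\<And>i. 0 < b i"
  have "linear (diag_map b)" by (rule linearI) (auto simp: diag_map_def fun_eq_iff algebra_simps)
  moreover have "bij_betw (diag_map b) (Rn n) (Rn n)"
    using b by (intro bij_betw_byWitness[where f'="diag_map (\<lambda>i. 1 / b i)"])
      (auto simp: diag_map_def Rn_eq less_imp_neq[THEN not_sym])
  ultimately show ?thesis by (simp add: GL_def)
qed

lemma GL_comp: "S \<in> GL n \<Longrightarrow> T \<in> GL n \<Longrightarrow> (\<lambda>x. S (T x)) \<in> GL n"
  using linear_compose[of T S] bij_betw_trans[of T "Rn n" "Rn n" S "Rn n"] by (auto simp: GL_def comp_def)

lemma diag_map_symbox: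
  assumes b: "\<And>i. 0 < b i" shows "diag_map b ` symbox n e = symbox n (\<lambda>i. b i * e i)"
proof safe
  fix x assume "x \<in> symbox n e"
  then show "diag_map b x \<in> symbox n (\<lambda>i. b i * e i)"
    using b by (auto simp: symbox_def diag_map_def Rn_eq abs_mult less_imp_le)
next
  fix x assume x: "x \<in> symbox n (\<lambda>i. b i * e i)"
  have "diag_map (\<lambda>i. 1 / b i) x \<in> symbox n e"
    using x b by (auto simp: symbox_def diag_map_def Rn_eq abs_mult pos_divide_le_eq mult.commute less_imp_le)
  moreover have "diag_map b (diag_map (\<lambda>i. 1 / b i) x) = x"
    using b by (simp add: diag_map_def fun_eq_iff less_imp_neq[THEN not_sym])
  ultimately show "x \<in> diag_map b ` symbox n e" by (metis image_eqI)
qed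

lemma cube_eq: "cube n = symbox n (\<lambda>_. 1)"
  by (simp add: cube_def symbox_def)

lemma exp_diag_cube: "exp_map (\<lambda>x. t *\<^sub>R diag_map \<alpha> x) ` cube n = symbox n (\<lambda>i. exp (t * \<alpha> i))"
  unfolding exp_map_diag cube_eq by (subst diag_map_symbox) auto

lemma symbox_sub_Rn: "symbox n a \<subseteq> Rn n"
  by (auto simp: symbox_def)

lemma log_concave_on_UNIV_iff:
  fixes \<phi> :: "real \<Rightarrow> ennreal"
  shows "log_concave_on UNIV \<phi> \<longleftrightarrow>
    (\<forall>x y c. 0 < c \<and> c < 1 \<longrightarrow> ennpow (\<phi> x) c * ennpow (\<phi> y) (1 - c) \<le> \<phi> (c * x + (1 - c) * y))"
  unfolding log_concave_on_def using ennpow_mult_le_iff_elog by (auto 4 4)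

text \<open>Any two boxes lie on one diagonal flow: absorb \<open>diag_map b\<close> into
  \<open>T\<close> and take diagonal entries ln (a_i / b_i). Then t = 0 gives the sides b, t = 1 the
  sides a, and t = c their geometric means.\<close>

lemma diag_log_concave_iff_box_ineq:
  assumes f: "density_fun n f"
  shows "diag_log_concave n f \<longleftrightarrow> box_ineq n f"
proof
  have fm: "f \<in> borel_measurable (leb n)" and fp: "\<And>x. x \<in> Rn n \<Longrightarrow> 0 \<le> f x"
    using f by (auto simp: density_fun_def)
  have key: "log_concave_on UNIV (\<lambda>t::real. int_over n (\<lambda>x. f (T x)) (exp_map (\<lambda>x. t *\<^sub>R diag_map \<alpha> x) ` cube n)) \<longleftrightarrow>
    (\<forall>x y c. 0 < c \<and> c < 1 \<longrightarrow>
      ennpow (int_over n f (T ` symbox n (\<lambda>i. exp (x * \<alpha> i)))) c *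
      ennpow (int_over n f (T ` symbox n (\<lambda>i. exp (y * \<alpha> i)))) (1 - c) \<le>
      int_over n f (T ` symbox n (\<lambda>i. exp ((c * x + (1 - c) * y) * \<alpha> i))))" if T: "T \<in> GL n" for T \<alpha>
  proof -
    obtain k where k: "0 < k" "k < \<infinity>"
      "\<And>S. S \<in> sets borel \<Longrightarrow> S \<subseteq> Rn n \<Longrightarrow> int_over n (\<lambda>x. f (T x)) S = k * int_over n f (T ` S)"
      using int_over_GL[OF fm fp T] by blast
    show ?thesis
      unfolding log_concave_on_UNIV_iff exp_diag_cube
      by (simp only: k(3)[OF symbox_borel symbox_sub_Rn] ennpow_scale_iff[OF k(1,2)])
  qed
  {
    assume D: "diag_log_concave n f"
    show "box_ineq n f"
      unfolding box_ineq_def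
    proof (intro ballI allI impI, elim conjE)
      fix T and a b :: "nat \<Rightarrow> real" and c :: real
      assume T: "T \<in> GL n" and ab: "\<forall>i. 0 < a i \<and> 0 < b i" and c: "0 < c" "c < 1"
      define T' where "T' = (\<lambda>x. T (diag_map b x))"
      define \<alpha> where "\<alpha> i = ln (a i / b i)" for i
      have T': "T' \<in> GL n" unfolding T'_def by (rule GL_comp[OF T diag_map_GL]) (use ab in auto)
      have im: "T' ` symbox n e = T ` symbox n (\<lambda>i. b i * e i)" for e
        unfolding T'_def using ab by (subst diag_map_symbox[symmetric]) (auto simp: image_image)
      have e: "b i * exp (t * \<alpha> i) = a i powr t * b i powr (1 - t)" for t i
      proof -
        have ab': "0 < a i" "0 < b i" using ab by auto
        have "b i * exp (t * \<alpha> i) = exp (ln (b i) + t * (ln (a i) - ln (b i)))"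
          using ab' by (simp add: exp_add \<alpha>_def ln_div)
        also have "\<dots> = a i powr t * b i powr (1 - t)"
          using ab' by (simp add: powr_def exp_add[symmetric] algebra_simps)
        finally show ?thesis .
      qed
      have "a i powr 1 * b i powr (1 - 1) = a i" "a i powr 0 * b i powr (1 - 0) = b i" for i
        using ab[rule_format, of i] by auto
      then show "ennpow (int_over n f (T ` symbox n a)) c * ennpow (int_over n f (T ` symbox n b)) (1 - c)
         \<le> int_over n f (T ` symbox n (\<lambda>i. a i powr c * b i powr (1 - c)))"
        using D[unfolded diag_log_concave_def, rule_format, OF T', of \<alpha>, unfolded key[OF T'] im e, rule_format, of c 1 0] c
        by simp
    qed
  }
  {
    assume B: "box_ineq n f"
    show "diag_log_concave n f"
      unfolding diag_log_concave_def
    proof (intro ballI allI)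
      fix T \<alpha> assume T: "T \<in> GL n"
      show "log_concave_on UNIV (\<lambda>t::real. int_over n (\<lambda>x. f (T x)) (exp_map (\<lambda>x. t *\<^sub>R diag_map \<alpha> x) ` cube n))"
        unfolding key[OF T]
      proof (intro allI impI, elim conjE)
        fix x y c :: real assume c: "0 < c" "c < 1"
        have "exp (x * \<alpha> i) powr c * exp (y * \<alpha> i) powr (1 - c) = exp ((c * x + (1 - c) * y) * \<alpha> i)" for i
          by (simp add: powr_def exp_add[symmetric] algebra_simps)
        then show "ennpow (int_over n f (T ` symbox n (\<lambda>i. exp (x * \<alpha> i)))) c *
          ennpow (int_over n f (T ` symbox n (\<lambda>i. exp (y * \<alpha> i)))) (1 - c) \<le>
          int_over n f (T ` symbox n (\<lambda>i. exp ((c * x + (1 - c) * y) * \<alpha> i)))"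
          using B[unfolded box_ineq_def, rule_format, OF T, of "\<lambda>i. exp (x * \<alpha> i)" "\<lambda>i. exp (y * \<alpha> i)" c] c by simp
      qed
    qed
  }
qed

subsection \<open>Log-combinations of parallelepipeds\<close>

lemma compactin_Euclidean_space: "compactin (Euclidean_space n) K \<longleftrightarrow> compact K \<and> K \<subseteq> Rn n"
  by (simp add: Euclidean_space_def euclidean_product_topology compactin_subtopology Rn_eq)

lemma openin_Euclidean_space: "openin (Euclidean_space n) U \<longleftrightarrow> (\<exists>V. open V \<and> U = V \<inter> Rn n)"
  by (simp add: Euclidean_space_def euclidean_product_topology openin_subtopology Rn_eq)

lemma symbox_alt: "symbox n a = (\<Pi>\<^sub>E i\<in>UNIV. if i < n then {- a i..a i} else {0})"
  by (auto simp: symbox_def Rn_eq PiE_iff abs_le_iff minus_le_iff split: if_splits)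

lemma compact_symbox: "compact (symbox n a)"
proof -
  have "compactin (product_topology (\<lambda>i::nat. euclidean :: real topology) UNIV) (symbox n a)"
    unfolding symbox_alt by (subst compactin_PiE) auto
  then show ?thesis by (simp add: euclidean_product_topology)
qed

lemma bdd_above_dot:
  assumes "compact K" shows "bdd_above ((\<lambda>y. dot n u y) ` K)"
proof -
  have "continuous_on K (dot n u)"
    unfolding dot_def by (intro continuous_intros continuous_coord)
  then show ?thesis
    by (intro bounded_imp_bdd_above compact_imp_bounded compact_continuous_image assms)
qed

lemma GL_image_symbox:
  assumes "T \<in> GL n" shows "T ` symbox n a = lin_on n T ` symbox n a"
  using assms symbox_sub_Rn[of n a] by (intro image_cong) (auto simp: lin_on_eq GL_def)

lemma GL_image_compact: "T \<in> GL n \<Longrightarrow> compact (T ` symbox n a)"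
  unfolding GL_image_symbox by (rule compact_continuous_image[OF continuous_lin_on compact_symbox])

lemma GL_image_sub: "T \<in> GL n \<Longrightarrow> T ` symbox n a \<subseteq> Rn n"
  using symbox_sub_Rn[of n a] by (auto simp: GL_def bij_betw_def)

lemma zero_mem_symbox: "(\<And>i. 0 < a i) \<Longrightarrow> 0 \<in> symbox n a"
  by (auto simp: symbox_def Rn_eq less_imp_le)

lemma dot_zero [simp]: "dot n w 0 = 0" "dot n 0 w = 0"
  by (simp_all add: dot_def)

lemma dot_sum: "dot n w (\<Sum>i\<in>I. v i) = (\<Sum>i\<in>I. dot n w (v i))"
  unfolding dot_def sum_fun_apply sum_distrib_left by (rule sum.swap)

lemma dot_scale_left: "dot n (r *\<^sub>R x) u = r * dot n x u"
  by (simp add: dot_def sum_distrib_left mult.assoc)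

text \<open>It suffices to test a log-combination in the facet normals of the boxes, where the
  support functions are multiples of the side lengths with one common factor.\<close>

lemma log_comb_boxes:
  assumes T: "T \<in> GL n" and a: "\<And>i. 0 < a i" and b: "\<And>i. 0 < b i" and c: "0 < c" "c < 1"
  shows "log_comb n c (T ` symbox n a) (T ` symbox n b) \<subseteq> T ` symbox n (\<lambda>i. a i powr c * b i powr (1 - c))"
proof
  fix x assume x: "x \<in> log_comb n c (T ` symbox n a) (T ` symbox n b)"
  then have xR: "x \<in> Rn n" by (simp add: log_comb_def)
  obtain S where S: "S \<in> GL n" "\<And>x. x \<in> Rn n \<Longrightarrow> S (T x) = x" "\<And>x. x \<in> Rn n \<Longrightarrow> T (S x) = x"
    using GL_inverse[OF T] by blast
  have lin: "linear T" "linear S" and TR: "\<And>x. x \<in> Rn n \<Longrightarrow> T x \<in> Rn n" and SR: "\<And>x. x \<in> Rn n \<Longrightarrow> S x \<in> Rn n"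
    using S T by (auto simp: GL_def bij_betw_def)
  let ?c = "\<lambda>i. a i powr c * b i powr (1 - c)"
  have coord: "\<bar>S x i\<bar> \<le> ?c i" if i: "i < n" for i
  proof -
    \<comment> \<open>The i-th row of the inverse matrix: the dot product with it reads off the i-th
      box coordinate. Its two unit multiples are the normals of the i-th pair of facets.\<close>
    define \<rho> where "\<rho> j = (if j < n then S (axis_vec j) i else 0)" for j
    have \<rho>R: "\<rho> \<in> Rn n" by (auto simp: \<rho>_def Rn_eq)
    have dot_\<rho>: "dot n y \<rho> = S y i" if "y \<in> Rn n" for y
      using lin_on_eq[OF lin(2) that] by (simp add: dot_def \<rho>_def flip: lin_on_apply)
    have "dot n (T (axis_vec i)) \<rho> = 1"
      using dot_\<rho>[OF TR[OF axis_vec_Rn[OF i]]] S(2)[OF axis_vec_Rn[OF i]] by (simp add: axis_vec_def)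
    then have "\<rho> \<noteq> 0" by (auto simp: dot_def)
    moreover have "0 \<le> dot n \<rho> \<rho>" by (simp add: dot_def sum_nonneg)
    moreover have "dot n \<rho> \<rho> = 0 \<Longrightarrow> \<rho> = 0"
      using \<rho>R by (auto simp: dot_def Rn_eq fun_eq_iff sum_nonneg_eq_0_iff not_less) (metis lessThan_iff not_less)
    ultimately have pos: "0 < dot n \<rho> \<rho>" by linarith
    define \<kappa> where "\<kappa> = 1 / sqrt (dot n \<rho> \<rho>)"
    have \<kappa>: "0 < \<kappa>" "\<kappa> * (\<kappa> * dot n \<rho> \<rho>) = 1" using pos by (auto simp: \<kappa>_def field_simps)
    have bound: "s * S x i \<le> ?c i" if s: "\<bar>s\<bar> = 1" for s
    proof -
      define w where "w = (s * \<kappa>) *\<^sub>R \<rho>"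
      have s2: "s * s = 1" using s by (metis abs_mult_self_eq mult_1)
      have "dot n w w = (s * s) * (\<kappa> * (\<kappa> * dot n \<rho> \<rho>))"
        by (simp add: w_def dot_scale dot_scale_left)
      then have wS: "w \<in> unit_sphere n"
        using \<kappa> s2 \<rho>R by (simp add: unit_sphere_def w_def Rn_scale)
      have sup: "0 \<le> support_fun n (T ` symbox n e) w \<and> support_fun n (T ` symbox n e) w \<le> \<kappa> * e i"
        if e: "\<And>i. 0 < e i" for e
      proof
        have T0: "0 \<in> T ` symbox n e" using zero_mem_symbox[of e n] e linear_0[OF lin(1)] by force
        have "dot n w 0 \<le> support_fun n (T ` symbox n e) w"
          unfolding support_fun_def by (intro cSUP_upper T0 bdd_above_dot GL_image_compact T)
        then show "0 \<le> support_fun n (T ` symbox n e) w" by (simp add: dot_def)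
        show "support_fun n (T ` symbox n e) w \<le> \<kappa> * e i"
          unfolding support_fun_def
        proof (rule cSUP_least)
          fix y assume "y \<in> T ` symbox n e"
          then obtain z where z: "z \<in> symbox n e" "y = T z" by blast
          then have zR: "z \<in> Rn n" by (simp add: symbox_def)
          have "dot n w y = s * \<kappa> * z i"
            using dot_\<rho>[OF TR[OF zR]] S(2)[OF zR] by (simp add: w_def dot_scale_left dot_commute[of n \<rho>] z(2))
          also have "\<dots> \<le> \<bar>s * \<kappa> * z i\<bar>" by simp
          also have "\<dots> \<le> \<kappa> * e i"
            using z(1) i \<kappa> s by (simp add: abs_mult symbox_def)
          finally show "dot n w y \<le> \<kappa> * e i" .
        qed (use T0 in auto)
      qed
      have "s * \<kappa> * S x i = dot n x w"
        by (simp add: w_def dot_scale dot_\<rho>[OF xR])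
      also have "\<dots> \<le> support_fun n (T ` symbox n a) w powr c * support_fun n (T ` symbox n b) w powr (1 - c)"
        using x wS by (simp add: log_comb_def)
      also have "\<dots> \<le> (\<kappa> * a i) powr c * (\<kappa> * b i) powr (1 - c)"
        using sup[of a] sup[of b] a b c by (intro mult_mono powr_mono2) auto
      also have "\<dots> = (\<kappa> powr c * \<kappa> powr (1 - c)) * ?c i"
        using \<kappa> a[of i] b[of i] by (simp add: powr_mult)
      also have "\<kappa> powr c * \<kappa> powr (1 - c) = \<kappa>"
        using \<kappa> by (simp add: powr_add[symmetric])
      finally have "\<kappa> * (s * S x i) \<le> \<kappa> * ?c i" by (simp add: algebra_simps)
      then show ?thesis using \<kappa> by simp
    qed
    show ?thesis using bound[of 1] bound[of "-1"] by (simp add: abs_le_iff)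
  qed
  have "S x \<in> symbox n ?c" using coord SR[OF xR] by (simp add: symbox_def)
  then show "x \<in> T ` symbox n ?c" using S(3)[OF xR] by (metis image_eqI)
qed

section \<open>Linear images of boxes as admissible bodies with parallel facets\<close>

lemma GL_box_symmetric: "T \<in> GL n \<Longrightarrow> symmetric_set (T ` symbox n a)"
proof -
  assume "T \<in> GL n"
  then have lin: "linear T" by (simp add: GL_def)
  have "uminus ` symbox n a = symbox n a"
  proof -
    have "- x \<in> symbox n a" if "x \<in> symbox n a" for x using that by (auto simp: symbox_def Rn_eq)
    then show ?thesis by (metis image_subsetI subset_antisym image_eqI add.inverse_inverse subsetI)
  qed
  then show ?thesis
    unfolding symmetric_set_def image_image linear_neg[OF lin, symmetric] by (metis image_image)
qed

lemma GL_box_parallelepiped: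
  assumes T: "T \<in> GL n" and a: "\<And>i. 0 < a i" shows "parallelepiped n (T ` symbox n a)"
  unfolding parallelepiped_def
proof (intro bexI)
  have "diag_map a ` cube n = symbox n a"
    unfolding cube_eq using a by (subst diag_map_symbox) auto
  then show "T ` symbox n a = (\<lambda>x. 0 + T (diag_map a x)) ` cube n"
    by (metis (no_types, lifting) add_0 image_cong image_image)
qed (auto intro: GL_comp[OF T diag_map_GL] a Rn_0)

lemma GL_box_convex_body:
  assumes T: "T \<in> GL n" and a: "\<And>i. 0 < a i" shows "convex_body n (T ` symbox n a)"
proof -
  obtain S where S: "S \<in> GL n" "\<And>x. x \<in> Rn n \<Longrightarrow> S (T x) = x" "\<And>x. x \<in> Rn n \<Longrightarrow> T (S x) = x"
    using GL_inverse[OF T] by blast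
  have lin: "linear T" "linear S" and SR: "\<And>x. x \<in> Rn n \<Longrightarrow> S x \<in> Rn n"
    using S T by (auto simp: GL_def bij_betw_def)
  have "convex (symbox n a)"
    unfolding convex_def
  proof (intro ballI allI impI)
    fix x y and s t :: real
    assume xy: "x \<in> symbox n a" "y \<in> symbox n a" and st: "0 \<le> s" "0 \<le> t" "s + t = 1"
    have "\<bar>s * x i + t * y i\<bar> \<le> a i" if i: "i < n" for i
    proof -
      have "\<bar>s * x i + t * y i\<bar> \<le> s * \<bar>x i\<bar> + t * \<bar>y i\<bar>"
        using abs_triangle_ineq[of "s * x i" "t * y i"] st by (simp add: abs_mult)
      also have "\<dots> \<le> s * a i + t * a i"
        using xy i st by (intro add_mono mult_left_mono) (auto simp: symbox_def)
      also have "\<dots> = a i" using st(3) by (metis distrib_right mult_1)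
      finally show ?thesis .
    qed
    then show "s *\<^sub>R x + t *\<^sub>R y \<in> symbox n a" using xy by (auto simp: symbox_def Rn_eq)
  qed
  then have "convex (T ` symbox n a)" by (rule convex_linear_image[OF lin(1)])
  moreover have "Euclidean_space n interior_of (T ` symbox n a) \<noteq> {}"
  proof -
    define V where "V = (\<Inter>i\<in>{..<n}. {y. \<bar>lin_on n S y i\<bar> < a i})"
    have "open V"
      unfolding V_def
      by (intro open_INT finite_lessThan ballI open_Collect_less continuous_on_rabs continuous_coord continuous_lin_on continuous_on_const)
    then have op: "openin (Euclidean_space n) (V \<inter> Rn n)" by (auto simp: openin_Euclidean_space)
    have "V \<inter> Rn n \<subseteq> T ` symbox n a"
    proof
      fix y assume y: "y \<in> V \<inter> Rn n"
      then have "S y \<in> symbox n a"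
        by (auto simp: V_def symbox_def lin_on_eq[OF lin(2)] SR less_imp_le)
      then show "y \<in> T ` symbox n a" using S(3)[of y] y by (metis IntD2 image_eqI)
    qed
    from interior_of_maximal[OF this op] have "V \<inter> Rn n \<subseteq> Euclidean_space n interior_of (T ` symbox n a)" .
    moreover have "0 \<in> V \<inter> Rn n" using a by (simp add: V_def Rn_0 lin_on_def)
    ultimately show ?thesis by blast
  qed
  ultimately show ?thesis
    using GL_image_compact[OF T] GL_image_sub[OF T] by (simp add: convex_body_def compactin_Euclidean_space)
qed

text \<open>A linear functional on a box is maximised coordinate by coordinate: a coordinate with
  non-zero coefficient is frozen at one end, the others are free.\<close>

lemma exposed_face_box:
  assumes T: "T \<in> GL n" and a: "\<And>i. 0 < a i"
  shows "exposed_face n (T ` symbox n a) w =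
    T ` {z \<in> symbox n a. \<forall>i<n. z i * dot n (T (axis_vec i)) w = a i * \<bar>dot n (T (axis_vec i)) w\<bar>}"
proof -
  have lin: "linear T" using T by (simp add: GL_def)
  define t where "t i = dot n (T (axis_vec i)) w" for i
  have dT: "dot n (T z) w = (\<Sum>i<n. z i * t i)" if "z \<in> symbox n a" for z
  proof -
    have z: "z \<in> Rn n" using that by (simp add: symbox_def)
    have "dot n (T z) w = dot n w (\<Sum>i<n. z i *\<^sub>R T (axis_vec i))"
      using lin_on_eq[OF lin z] by (simp add: lin_on_def dot_commute)
    also have "\<dots> = (\<Sum>i<n. z i * t i)"
      by (simp add: dot_sum dot_scale t_def dot_commute)
    finally show ?thesis .
  qed
  have le: "z i * t i \<le> a i * \<bar>t i\<bar>" if "z \<in> symbox n a" "i < n" for z i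
  proof -
    have "z i * t i \<le> \<bar>z i\<bar> * \<bar>t i\<bar>" by (metis abs_ge_self abs_mult)
    also have "\<dots> \<le> a i * \<bar>t i\<bar>" using that by (intro mult_right_mono) (auto simp: symbox_def)
    finally show ?thesis .
  qed
  have sup: "support_fun n (T ` symbox n a) w = (\<Sum>i<n. a i * \<bar>t i\<bar>)"
    unfolding support_fun_def
  proof (rule cSup_eq_maximum)
    define z where "z i = (if i < n then a i * sgn (t i) else 0)" for i
    have z: "z \<in> symbox n a"
      using a by (auto simp: z_def symbox_def Rn_eq abs_mult abs_sgn_eq less_imp_le)
    have "dot n w (T z) = (\<Sum>i<n. a i * \<bar>t i\<bar>)"
      unfolding dot_commute[of n w] dT[OF z] by (intro sum.cong) (auto simp: z_def abs_sgn mult.assoc mult.commute)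
    then show "(\<Sum>i<n. a i * \<bar>t i\<bar>) \<in> dot n w ` T ` symbox n a" using z by (metis image_eqI)
    fix r assume "r \<in> dot n w ` T ` symbox n a"
    then obtain z where z: "z \<in> symbox n a" "r = dot n w (T z)" by blast
    show "r \<le> (\<Sum>i<n. a i * \<bar>t i\<bar>)"
      unfolding z(2) dot_commute[of n w] dT[OF z(1)] by (intro sum_mono le z(1)) simp
  qed
  have "(\<Sum>i<n. z i * t i) = (\<Sum>i<n. a i * \<bar>t i\<bar>) \<longleftrightarrow> (\<forall>i<n. z i * t i = a i * \<bar>t i\<bar>)"
    if z: "z \<in> symbox n a" for z
  proof -
    have "(\<Sum>i<n. z i * t i) = (\<Sum>i<n. a i * \<bar>t i\<bar>) \<longleftrightarrow> (\<Sum>i<n. a i * \<bar>t i\<bar> - z i * t i) = 0"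
      by (auto simp: sum_subtractf)
    also have "\<dots> \<longleftrightarrow> (\<forall>i\<in>{..<n}. a i * \<bar>t i\<bar> - z i * t i = 0)"
      using le[OF z] by (intro sum_nonneg_eq_0_iff) auto
    finally show ?thesis by auto
  qed
  then show ?thesis
    unfolding exposed_face_def sup using dT by (auto simp: t_def)
qed

text \<open>In a given direction \<open>w\<close> the faces of both boxes have the same frozen
  coordinates, so a difference within one face becomes, after shrinking, a difference within the
  other.\<close>

lemma box_face_span:
  assumes T: "T \<in> GL n" and a: "\<And>i. 0 < a i" and b: "\<And>i. 0 < b i"
  shows "{x - y |x y. x \<in> exposed_face n (T ` symbox n a) w \<and> y \<in> exposed_face n (T ` symbox n a) w} \<subseteq>
    span {x - y |x y. x \<in> exposed_face n (T ` symbox n b) w \<and> y \<in> exposed_face n (T ` symbox n b) w}"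
    (is "_ \<subseteq> span ?D")
proof safe
  have lin: "linear T" using T by (simp add: GL_def)
  define t where "t i = dot n (T (axis_vec i)) w" for i
  fix x y assume "x \<in> exposed_face n (T ` symbox n a) w" "y \<in> exposed_face n (T ` symbox n a) w"
  then obtain z z' where z: "x = T z" "z \<in> symbox n a" "\<And>i. i < n \<Longrightarrow> z i * t i = a i * \<bar>t i\<bar>"
    and z': "y = T z'" "z' \<in> symbox n a" "\<And>i. i < n \<Longrightarrow> z' i * t i = a i * \<bar>t i\<bar>"
    unfolding exposed_face_box[OF T a] t_def by blast
  \<comment> \<open>Small enough that s times a difference of two points of the first box fits into
    the second box; the summand 1 keeps the denominator positive for n = 0.\<close>
  define s where "s = 1 / (1 + (\<Sum>i<n. 2 * a i / b i))"
  have sum0: "0 \<le> (\<Sum>i<n. 2 * a i / b i)" using a b by (intro sum_nonneg) (auto simp: less_imp_le)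
  then have s: "0 < s" by (auto simp: s_def intro!: divide_pos_pos)
  have sb: "s * (2 * a i) \<le> b i" if "i < n" for i
  proof -
    have "2 * a i / b i \<le> (\<Sum>i<n. 2 * a i / b i)"
      using that a b by (intro member_le_sum) (auto simp: less_imp_le)
    then have "2 * a i / b i \<le> 1 + (\<Sum>i<n. 2 * a i / b i)" by simp
    then have "2 * a i \<le> (1 + (\<Sum>i<n. 2 * a i / b i)) * b i"
      using b[of i] by (simp add: pos_divide_le_eq)
    then show ?thesis using sum0 unfolding s_def by (simp add: pos_divide_le_eq mult.commute)
  qed
  define e where "e v i = (if i < n then (if t i = 0 then v i else b i * sgn (t i)) else 0)" for v i
  have e: "T (e v) \<in> exposed_face n (T ` symbox n b) w" if "\<And>i. i < n \<Longrightarrow> \<bar>v i\<bar> \<le> b i" for v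
    unfolding exposed_face_box[OF T b] t_def[symmetric]
  proof (intro imageI CollectI conjI allI impI)
    show "e v \<in> symbox n b" using that b by (auto simp: e_def symbox_def Rn_eq abs_mult abs_sgn_eq less_imp_le)
    show "e v i * t i = b i * \<bar>t i\<bar>" if "i < n" for i using that by (simp add: e_def abs_sgn mult.assoc mult.commute)
  qed
  have zz: "z i = z' i" if "i < n" "t i \<noteq> 0" for i
    using z(3)[OF that(1)] z'(3)[OF that(1)] that(2) by (metis mult_right_cancel)
  have "s *\<^sub>R (z - z') = e (s *\<^sub>R (z - z')) - e 0"
    using z(2) z'(2) zz by (auto simp: e_def fun_eq_iff symbox_def Rn_eq not_less)
  then have "s *\<^sub>R (x - y) = T (e (s *\<^sub>R (z - z'))) - T (e 0)"
    unfolding z(1) z'(1) by (metis linear_diff[OF lin] linear_scale[OF lin])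
  moreover have "T (e (s *\<^sub>R (z - z'))) - T (e 0) \<in> ?D"
  proof -
    have "\<bar>(s *\<^sub>R (z - z')) i\<bar> \<le> b i" if i: "i < n" for i
    proof -
      have "\<bar>z i - z' i\<bar> \<le> 2 * a i" using z(2) z'(2) i by (auto simp: symbox_def) (smt (verit))
      then have "s * \<bar>z i - z' i\<bar> \<le> s * (2 * a i)" using s by (intro mult_left_mono) auto
      then have "s * \<bar>z i - z' i\<bar> \<le> b i" using sb[OF i] by linarith
      then show ?thesis using s by (simp add: abs_mult)
    qed
    moreover have "\<bar>0 i\<bar> \<le> b i" for i using b[of i] by simp
    ultimately show ?thesis using e[of "s *\<^sub>R (z - z')"] e[of 0] by blast
  qed
  ultimately have "s *\<^sub>R (x - y) \<in> span ?D" by (simp only: span_base)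
  then have "(1 / s) *\<^sub>R (s *\<^sub>R (x - y)) \<in> span ?D" by (rule span_scale)
  then show "x - y \<in> span ?D" using s by simp
qed

text \<open>In every direction the differences within the two faces span the same subspace, so
  either both faces are facets or neither is.\<close>

lemma GL_box_parallel_facets:
  assumes T: "T \<in> GL n" and a: "\<And>i. 0 < a i" and b: "\<And>i. 0 < b i"
  shows "parallel_facets n (T ` symbox n a) (T ` symbox n b)"
proof -
  have "dim {x - y |x y. x \<in> exposed_face n (T ` symbox n a) w \<and> y \<in> exposed_face n (T ` symbox n a) w} =
    dim {x - y |x y. x \<in> exposed_face n (T ` symbox n b) w \<and> y \<in> exposed_face n (T ` symbox n b) w}" for w
    by (intro span_eq_dim antisym span_minimal subspace_span box_face_span[OF T] a b)
  then show ?thesis by (simp add: parallel_facets_def facet_normals_def)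
qed

lemma box_ineq_if_log_BM_for:
  assumes "\<And>T a b c. T \<in> GL n \<Longrightarrow> (\<And>i. 0 < a i) \<Longrightarrow> (\<And>i. 0 < b i) \<Longrightarrow> 0 < c \<Longrightarrow> c < 1 \<Longrightarrow>
    log_BM_for n f c (T ` symbox n a) (T ` symbox n b)"
  shows "box_ineq n f"
  unfolding box_ineq_def
proof (intro ballI allI impI, elim conjE)
  fix T and a b :: "nat \<Rightarrow> real" and c :: real
  assume T: "T \<in> GL n" and ab: "\<forall>i. 0 < a i \<and> 0 < b i" and c: "0 < c" "c < 1"
  have "ennpow (int_over n f (T ` symbox n a)) c * ennpow (int_over n f (T ` symbox n b)) (1 - c) \<le>
    int_over n f (log_comb n c (T ` symbox n a) (T ` symbox n b))"
    using assms[OF T _ _ c, of a b] ab by (simp add: log_BM_for_def)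
  also have "\<dots> \<le> int_over n f (T ` symbox n (\<lambda>i. a i powr c * b i powr (1 - c)))"
    unfolding int_over_def using log_comb_boxes[OF T _ _ c, of a b] ab
    by (intro nn_integral_mono mult_left_mono) (auto simp: indicator_def)
  finally show "ennpow (int_over n f (T ` symbox n a)) c * ennpow (int_over n f (T ` symbox n b)) (1 - c) \<le>
    int_over n f (T ` symbox n (\<lambda>i. a i powr c * b i powr (1 - c)))" .
qed

lemma log_BM_imp_box_ineq: "log_BM n f \<Longrightarrow> box_ineq n f"
  by (intro box_ineq_if_log_BM_for) (auto simp: log_BM_def GL_box_convex_body GL_box_symmetric)

lemma log_BM_parallelepipeds_imp_box_ineq: "log_BM_parallelepipeds n f \<Longrightarrow> box_ineq n f"
  by (intro box_ineq_if_log_BM_for)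
    (auto simp: log_BM_parallelepipeds_def GL_box_parallelepiped GL_box_symmetric GL_box_parallel_facets)

subsection \<open>The one-dimensional Prekopa-Leindler inequality\<close>

text \<open>Inner regularity supplies a closed set, and cutting it with growing intervals makes it
  compact. The strict lower bound \<open>y\<close> in place of an error term admits sets of infinite
  measure.\<close>

lemma emeasure_lborel_inner_compact:
  fixes A :: "real set"
  assumes [measurable]: "A \<in> sets borel" and y: "y < emeasure lborel A"
  obtains K where "compact K" "K \<subseteq> A" "K \<noteq> {}" "y < emeasure lborel K"
proof -
  obtain z where z: "y < z" "z < emeasure lborel A" using dense[OF y] by blast
  obtain y' where y': "y = ennreal y'" "0 \<le> y'" using z(1) by (cases y rule: ennreal_cases) auto
  obtain z' where z': "z = ennreal z'" "0 \<le> z'" using z(2) by (cases z rule: ennreal_cases) auto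
  have e: "0 < z' - y'" using z(1) y' z' by (simp add: ennreal_less_iff)
  have "A \<in> sets lebesgue" by simp
  then obtain T where T: "closed T" "T \<subseteq> A" "emeasure lebesgue (A - T) < ennreal (z' - y')"
    using sets_lebesgue_inner_closed[OF _ e] by metis
  have [measurable]: "T \<in> sets borel" using T(1) by simp
  have yT: "y < emeasure lborel T"
  proof (rule ccontr)
    assume "\<not> y < emeasure lborel T"
    then have "emeasure lborel T \<le> ennreal y'" by (simp add: y')
    moreover have "emeasure lborel (A - T) \<le> ennreal (z' - y')"
      using T(3) by (simp add: less_imp_le)
    moreover have "emeasure lborel A \<le> emeasure lborel T + emeasure lborel (A - T)"
      using emeasure_subadditive[of T lborel "A - T"] T(2) by (simp add: Un_absorb1)
    ultimately have "emeasure lborel A \<le> ennreal y' + ennreal (z' - y')"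
      by (meson add_mono order_trans)
    also have "\<dots> = z" using y' z' e by (simp add: ennreal_plus[symmetric] del: ennreal_plus)
    finally show False using z(2) by simp
  qed
  have "(SUP k. emeasure lborel (T \<inter> {- real k..real k})) = emeasure lborel (\<Union>k. T \<inter> {- real k..real k})"
    by (rule SUP_emeasure_incseq) (auto simp: incseq_def)
  also have "(\<Union>k. T \<inter> {- real k..real k}) = T"
  proof -
    have "\<exists>k::nat. - real k \<le> x \<and> x \<le> real k" for x :: real
    proof -
      obtain k :: nat where "\<bar>x\<bar> \<le> real k" using real_arch_simple by blast
      then show ?thesis by (intro exI[of _ k]) linarith
    qed
    then show ?thesis by auto
  qed
  finally have "y < (SUP k. emeasure lborel (T \<inter> {- real k..real k}))" using yT by simp
  then obtain k where k: "y < emeasure lborel (T \<inter> {- real k..real k})"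
    by (auto simp: less_SUP_iff)
  show thesis
    by (rule that[of "T \<inter> {- real k..real k}"]) (use T k in \<open>auto simp: closed_Int_compact\<close>)
qed

text \<open>\<open>C\<close> contains the translates A + min B and max A + B, which meet at most in
  the single point max A + min B.\<close>

lemma brunn_minkowski_1d_compact:
  fixes A B C :: "real set"
  assumes A: "compact A" "A \<noteq> {}" and B: "compact B" "B \<noteq> {}"
    and C: "C \<in> sets borel" "\<And>x y. x \<in> A \<Longrightarrow> y \<in> B \<Longrightarrow> x + y \<in> C"
  shows "emeasure lborel A + emeasure lborel B \<le> emeasure lborel C"
proof -
  obtain a where a: "a \<in> A" "\<And>x. x \<in> A \<Longrightarrow> x \<le> a" using compact_attains_sup[OF A] by blast
  obtain b where b: "b \<in> B" "\<And>x. x \<in> B \<Longrightarrow> b \<le> x" using compact_attains_inf[OF B] by blast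
  have [measurable]: "A \<in> sets borel" "B \<in> sets borel" using A B by (auto simp: compact_imp_closed)
  note C(1)[measurable]
  define A' where "A' = {x. x - b \<in> A}"
  define B' where "B' = {x. x - a \<in> B \<and> x \<noteq> a + b}"
  have [measurable]: "A' \<in> sets borel" "B' \<in> sets borel" unfolding A'_def B'_def by measurable
  have shift: "emeasure lborel {x. x - t \<in> S} = emeasure lborel S" if [measurable]: "S \<in> sets borel" for S and t :: real
  proof -
    have "emeasure lborel S = emeasure (distr lborel borel ((+) (- t))) S" by (simp add: lborel_distr_plus)
    also have "\<dots> = emeasure lborel ((+) (- t) -` S)" by (subst emeasure_distr) auto
    also have "(+) (- t) -` S = {x. x - t \<in> S}" by auto
    finally show ?thesis by simp
  qed
  have "emeasure lborel B = emeasure lborel {x. x - a \<in> B}" by (simp add: shift)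
  also have "\<dots> \<le> emeasure lborel (B' \<union> {a + b})"
    by (intro emeasure_mono) (auto simp: B'_def)
  also have "\<dots> \<le> emeasure lborel B' + emeasure lborel {a + b}" by (rule emeasure_subadditive) auto
  finally have B': "emeasure lborel B \<le> emeasure lborel B'" by simp
  have "emeasure lborel A + emeasure lborel B \<le> emeasure lborel A' + emeasure lborel B'"
    using B' by (intro add_mono) (simp_all add: A'_def shift)
  also have "\<dots> = emeasure lborel (A' \<union> B')"
  proof (rule plus_emeasure)
    show "A' \<inter> B' = {}"
    proof (intro equals0I, elim IntE)
      fix x assume "x \<in> A'" "x \<in> B'"
      then have "x - b \<le> a" "b \<le> x - a" "x \<noteq> a + b" using a(2) b(2) by (auto simp: A'_def B'_def)
      then show False by linarith
    qed
  qed auto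
  also have "\<dots> \<le> emeasure lborel C"
  proof (intro emeasure_mono subsetI)
    fix x assume "x \<in> A' \<union> B'"
    then show "x \<in> C"
      using C(2)[of "x - b" b] C(2)[of a "x - a"] a b by (auto simp: A'_def B'_def)
  qed simp
  finally show ?thesis .
qed

lemma brunn_minkowski_1d:
  fixes A B C :: "real set"
  assumes [measurable]: "A \<in> sets borel" "B \<in> sets borel" "C \<in> sets borel"
    and ne: "A \<noteq> {}" "B \<noteq> {}" and C: "\<And>x y. x \<in> A \<Longrightarrow> y \<in> B \<Longrightarrow> x + y \<in> C"
  shows "emeasure lborel A + emeasure lborel B \<le> emeasure lborel C"
proof -
  \<comment> \<open>The alternative y = 0 covers a non-empty set of measure zero: a singleton serves
    as compact subset, and a point is required because the sum with an empty set is empty.\<close>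
  have inner: "\<exists>K. compact K \<and> K \<subseteq> S \<and> K \<noteq> {} \<and> y \<le> emeasure lborel K"
    if [measurable]: "S \<in> sets borel" and ne: "S \<noteq> {}" and y: "y < emeasure lborel S \<or> y = 0" for S :: "real set" and y
  proof (cases "y < emeasure lborel S")
    case True
    then show ?thesis using emeasure_lborel_inner_compact[OF that(1), of y] by (metis less_imp_le)
  next
    case False
    obtain s where "s \<in> S" using ne by blast
    then show ?thesis using False y by (intro exI[of _ "{s}"]) auto
  qed
  have key: "y + z \<le> emeasure lborel C"
    if y: "y < emeasure lborel A \<or> y = 0" and z: "z < emeasure lborel B \<or> z = 0" for y z
  proof -
    obtain K L where K: "compact K" "K \<subseteq> A" "K \<noteq> {}" "y \<le> emeasure lborel K"
      and L: "compact L" "L \<subseteq> B" "L \<noteq> {}" "z \<le> emeasure lborel L"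
      using inner[of A y] inner[of B z] y z ne by auto
    have "y + z \<le> emeasure lborel K + emeasure lborel L" using K L by (intro add_mono)
    also have "\<dots> \<le> emeasure lborel C"
      using K L C by (intro brunn_minkowski_1d_compact) auto
    finally show ?thesis .
  qed
  have sup: "emeasure lborel S = (SUP y\<in>{y. y < emeasure lborel S \<or> y = 0}. y)" for S :: "real set"
  proof (rule antisym)
    show "emeasure lborel S \<le> (SUP y\<in>{y. y < emeasure lborel S \<or> y = 0}. y)"
      by (rule le_SUP_iff[THEN iffD2]) (metis (mono_tags) dense mem_Collect_eq)
    show "(SUP y\<in>{y. y < emeasure lborel S \<or> y = 0}. y) \<le> emeasure lborel S"
      by (rule SUP_least) auto
  qed
  have "emeasure lborel A + emeasure lborel B =
      (SUP y\<in>{y. y < emeasure lborel A \<or> y = 0}. y + emeasure lborel B)"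
    by (subst sup[of A]) (rule ennreal_SUP_add_left[where f="\<lambda>z. z", symmetric], auto)
  also have "\<dots> \<le> emeasure lborel C"
  proof (rule SUP_least)
    fix y assume y: "y \<in> {y. y < emeasure lborel A \<or> y = 0}"
    have "y + emeasure lborel B = (SUP z\<in>{z. z < emeasure lborel B \<or> z = 0}. y + z)"
      by (subst sup[of B]) (rule ennreal_SUP_add_right[where f="\<lambda>z. z"], auto)
    also have "\<dots> \<le> emeasure lborel C"
      using y by (intro SUP_least key) auto
    finally show "y + emeasure lborel B \<le> emeasure lborel C" .
  qed
  finally show ?thesis .
qed

lemma nn_integral_truncated_layers:
  fixes w :: "real \<Rightarrow> ennreal"
  assumes [measurable]: "w \<in> borel_measurable borel"
  shows "(\<integral>\<^sup>+\<tau>. indicator {0<..<1} \<tau> * emeasure lborel {x. ennreal \<tau> < w x} \<partial>lborel) = (\<integral>\<^sup>+x. min 1 (w x) \<partial>lborel)"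
proof -
  have "(\<integral>\<^sup>+\<tau>. indicator {0<..<1} \<tau> * emeasure lborel {x. ennreal \<tau> < w x} \<partial>lborel) =
    (\<integral>\<^sup>+\<tau>. (\<integral>\<^sup>+x. indicator {0<..<1} \<tau> * indicator {x. ennreal \<tau> < w x} x \<partial>lborel) \<partial>lborel)"
    by (intro nn_integral_cong) (simp add: nn_integral_cmult)
  also have "\<dots> = (\<integral>\<^sup>+x. (\<integral>\<^sup>+\<tau>. indicator {0<..<1} \<tau> * indicator {x. ennreal \<tau> < w x} x \<partial>lborel) \<partial>lborel)"
    by (rule lborel_pair.Fubini') measurable
  also have "\<dots> = (\<integral>\<^sup>+x. min 1 (w x) \<partial>lborel)"
  proof (rule nn_integral_cong)
    fix x
    define r where "r = enn2real (min 1 (w x))"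
    have r: "ennreal r = min 1 (w x)" "0 \<le> r" "r \<le> 1"
    proof -
      have "min 1 (w x) \<le> 1" by simp
      then have "min 1 (w x) < top" by (rule le_less_trans) simp
      then show "ennreal r = min 1 (w x)" by (simp add: r_def)
      then show "r \<le> 1" by (metis ennreal_le_1 min.cobounded1)
    qed (simp add: r_def)
    have "(indicator {0<..<1} \<tau> * indicator {x. ennreal \<tau> < w x} x :: ennreal) = indicator {0<..<r} \<tau>" for \<tau>
    proof (cases "0 < \<tau> \<and> \<tau> < 1")
      case True
      then have "ennreal \<tau> < 1" by (metis ennreal_1 ennreal_less_iff less_imp_le)
      then have "ennreal \<tau> < w x \<longleftrightarrow> ennreal \<tau> < ennreal r" unfolding r by simp
      also have "\<dots> \<longleftrightarrow> \<tau> < r" using True by (simp add: ennreal_less_iff)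
      finally show ?thesis using True by (simp add: indicator_def)
    next
      case False then show ?thesis using r by (auto simp: indicator_def)
    qed
    then have "(\<integral>\<^sup>+\<tau>. indicator {0<..<1} \<tau> * indicator {x. ennreal \<tau> < w x} x \<partial>lborel) = emeasure lborel {0<..<r}"
      by simp
    then show "(\<integral>\<^sup>+\<tau>. indicator {0<..<1} \<tau> * indicator {x. ennreal \<tau> < w x} x \<partial>lborel) = min 1 (w x)"
      using r by simp
  qed
  finally show ?thesis .
qed

text \<open>Both functions are scaled to supremum 1, which boundedness permits. Then at each level
  below 1 both superlevel sets are non-empty and Brunn-Minkowski on the line applies. Integration
  over the levels gives an arithmetic mean of the integrals, and the weighted arithmetic-geometric
  inequality turns it into the product.\<close>

lemma prekopa_leindler_1d:
  fixes p q :: "real \<Rightarrow> real" and w :: "real \<Rightarrow> ennreal"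
  assumes [measurable]: "p \<in> borel_measurable borel" "q \<in> borel_measurable borel" "w \<in> borel_measurable borel"
    and p0: "\<And>x. 0 \<le> p x" and q0: "\<And>x. 0 \<le> q x"
    and bp: "bdd_above (range p)" and bq: "bdd_above (range q)"
    and c: "0 < c" "c < 1"
    and ineq: "\<And>x y. ennreal (p x powr c * q y powr (1 - c)) \<le> w (c * x + (1 - c) * y)"
    and Ip: "(\<integral>\<^sup>+x. p x \<partial>lborel) = ennreal Ip" "0 \<le> Ip" and Iq: "(\<integral>\<^sup>+x. q x \<partial>lborel) = ennreal Iq" "0 \<le> Iq"
  shows "ennreal (Ip powr c * Iq powr (1 - c)) \<le> (\<integral>\<^sup>+x. w x \<partial>lborel)"
proof (cases "Ip = 0 \<or> Iq = 0")
  case False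
  then have pos: "0 < Ip" "0 < Iq" using Ip Iq by auto
  define P where "P = (SUP x. p x)"
  define Q where "Q = (SUP x. q x)"
  have sup_pos: "0 < (SUP x. h x)" if bdd: "bdd_above (range h)" and h: "\<And>x. 0 \<le> h x" and
    int: "(\<integral>\<^sup>+x. ennreal (h x) \<partial>lborel) \<noteq> 0" for h :: "real \<Rightarrow> real"
  proof (rule ccontr)
    assume "\<not> 0 < (SUP x. h x)"
    then have "h x \<le> 0" for x using cSUP_upper[OF UNIV_I bdd, of x] by linarith
    then have "h x = 0" for x using h[of x] by (simp add: order.antisym)
    then show False using int by simp
  qed
  have P: "0 < P" unfolding P_def by (rule sup_pos[OF bp p0]) (use Ip pos in simp)
  have Q: "0 < Q" unfolding Q_def by (rule sup_pos[OF bq q0]) (use Iq pos in simp)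
  \<comment> \<open>At level \<tau> the thresholds P \<tau> and Q \<tau> have the geometric mean W
    \<tau>, so \<open>w\<close> has to be divided by W.\<close>
  define W where "W = P powr c * Q powr (1 - c)"
  have W: "0 < W" using P Q by (simp add: W_def)
  define w' where "w' x = ennreal (1 / W) * w x" for x
  have [measurable]: "w' \<in> borel_measurable borel" unfolding w'_def by measurable
  have layer: "(\<integral>\<^sup>+\<tau>. indicator {0<..<1} \<tau> * emeasure lborel {x. R * \<tau> < h x} \<partial>lborel) = ennreal (I / R)"
    if [measurable]: "h \<in> borel_measurable borel" and h0: "\<And>x. 0 \<le> h x" and hR: "\<And>x. h x \<le> R" and R: "0 < R"
      and I: "(\<integral>\<^sup>+x. ennreal (h x) \<partial>lborel) = ennreal I" "0 \<le> I" for h :: "real \<Rightarrow> real" and R I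
  proof -
    have "(\<integral>\<^sup>+\<tau>. indicator {0<..<1} \<tau> * emeasure lborel {x. R * \<tau> < h x} \<partial>lborel) =
      (\<integral>\<^sup>+\<tau>. indicator {0<..<1} \<tau> * emeasure lborel {x. ennreal \<tau> < ennreal (h x / R)} \<partial>lborel)"
    proof (rule nn_integral_cong)
      fix \<tau> :: real
      have "{x. R * \<tau> < h x} = {x. ennreal \<tau> < ennreal (h x / R)}" if "0 < \<tau>"
        using that R h0 by (auto simp: ennreal_less_iff pos_less_divide_eq mult.commute)
      then show "indicator {0<..<1} \<tau> * emeasure lborel {x. R * \<tau> < h x} =
         indicator {0<..<1} \<tau> * emeasure lborel {x. ennreal \<tau> < ennreal (h x / R)}"
        by (auto simp: indicator_def)
    qed
    also have "\<dots> = (\<integral>\<^sup>+x. min 1 (ennreal (h x / R)) \<partial>lborel)"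
      by (rule nn_integral_truncated_layers[of "\<lambda>x. ennreal (h x / R)"]) measurable
    also have "\<dots> = (\<integral>\<^sup>+x. ennreal (1 / R) * ennreal (h x) \<partial>lborel)"
    proof (rule nn_integral_cong)
      fix x
      have "h x / R \<le> 1" using hR[of x] R by simp
      then have "ennreal (h x / R) \<le> 1" by (simp add: ennreal_le_1)
      then have "min 1 (ennreal (h x / R)) = ennreal (h x / R)" by (rule min.absorb2)
      then show "min 1 (ennreal (h x / R)) = ennreal (1 / R) * ennreal (h x)"
        using R h0 by (simp add: ennreal_mult[symmetric])
    qed
    also have "\<dots> = ennreal (1 / R) * ennreal I"
      using I by (simp add: nn_integral_cmult)
    finally show ?thesis using R I by (simp add: ennreal_mult[symmetric])
  qed
  have lp: "(\<integral>\<^sup>+\<tau>. indicator {0<..<1} \<tau> * emeasure lborel {x. P * \<tau> < p x} \<partial>lborel) = ennreal (Ip / P)"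
    by (rule layer[OF _ p0 _ P Ip]) (auto simp: P_def intro: cSUP_upper bp)
  have lq: "(\<integral>\<^sup>+\<tau>. indicator {0<..<1} \<tau> * emeasure lborel {x. Q * \<tau> < q x} \<partial>lborel) = ennreal (Iq / Q)"
    by (rule layer[OF _ q0 _ Q Iq]) (auto simp: Q_def intro: cSUP_upper bq)
  have scale: "emeasure lborel {x. (1 / s) * x \<in> S} = ennreal s * emeasure lborel S"
    if s: "0 < s" and [measurable]: "S \<in> sets borel" for s :: real and S
  proof -
    have "{x. (1 / s) * x \<in> S} \<in> sets lborel" by measurable
    from nn_integral_indicator[OF this]
    have "emeasure lborel {x. (1 / s) * x \<in> S} = (\<integral>\<^sup>+x. indicator {x. (1 / s) * x \<in> S} x \<partial>lborel)" by simp
    also have "\<dots> = (\<integral>\<^sup>+x. indicator S ((1 / s) * x) \<partial>lborel)"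
      by (intro nn_integral_cong) (simp only: indicator_def mem_Collect_eq)
    also have "\<dots> = ennreal s * (\<integral>\<^sup>+x. indicator S x \<partial>lborel)"
      using nn_integral_real_affine[of "\<lambda>x. indicator S ((1 / s) * x)" s 0] s by simp
    finally show ?thesis by simp
  qed
  have bm: "ennreal c * emeasure lborel {x. P * \<tau> < p x} + ennreal (1 - c) * emeasure lborel {x. Q * \<tau> < q x} \<le>
      emeasure lborel {x. ennreal \<tau> < w' x}" if \<tau>: "0 < \<tau>" "\<tau> < 1" for \<tau>
  proof -
    have "P * \<tau> < P" "Q * \<tau> < Q" using P Q \<tau> by auto
    then obtain x0 y0 where x0: "P * \<tau> < p x0" and y0: "Q * \<tau> < q y0"
      unfolding P_def Q_def using less_cSUP_iff[of UNIV p] less_cSUP_iff[of UNIV q] bp bq by (metis UNIV_not_empty)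
    have "emeasure lborel {x. (1 / c) * x \<in> {x. P * \<tau> < p x}} + emeasure lborel {x. (1 / (1 - c)) * x \<in> {x. Q * \<tau> < q x}} \<le>
      emeasure lborel {x. ennreal \<tau> < w' x}"
    proof (rule brunn_minkowski_1d)
      show "{x. (1 / c) * x \<in> {x. P * \<tau> < p x}} \<noteq> {}" using x0 c by (auto intro!: exI[of _ "c * x0"])
      show "{x. (1 / (1 - c)) * x \<in> {x. Q * \<tau> < q x}} \<noteq> {}" using y0 c by (auto intro!: exI[of _ "(1 - c) * y0"])
      fix x y assume "x \<in> {x. (1 / c) * x \<in> {x. P * \<tau> < p x}}" "y \<in> {x. (1 / (1 - c)) * x \<in> {x. Q * \<tau> < q x}}"
      then have xy: "P * \<tau> < p ((1 / c) * x)" "Q * \<tau> < q ((1 / (1 - c)) * y)" by auto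
      have "W * \<tau> = (P * \<tau>) powr c * (Q * \<tau>) powr (1 - c)"
      proof -
        have "(P * \<tau>) powr c * (Q * \<tau>) powr (1 - c) = W * (\<tau> powr c * \<tau> powr (1 - c))"
          using P Q \<tau> by (simp add: powr_mult W_def)
        then show ?thesis using \<tau> by (simp add: powr_add[symmetric])
      qed
      also have "\<dots> < p ((1 / c) * x) powr c * q ((1 / (1 - c)) * y) powr (1 - c)"
      proof -
        have "0 < P * \<tau>" "0 < Q * \<tau>" using P Q \<tau> by auto
        moreover from this have "0 < p ((1 / c) * x)" "0 < q ((1 / (1 - c)) * y)" using xy by linarith+
        moreover have "(P * \<tau>) powr c < p ((1 / c) * x) powr c" "(Q * \<tau>) powr (1 - c) < q ((1 / (1 - c)) * y) powr (1 - c)"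
          using xy calculation c by (auto intro!: powr_less_mono2 simp del: times_divide_eq_left)
        ultimately show ?thesis by (intro mult_strict_mono) (auto simp: less_imp_neq[THEN not_sym])
      qed
      finally have "ennreal (W * \<tau>) < ennreal (p ((1 / c) * x) powr c * q ((1 / (1 - c)) * y) powr (1 - c))"
        using W \<tau> by (subst ennreal_less_iff) auto
      also have "\<dots> \<le> w (c * ((1 / c) * x) + (1 - c) * ((1 / (1 - c)) * y))" by (rule ineq)
      also have "c * ((1 / c) * x) + (1 - c) * ((1 / (1 - c)) * y) = x + y" using c by simp
      finally have "ennreal (W * \<tau>) < w (x + y)" .
      then have "ennreal (1 / W) * ennreal (W * \<tau>) < ennreal (1 / W) * w (x + y)"
        using W by (intro ennreal_mult_strict_left_mono) auto
      moreover have "ennreal (1 / W) * ennreal (W * \<tau>) = ennreal \<tau>"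
        using W \<tau> by (simp add: ennreal_mult[symmetric])
      ultimately show "x + y \<in> {x. ennreal \<tau> < w' x}" by (simp add: w'_def)
    qed measurable
    moreover have "{x. P * \<tau> < p x} \<in> sets borel" "{x. Q * \<tau> < q x} \<in> sets borel" by measurable
    note scale[OF c(1) this(1)] scale[OF _ this(2), of "1 - c"]
    ultimately show ?thesis using c by (simp only: diff_gt_0_iff_gt)
  qed
  have layer_meas: "(\<lambda>\<tau>. indicator {0<..<1} \<tau> * emeasure lborel {x. R * \<tau> < h x}) \<in> borel_measurable borel"
    if [measurable]: "h \<in> borel_measurable borel" for h :: "real \<Rightarrow> real" and R
  proof -
    have "emeasure lborel {x. R * \<tau> < h x} = (\<integral>\<^sup>+x. indicator {x. R * \<tau> < h x} x \<partial>lborel)" for \<tau>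
      by (rule nn_integral_indicator[symmetric]) measurable
    then show ?thesis by simp
  qed
  have "ennreal c * ennreal (Ip / P) + ennreal (1 - c) * ennreal (Iq / Q) =
    (\<integral>\<^sup>+\<tau>. ennreal c * (indicator {0<..<1} \<tau> * emeasure lborel {x. P * \<tau> < p x}) +
       ennreal (1 - c) * (indicator {0<..<1} \<tau> * emeasure lborel {x. Q * \<tau> < q x}) \<partial>lborel)"
    unfolding lp[symmetric] lq[symmetric]
    using layer_meas[of p P] layer_meas[of q Q] by (simp add: nn_integral_add nn_integral_cmult)
  also have "\<dots> \<le> (\<integral>\<^sup>+\<tau>. indicator {0<..<1} \<tau> * emeasure lborel {x. ennreal \<tau> < w' x} \<partial>lborel)"
    by (rule nn_integral_mono) (auto simp: indicator_def bm)
  also have "\<dots> = (\<integral>\<^sup>+x. min 1 (w' x) \<partial>lborel)" by (rule nn_integral_truncated_layers) fact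
  also have "\<dots> \<le> (\<integral>\<^sup>+x. w' x \<partial>lborel)" by (intro nn_integral_mono) simp
  also have "\<dots> = ennreal (1 / W) * (\<integral>\<^sup>+x. w x \<partial>lborel)" unfolding w'_def by (rule nn_integral_cmult) simp
  finally have main: "ennreal (c * (Ip / P) + (1 - c) * (Iq / Q)) \<le> ennreal (1 / W) * (\<integral>\<^sup>+x. w x \<partial>lborel)"
    using c pos P Q by (simp add: ennreal_mult[symmetric] ennreal_plus[symmetric] del: ennreal_plus)
  have "Ip powr c * Iq powr (1 - c) = W * ((Ip / P) powr c * (Iq / Q) powr (1 - c))"
    using P Q pos by (simp add: W_def powr_divide)
  also have "\<dots> \<le> W * (c * (Ip / P) + (1 - c) * (Iq / Q))"
    using W c pos P Q by (intro mult_left_mono Youngs_inequality_0) auto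
  finally have "ennreal (Ip powr c * Iq powr (1 - c)) \<le> ennreal (W * (c * (Ip / P) + (1 - c) * (Iq / Q)))"
    by (rule ennreal_leI)
  also have "\<dots> = ennreal W * ennreal (c * (Ip / P) + (1 - c) * (Iq / Q))"
    by (rule ennreal_mult) (use W c pos P Q in auto)
  also have "\<dots> \<le> ennreal W * (ennreal (1 / W) * (\<integral>\<^sup>+x. w x \<partial>lborel))" by (rule mult_left_mono[OF main]) simp
  also have "\<dots> = (\<integral>\<^sup>+x. w x \<partial>lborel)"
    using W by (simp add: mult.assoc[symmetric] ennreal_mult[symmetric])
  finally show ?thesis .
qed auto

subsection \<open>Supporting directions\<close>

text \<open>Steinhaus theorem. If arbitrarily small v moved A off itself, then |1_A(x + v) - 1_A(x)|
  would dominate 1_A, and its integral would stay above the measure of A, contrary to continuity of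
  translations in the mean.\<close>

lemma steinhaus_symbox:
  assumes A [measurable]: "A \<in> sets borel" and pos: "0 < emeasure (lam n) A" and fin: "emeasure (lam n) A < \<infinity>"
  obtains e where "0 < e" "\<And>v. v \<in> symbox n (\<lambda>_. e) \<Longrightarrow> \<exists>x. x \<in> A \<and> x + v \<in> A"
proof (rule ccontr)
  assume "\<not> thesis"
  then have "\<exists>v. v \<in> symbox n (\<lambda>_. 1 / real (Suc j)) \<and> (\<forall>x. \<not> (x \<in> A \<and> x + v \<in> A))" for j
    using that[of "1 / real (Suc j)"] by auto
  then obtain v where v: "\<And>j. v j \<in> symbox n (\<lambda>_. 1 / real (Suc j))" "\<And>j x. \<not> (x \<in> A \<and> x + v j \<in> A)" by metis
  have i: "integrable (lam n) (indicator A :: _ \<Rightarrow> real)" using fin by simp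
  have "(\<lambda>j. v j i) \<longlonglongrightarrow> 0" for i
  proof (rule Lim_null_comparison)
    show "\<forall>\<^sub>F j in sequentially. norm (v j i) \<le> 1 / real (Suc j)"
      using v(1) by (intro always_eventually allI) (cases "i < n"; fastforce simp: symbox_def Rn_eq not_less)
    show "(\<lambda>j. 1 / real (Suc j)) \<longlonglongrightarrow> 0" using LIMSEQ_inverse_real_of_nat by (simp add: inverse_eq_divide)
  qed
  then have l: "(\<lambda>j. \<integral>x. \<bar>indicator A (x + v j) - indicator A x\<bar> \<partial>lam n) \<longlonglongrightarrow> (0::real)"
    using v(1) by (intro translation_mean_tendsto i) (auto simp: symbox_def)
  have ge: "measure (lam n) A \<le> (\<integral>x. \<bar>indicator A (x + v j) - indicator A x\<bar> \<partial>lam n)" for j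
  proof -
    have "v j \<in> Rn n" using v(1)[of j] by (simp add: symbox_def)
    then have "integrable (lam n) (\<lambda>x. indicator A (x + v j) :: real)"
      using i by (subst (asm) lam_translate[of "v j", symmetric]) (auto simp: integrable_distr_eq)
    then have "(\<integral>x. indicator A x \<partial>lam n) \<le> (\<integral>x. \<bar>indicator A (x + v j) - indicator A x\<bar> \<partial>lam n :: real)"
    proof (intro integral_mono i)
      show "integrable (lam n) (\<lambda>x. \<bar>indicator A (x + v j) - indicator A x\<bar> :: real)"
        using \<open>integrable (lam n) (\<lambda>x. indicator A (x + v j) :: real)\<close> i by auto
      show "indicator A x \<le> (\<bar>indicator A (x + v j) - indicator A x\<bar> :: real)" for x
        using v(2)[of x j] by (auto simp: indicator_def)
    qed
    then show ?thesis by simp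
  qed
  have "measure (lam n) A \<le> 0" by (rule LIMSEQ_le_const[OF l]) (use ge in blast)
  moreover have "0 < measure (lam n) A" using pos fin by (simp add: measure_def enn2real_positive_iff)
  ultimately show False by simp
qed

text \<open>A superlevel set of a log-concave function is convex but may fail to be Borel or closed;
  a Borel part of positive measure is enough to find a cube inside. If x and x + 2w lie in that
  part, then w is the midpoint of x + 2w and -x.\<close>

lemma symmetric_convex_contains_symbox:
  assumes "convex A" and sym: "\<And>x. x \<in> A \<Longrightarrow> - x \<in> A" and A0: "A0 \<subseteq> A" "A0 \<in> sets borel"
    and pos: "0 < emeasure (lam n) A0" and fin: "emeasure (lam n) A0 < \<infinity>"
  obtains e where "0 < e" "symbox n (\<lambda>_. e) \<subseteq> A"
proof -
  obtain e where e: "0 < e" "\<And>v. v \<in> symbox n (\<lambda>_. e) \<Longrightarrow> \<exists>x. x \<in> A0 \<and> x + v \<in> A0"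
    using steinhaus_symbox[OF A0(2) pos fin] by metis
  have "symbox n (\<lambda>_. e / 2) \<subseteq> A"
  proof
    fix w assume w: "w \<in> symbox n (\<lambda>_. e / 2)"
    then have "2 *\<^sub>R w \<in> symbox n (\<lambda>_. e)" by (auto simp: symbox_def Rn_eq abs_mult)
    then obtain x where "x \<in> A0" "x + 2 *\<^sub>R w \<in> A0" using e(2) by blast
    then have "(1 / 2) *\<^sub>R (x + 2 *\<^sub>R w) + (1 / 2) *\<^sub>R (- x) \<in> A"
      using A0(1) sym by (intro convexD[OF \<open>convex A\<close>]) auto
    moreover have "(1 / 2) *\<^sub>R (x + 2 *\<^sub>R w) + (1 / 2) *\<^sub>R (- x) = w"
      by (simp add: fun_eq_iff field_simps)
    ultimately show "w \<in> A" by simp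
  qed
  then show thesis using that[of "e / 2"] e(1) by simp
qed

lemma dot_self_nonneg: "0 \<le> dot n x x"
  by (simp add: dot_def sum_nonneg)

lemma coord_le_dot_self: "i < n \<Longrightarrow> (x i)\<^sup>2 \<le> dot n x x"
  unfolding dot_def power2_eq_square by (rule member_le_sum) auto

lemma dot_self_le: "x \<in> symbox n (\<lambda>_. r) \<Longrightarrow> dot n x x \<le> real n * r\<^sup>2"
proof -
  assume x: "x \<in> symbox n (\<lambda>_. r)"
  have "dot n x x \<le> (\<Sum>i<n. r\<^sup>2)"
    unfolding dot_def using x
    by (intro sum_mono) (auto simp: symbox_def power2_eq_square[symmetric] abs_le_square_iff[symmetric])
  then show ?thesis by simp
qed

text \<open>If every direction \<open>u\<close> satisfies \<open>u \<bullet> x \<le> h\<^sub>M(u)\<close>, then \<open>x\<close> is a limit of points of \<open>M\<close>: a point of \<open>M\<close>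
  almost nearest to \<open>x\<close> would otherwise yield a separating direction. No compactness of \<open>M\<close> is used.\<close>

lemma supported_imp_near:
  assumes cv: "convex M" and bd: "M \<subseteq> symbox n (\<lambda>_. R)" and ne: "M \<noteq> {}" and xR: "x \<in> Rn n"
    and supp: "\<And>u e. u \<in> unit_sphere n \<Longrightarrow> 0 < e \<Longrightarrow> \<exists>m\<in>M. dot n u x \<le> dot n u m + e"
    and e: "0 < e"
  shows "\<exists>m\<in>M. dot n (x - m) (x - m) < e"
proof (rule ccontr)
  assume "\<not> ?thesis"
  then have far: "e \<le> dot n (x - m) (x - m)" if "m \<in> M" for m using that by (auto simp: not_less)
  define q where "q = (INF m\<in>M. dot n (x - m) (x - m))"
  have bdd: "bdd_below ((\<lambda>m. dot n (x - m) (x - m)) ` M)" by (rule bdd_belowI2[of _ 0]) (rule dot_self_nonneg)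
  have q: "0 < q" unfolding q_def using cINF_greatest[OF ne far] e by (rule less_le_trans[rotated])
  have q_le: "q \<le> dot n (x - m) (x - m)" if "m \<in> M" for m unfolding q_def by (rule cINF_lower[OF bdd that])
  define D where "D = real n * (2 * R)\<^sup>2 + 1"
  have D: "0 < D" by (auto simp: D_def intro: add_nonneg_pos)
  have Db: "dot n (m' - m) (m' - m) \<le> D" if "m \<in> M" "m' \<in> M" for m m'
  proof -
    have mm: "m \<in> symbox n (\<lambda>_. R)" "m' \<in> symbox n (\<lambda>_. R)" using bd that by auto
    then have "\<bar>m' i - m i\<bar> \<le> 2 * R" if "i < n" for i
      using that mm abs_triangle_ineq4[of "m' i" "m i"] by (fastforce simp: symbox_def)
    then have "m' - m \<in> symbox n (\<lambda>_. 2 * R)"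
      using mm by (simp add: symbox_def Rn_diff)
    then show ?thesis using dot_self_le[of "m' - m" n "2 * R"] by (simp add: D_def)
  qed
  \<comment> \<open>\<open>D\<close> bounds squared distances within \<open>M\<close>. Moving from m
    towards m' by the fraction t changes the squared distance to x by at most - 2 t w.(m' - m) + t^2
    D. The choice makes t D \<le> q / 4, and m is taken within t q / 4 of the infimum, so both
    errors are of order t q.\<close>
  define t where "t = min 1 (q / (4 * D))"
  have t: "0 < t" "t \<le> 1" "t * D \<le> q / 4" using q D by (auto simp: t_def min_def field_simps)
  obtain m where m: "m \<in> M" "dot n (x - m) (x - m) < q + t * q / 4"
  proof -
    have "q < q + t * q / 4" using t q by simp
    then obtain m where "m \<in> M" "dot n (x - m) (x - m) < q + t * q / 4"
      unfolding q_def cINF_less_iff[OF ne bdd] by blast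
    then show thesis by (rule that)
  qed
  define w where "w = x - m"
  have mR: "m \<in> Rn n" using m bd by (auto simp: symbox_def)
  define \<kappa> where "\<kappa> = sqrt (dot n w w)"
  have ww: "q \<le> dot n w w" using q_le[OF m(1)] by (simp add: w_def)
  have \<kappa>: "0 < \<kappa>" "\<kappa> * \<kappa> = dot n w w" using ww q by (auto simp: \<kappa>_def)
  define u where "u = (1 / \<kappa>) *\<^sub>R w"
  have "dot n u u = 1" using \<kappa> by (simp add: u_def dot_scale dot_scale_left \<kappa>(2)[symmetric])
  then have "u \<in> unit_sphere n" using xR mR by (simp add: unit_sphere_def u_def w_def Rn_scale Rn_diff)
  then obtain m' where m': "m' \<in> M" "dot n u x \<le> dot n u m' + q / (8 * \<kappa>)"
    using supp[of u "q / (8 * \<kappa>)"] q \<kappa> by auto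
  have "\<kappa> * dot n u y = dot n w y" for y using \<kappa> by (simp add: u_def dot_scale_left)
  moreover have "\<kappa> * dot n u x \<le> \<kappa> * (dot n u m' + q / (8 * \<kappa>))" using m' \<kappa> by (intro mult_left_mono) auto
  ultimately have "dot n w x \<le> dot n w m' + q / 8" using \<kappa> by (simp add: distrib_left)
  then have a1: "dot n w w \<le> dot n w (m' - m) + q / 8"
    by (simp add: w_def dot_diff[of n "x - m"])
  have "(1 - t) *\<^sub>R m + t *\<^sub>R m' \<in> M" using t m m' by (intro convexD[OF cv]) auto
  then have "q \<le> dot n (x - ((1 - t) *\<^sub>R m + t *\<^sub>R m')) (x - ((1 - t) *\<^sub>R m + t *\<^sub>R m'))" by (rule q_le)
  also have "x - ((1 - t) *\<^sub>R m + t *\<^sub>R m') = w - t *\<^sub>R (m' - m)"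
    by (simp add: w_def fun_eq_iff algebra_simps)
  also have "dot n (w - t *\<^sub>R (m' - m)) (w - t *\<^sub>R (m' - m)) = dot n w w - 2 * t * dot n w (m' - m) + t * (t * dot n (m' - m) (m' - m))"
  proof -
    have "dot n (a - t *\<^sub>R b) (a - t *\<^sub>R b) = dot n a a - 2 * t * dot n a b + t * (t * dot n b b)" for a b
      unfolding dot_def sum_distrib_left sum_subtractf[symmetric] sum.distrib[symmetric]
      by (rule sum.cong) (simp_all add: algebra_simps)
    then show ?thesis .
  qed
  also have "t * (t * dot n (m' - m) (m' - m)) \<le> t * (t * D)"
    using t Db[OF m(1) m'(1)] by (intro mult_left_mono) auto
  finally have "2 * t * dot n w (m' - m) \<le> (dot n w w - q) + t * (t * D)" by linarith
  also have "\<dots> \<le> t * (q / 4) + t * (q / 4)"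
    using m(2) t by (intro add_mono mult_left_mono) (auto simp: w_def)
  finally have "t * (2 * dot n w (m' - m)) \<le> t * (q / 2)" by (simp add: algebra_simps)
  then have "dot n w (m' - m) \<le> q / 4" using t by simp
  then show False using a1 ww q by linarith
qed

text \<open>Write r x = r m + (1 - r) y with m in \<open>M\<close> close to x: the error r (x - m)
  is absorbed by the cube inside \<open>M\<close>. The contraction thus replaces taking the closure
  of \<open>M\<close>.\<close>

lemma scaled_supported_mem:
  assumes cv: "convex M" and bd: "M \<subseteq> symbox n (\<lambda>_. R)" and ball: "0 < e" "symbox n (\<lambda>_. e) \<subseteq> M" and xR: "x \<in> Rn n"
    and supp: "\<And>u e. u \<in> unit_sphere n \<Longrightarrow> 0 < e \<Longrightarrow> \<exists>m\<in>M. dot n u x \<le> dot n u m + e"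
    and r: "0 < r" "r < 1"
  shows "r *\<^sub>R x \<in> M"
proof -
  have ne: "M \<noteq> {}" using zero_mem_symbox[of "\<lambda>_. e" n] ball by auto
  \<comment> \<open>The closeness of m to x that forces the coordinates of y = r / (1 - r) (x - m)
    to be at most e.\<close>
  define \<delta> where "\<delta> = (e * (1 - r) / r)\<^sup>2"
  have "0 < \<delta>" using ball r by (simp add: \<delta>_def)
  then obtain m where m: "m \<in> M" "dot n (x - m) (x - m) < \<delta>"
    using supported_imp_near[OF cv bd ne xR supp] by blast
  define y where "y = (r / (1 - r)) *\<^sub>R (x - m)"
  have mR: "m \<in> Rn n" using m bd by (auto simp: symbox_def)
  have "y \<in> symbox n (\<lambda>_. e)"
    unfolding symbox_def
  proof (intro CollectI conjI allI impI)
    show "y \<in> Rn n" unfolding y_def by (intro Rn_scale Rn_diff xR mR)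
    fix i assume i: "i < n"
    have "((x - m) i)\<^sup>2 \<le> (e * (1 - r) / r)\<^sup>2"
      using coord_le_dot_self[OF i, of "x - m"] m(2) by (simp add: \<delta>_def)
    then have "\<bar>(x - m) i\<bar> \<le> e * (1 - r) / r"
      using ball r by (simp add: abs_le_square_iff[symmetric])
    then have "(r / (1 - r)) * \<bar>(x - m) i\<bar> \<le> (r / (1 - r)) * (e * (1 - r) / r)"
      using r by (intro mult_left_mono) auto
    then show "\<bar>y i\<bar> \<le> e" using r by (simp add: y_def abs_mult)
  qed
  then have "r *\<^sub>R m + (1 - r) *\<^sub>R y \<in> M" using ball m r by (intro convexD[OF cv]) auto
  moreover have "r *\<^sub>R m + (1 - r) *\<^sub>R y = r *\<^sub>R x"
  proof -
    have "(1 - r) *\<^sub>R y = r *\<^sub>R (x - m)" using r by (simp add: y_def)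
    then show ?thesis by (simp add: scaleR_diff_right)
  qed
  ultimately show ?thesis by simp
qed

text \<open>The axis vectors come first, so that the first n slabs already bound the intersection;
  the later terms enumerate a countable dense subset of the sphere.\<close>

lemma dense_directions:
  assumes n: "1 \<le> n"
  obtains U :: "nat \<Rightarrow> nat \<Rightarrow> real" where "\<And>i. U i \<in> unit_sphere n" "\<And>i. i < n \<Longrightarrow> U i = axis_vec i"
    "\<And>u. u \<in> unit_sphere n \<Longrightarrow> \<exists>s :: nat \<Rightarrow> nat. (\<lambda>k. U (s k)) \<longlonglongrightarrow> u"
proof -
  have ax: "axis_vec i \<in> unit_sphere n" if "i < n" for i
    using that by (simp add: unit_sphere_def axis_vec_Rn dot_axis) (simp add: axis_vec_def)
  obtain B :: "(nat \<Rightarrow> real) set set" where B: "countable B" "topological_basis B"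
    using ex_countable_basis by blast
  define pick where "pick b = (SOME x. x \<in> b \<inter> unit_sphere n)" for b
  define T where "T = pick ` {b \<in> B. b \<inter> unit_sphere n \<noteq> {}}"
  have pick: "pick b \<in> b \<inter> unit_sphere n" if ne: "b \<inter> unit_sphere n \<noteq> {}" for b
  proof -
    obtain x where "x \<in> b \<inter> unit_sphere n" using ne by auto
    then show ?thesis unfolding pick_def by (rule someI[of "\<lambda>x. x \<in> b \<inter> unit_sphere n"])
  qed
  have T: "countable T" "T \<subseteq> unit_sphere n" using B(1) pick by (auto simp: T_def)
  have cl: "u \<in> closure T" if u: "u \<in> unit_sphere n" for u
    unfolding closure_iff_nhds_not_empty
  proof (intro allI impI)
    fix S V :: "(nat \<Rightarrow> real) set" assume "V \<subseteq> S" "open V" "u \<in> V"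
    then obtain b where b: "b \<in> B" "u \<in> b" "b \<subseteq> V" using topological_basisE[OF B(2)] by metis
    then have "pick b \<in> T \<inter> S" using pick[of b] u \<open>V \<subseteq> S\<close> by (auto simp: T_def)
    then show "T \<inter> S \<noteq> {}" by blast
  qed
  have "T \<noteq> {}" using cl[OF ax[of 0]] n by (auto simp: closure_empty)
  then have rT: "range (from_nat_into T) = T" using T(1) by (rule range_from_nat_into)
  define U where "U i = (if i < n then axis_vec i else from_nat_into T (i - n))" for i
  show thesis
  proof
    show "U i \<in> unit_sphere n" for i using ax T(2) \<open>T \<noteq> {}\<close> from_nat_into[of T] by (auto simp: U_def)
    show "U i = axis_vec i" if "i < n" for i using that by (simp add: U_def)
    fix u assume "u \<in> unit_sphere n"
    from cl[OF this] obtain v where v: "\<forall>k. v k \<in> T" "v \<longlonglongrightarrow> u"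
      unfolding closure_sequential by blast
    have "\<exists>i. U i = w" if w: "w \<in> T" for w
    proof -
      have "w \<in> range (from_nat_into T)" unfolding rT by (rule w)
      then obtain j where "w = from_nat_into T j" by (rule rangeE)
      then show ?thesis by (intro exI[of _ "n + j"]) (simp add: U_def)
    qed
    with v(1) have "\<forall>k. \<exists>i. U i = v k" by blast
    then obtain s where "\<forall>k. U (s k) = v k" by (rule choice[THEN exE])
    then show "\<exists>s :: nat \<Rightarrow> nat. (\<lambda>k. U (s k)) \<longlonglongrightarrow> u" using v(2) by (intro exI[of _ s]) simp
  qed
qed

lemma tendsto_coord:
  fixes v :: "'a \<Rightarrow> nat \<Rightarrow> real"
  shows "(v \<longlongrightarrow> u) F \<Longrightarrow> ((\<lambda>k. v k l) \<longlongrightarrow> u l) F"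
proof -
  have "isCont (\<lambda>x::nat \<Rightarrow> real. x l) u"
    using continuous_on_product_coordinates by (rule continuous_on_interior) simp
  then show "(v \<longlongrightarrow> u) F \<Longrightarrow> ((\<lambda>k. v k l) \<longlongrightarrow> u l) F" by (rule isCont_tendsto_compose)
qed

section \<open>Support functions of bounded symmetric sets\<close>

locale bounded_symmetric =
  fixes n :: nat and A :: "(nat \<Rightarrow> real) set" and R e :: real
  assumes sub: "A \<subseteq> symbox n (\<lambda>_. R)" and sym: "\<And>x. x \<in> A \<Longrightarrow> - x \<in> A"
    and e: "0 < e" "symbox n (\<lambda>_. e) \<subseteq> A"
begin

abbreviation "h \<equiv> support_fun n A"

lemma zero_mem: "0 \<in> A"
  using zero_mem_symbox[of "\<lambda>_. e" n] e by auto

lemma dot_bound: "y \<in> A \<Longrightarrow> \<bar>dot n u y\<bar> \<le> R * (\<Sum>l<n. \<bar>u l\<bar>)"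
  unfolding dot_def sum_distrib_left using sub
  by (intro order.trans[OF sum_abs] sum_mono)
    (auto simp: abs_mult symbox_def mult.commute[of R] intro!: mult_left_mono)

lemma bdd: "bdd_above (dot n u ` A)"
  using dot_bound by (intro bdd_aboveI2[of _ _ "R * (\<Sum>l<n. \<bar>u l\<bar>)"]) (auto simp: abs_le_iff)

lemma support_upper: "y \<in> A \<Longrightarrow> \<bar>dot n u y\<bar> \<le> h u"
  using cSUP_upper[OF _ bdd, of y u] cSUP_upper[OF _ bdd, of "- y" u] sym[of y]
  by (auto simp: support_fun_def abs_le_iff dot_minus)

lemma support_pos: "u \<in> unit_sphere n \<Longrightarrow> 0 < h u"
proof -
  assume u: "u \<in> unit_sphere n"
  have "\<bar>u l\<bar> \<le> 1" if "l < n" for l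
    using coord_le_dot_self[OF that, of u] u by (simp add: unit_sphere_def abs_square_le_1)
  then have "e *\<^sub>R u \<in> symbox n (\<lambda>_. e)"
    using u e by (auto simp: symbox_def unit_sphere_def Rn_scale abs_mult)
  then have "\<bar>dot n u (e *\<^sub>R u)\<bar> \<le> h u" using e by (intro support_upper) auto
  then show ?thesis using u e by (simp add: dot_scale unit_sphere_def)
qed

text \<open>Superlevel sets need not be closed, so the supremum may only be approached.\<close>

lemma support_approx: "0 < d \<Longrightarrow> \<exists>y\<in>A. h u < dot n u y + d"
  using less_cSUP_iff[OF _ bdd, of "h u - d" u] zero_mem by (auto simp: support_fun_def diff_less_eq)

text \<open>On a set with coordinates bounded by R, two linear functionals differ by at most R times
  the l1 distance of their coefficients. The resulting continuity carries inequalities from a dense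
  sequence of directions to all of them.\<close>

lemma support_lipschitz: "\<bar>h u - h v\<bar> \<le> R * (\<Sum>l<n. \<bar>u l - v l\<bar>)"
proof -
  have "h u \<le> h v + R * (\<Sum>l<n. \<bar>u l - v l\<bar>)" for u v
    unfolding support_fun_def[of n A u]
  proof (rule cSUP_least)
    fix y assume y: "y \<in> A"
    have "dot n u y = dot n v y + dot n (u - v) y" by (simp add: dot_def sum.distrib[symmetric] algebra_simps)
    also have "\<dots> \<le> h v + R * (\<Sum>l<n. \<bar>u l - v l\<bar>)"
      using support_upper[OF y, of v] dot_bound[OF y, of "u - v"] by (auto simp: abs_le_iff intro: add_mono)
    finally show "dot n u y \<le> h v + R * (\<Sum>l<n. \<bar>u l - v l\<bar>)" .
  qed (use zero_mem in auto)
  from this[of u v] this[of v u] show ?thesis by (simp add: abs_le_iff abs_minus_commute)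
qed

lemma support_tendsto: "v \<longlonglongrightarrow> u \<Longrightarrow> (\<lambda>k. h (v k)) \<longlonglongrightarrow> h u"
proof -
  assume v: "v \<longlonglongrightarrow> u"
  have "(\<lambda>k. R * (\<Sum>l<n. \<bar>v k l - u l\<bar>)) \<longlonglongrightarrow> R * (\<Sum>l<n. \<bar>u l - u l\<bar>)"
    by (intro tendsto_intros tendsto_coord v)
  then have "(\<lambda>k. R * (\<Sum>l<n. \<bar>v k l - u l\<bar>)) \<longlonglongrightarrow> 0" by simp
  from Lim_null_comparison[OF _ this, of "\<lambda>k. h (v k) - h u"]
  have "(\<lambda>k. h (v k) - h u) \<longlonglongrightarrow> 0" using support_lipschitz by simp
  then show ?thesis by (rule LIM_zero_cancel)
qed

end

subsection \<open>Even log-concave densities\<close>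

lemma compact_sub_symbox:
  assumes K: "compact K" "K \<subseteq> Rn n"
  obtains R where "K \<subseteq> symbox n (\<lambda>_. R)"
proof -
  have "\<exists>b. \<forall>y\<in>K. \<bar>y i\<bar> \<le> b" for i
  proof -
    have "compact ((\<lambda>y. y i) ` K)"
      by (intro compact_continuous_image continuous_coord continuous_on_id K)
    from compact_imp_bounded[OF this] show ?thesis by (auto simp: bounded_iff)
  qed
  then obtain b where b: "\<And>i y. y \<in> K \<Longrightarrow> \<bar>y i\<bar> \<le> b i" by metis
  have "\<bar>y i\<bar> \<le> (\<Sum>l<n. \<bar>b l\<bar>)" if "y \<in> K" "i < n" for y i
  proof -
    have "\<bar>b i\<bar> \<le> (\<Sum>l<n. \<bar>b l\<bar>)" using that(2) by (intro member_le_sum) auto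
    then show ?thesis using b[OF that(1), of i] by linarith
  qed
  then have "K \<subseteq> symbox n (\<lambda>_. \<Sum>l<n. \<bar>b l\<bar>)" using K(2) by (auto simp: symbox_def)
  then show thesis by (rule that)
qed

lemma log_comb_borel: "log_comb n c K L \<in> sets borel"
proof -
  let ?b = "\<lambda>u. support_fun n K u powr c * support_fun n L u powr (1 - c)"
  have "log_comb n c K L = Rn n \<inter> (\<Inter>u\<in>unit_sphere n. {x. dot n x u \<le> ?b u})"
    by (auto simp: log_comb_def)
  moreover have "closed {x. dot n x u \<le> ?b u}" for u
    unfolding dot_def by (intro closed_Collect_le continuous_intros continuous_coord continuous_on_id)
  ultimately have "closed (log_comb n c K L)" using closed_Rn by (simp only:) (intro closed_Int closed_INT ballI)
  then show ?thesis by simp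
qed

text \<open>The log-sum is first replaced by finite intersections of slabs, then by the limit \<open>D\<close> over a dense sequence of
  normals. Points of \<open>D\<close> lie in the log-sum and, after a contraction, in the smaller Minkowski sum.\<close>

lemma log_comb_measure:
  fixes c :: real
  assumes n: "1 \<le> n"
    and hyp: "\<And>N. 1 \<le> N \<Longrightarrow> \<exists>f. density_fun N f \<and> integrable_on_all_subspaces N f \<and> box_ineq N f"
    and K: "compact K" "K \<subseteq> Rn n" and L: "compact L" "L \<subseteq> Rn n" and c: "0 < c" "c < 1"
    and A: "A \<subseteq> K" "convex A" "\<And>x. x \<in> A \<Longrightarrow> - x \<in> A"
    and B: "B \<subseteq> L" "convex B" "\<And>x. x \<in> B \<Longrightarrow> - x \<in> B"
    and A0: "A0 \<subseteq> A" "A0 \<in> sets borel" "0 < emeasure (lam n) A0"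
    and B0: "B0 \<subseteq> B" "B0 \<in> sets borel" "0 < emeasure (lam n) B0"
    and E [measurable]: "E \<in> sets borel"
    and EI: "AE x in lam n. x \<in> log_comb n c K L \<and> (\<exists>a\<in>A. \<exists>b\<in>B. x = c *\<^sub>R a + (1 - c) *\<^sub>R b) \<longrightarrow> x \<in> E"
  shows "ennreal (measure (lam n) A0 powr c * measure (lam n) B0 powr (1 - c)) \<le> emeasure (lam n) E"
proof -
  obtain RK where RK: "K \<subseteq> symbox n (\<lambda>_. RK)" using compact_sub_symbox[OF K] by metis
  obtain RL where RL: "L \<subseteq> symbox n (\<lambda>_. RL)" using compact_sub_symbox[OF L] by metis
  have symbox_fin: "emeasure (lam n) (symbox n a) < \<infinity>" if "\<And>i. 0 \<le> a i" for a
    using that by (subst emeasure_lam_symbox) auto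
  have fin: "emeasure (lam n) S < \<infinity>" if "S \<subseteq> symbox n (\<lambda>_. R)" for S R
  proof -
    have "emeasure (lam n) S \<le> emeasure (lam n) (symbox n (\<lambda>_. \<bar>R\<bar>))"
      using that by (intro emeasure_mono) (auto simp: symbox_def, fastforce)
    then show ?thesis using symbox_fin[of "\<lambda>_. \<bar>R\<bar>"] by (simp add: le_less_trans)
  qed
  have subs: "A \<subseteq> symbox n (\<lambda>_. RK)" "B \<subseteq> symbox n (\<lambda>_. RL)" using A B RK RL by auto
  have finA0: "emeasure (lam n) A0 < \<infinity>" and finB0: "emeasure (lam n) B0 < \<infinity>"
    using fin[OF order.trans[OF A0(1) subs(1)]] fin[OF order.trans[OF B0(1) subs(2)]] by auto
  obtain eA where eA: "0 < eA" "symbox n (\<lambda>_. eA) \<subseteq> A"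
    using symmetric_convex_contains_symbox[OF A(2,3) A0 finA0] by metis
  obtain eB where eB: "0 < eB" "symbox n (\<lambda>_. eB) \<subseteq> B"
    using symmetric_convex_contains_symbox[OF B(2,3) B0 finB0] by metis
  interpret A: bounded_symmetric n A RK eA by unfold_locales (use subs A eA in auto)
  interpret B: bounded_symmetric n B RL eB by unfold_locales (use subs B eB in auto)
  define H where "H u = A.h u powr c * B.h u powr (1 - c)" for u
  have H_pos: "0 < H u" if "u \<in> unit_sphere n" for u
    using A.support_pos[OF that] B.support_pos[OF that] by (simp add: H_def)
  obtain U :: "nat \<Rightarrow> nat \<Rightarrow> real" where U: "\<And>i. U i \<in> unit_sphere n" "\<And>i. i < n \<Longrightarrow> U i = axis_vec i"
    and dense: "\<And>u. u \<in> unit_sphere n \<Longrightarrow> \<exists>s :: nat \<Rightarrow> nat. (\<lambda>k. U (s k)) \<longlonglongrightarrow> u"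
    using dense_directions[OF n] by blast
  define \<alpha> where "\<alpha> i = A.h (U i)" for i
  define \<beta> where "\<beta> i = B.h (U i)" for i
  define \<gamma> where "\<gamma> = (\<lambda>i. \<alpha> i powr c * \<beta> i powr (1 - c))"
  have \<gamma>H: "\<gamma> i = H (U i)" for i by (simp add: \<gamma>_def H_def \<alpha>_def \<beta>_def)
  have \<alpha>: "0 < \<alpha> i" and \<beta>: "0 < \<beta> i" and \<gamma>: "0 < \<gamma> i" for i
    using A.support_pos[OF U(1)] B.support_pos[OF U(1)] H_pos[OF U(1)] by (auto simp: \<alpha>_def \<beta>_def \<gamma>H)
  \<comment> \<open>The offset n keeps all axis directions among the normals, so that every
    intersection has finite measure.\<close>
  define S where "S X p = slabs n (n + p) U X" for X p
  have [measurable]: "S X p \<in> sets borel" for X p by (simp add: S_def)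
  have Sfin: "emeasure (lam n) (S X p) < \<infinity>" if X: "\<And>i. 0 < X i" for X p
  proof -
    have "emeasure (lam n) (S X p) \<le> emeasure (lam n) (symbox n X)"
    proof (intro emeasure_mono_AE)
      show "AE x in lam n. x \<in> S X p \<longrightarrow> x \<in> symbox n X"
        using AE_lam_Rn
      proof eventually_elim
        case (elim x)
        have "\<bar>x i\<bar> \<le> X i" if "x \<in> S X p" "i < n" for i
        proof -
          have "\<bar>dot n (U i) x\<bar> \<le> X i" using that by (simp add: S_def slabs_def)
          then show ?thesis using that by (simp add: U(2) dot_axis)
        qed
        then show ?case using elim by (simp add: symbox_def)
      qed
    qed simp
    then show ?thesis using symbox_fin[of X] X by (simp add: less_imp_le le_less_trans)
  qed
  have S\<alpha>: "emeasure (lam n) (S \<alpha> p) < \<infinity>" and S\<beta>: "emeasure (lam n) (S \<beta> p) < \<infinity>"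
    and S\<gamma>: "emeasure (lam n) (S \<gamma> p) < \<infinity>" for p
    by (rule Sfin, rule \<alpha> \<beta> \<gamma>)+
  define v where "v = measure (lam n) A0 powr c * measure (lam n) B0 powr (1 - c)"
  have vS: "v \<le> measure (lam n) (S \<gamma> p)" for p
  proof -
    have "A0 \<subseteq> S \<alpha> p" "B0 \<subseteq> S \<beta> p"
      using A0(1) B0(1) A.support_upper B.support_upper by (auto simp: S_def slabs_def \<alpha>_def \<beta>_def)
    then have le: "measure (lam n) A0 \<le> measure (lam n) (S \<alpha> p)" "measure (lam n) B0 \<le> measure (lam n) (S \<beta> p)"
      using S\<alpha>[of p] S\<beta>[of p] A0(2) B0(2)
      by (auto intro!: measure_mono_fmeasurable simp: fmeasurable_def)
    \<comment> \<open>The dimension consists of one axis coordinate, \<open>n + p\<close> auxiliary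
      coordinates for the slabs, and n for the slabs themselves. It grows with p, so no single
      dimension of the hypothesis suffices.\<close>
    obtain f where f: "density_fun (Suc (n + p) + n) f" "integrable_on_all_subspaces (Suc (n + p) + n) f" "box_ineq (Suc (n + p) + n) f"
      using hyp[of "Suc (n + p) + n"] by auto
    have "v \<le> measure (lam n) (S \<alpha> p) powr c * measure (lam n) (S \<beta> p) powr (1 - c)"
      unfolding v_def using le c by (intro mult_mono powr_mono2) auto
    also have "\<dots> \<le> measure (lam n) (S \<gamma> p)"
      unfolding S_def \<gamma>_def
      by (rule log_BM_slabs[OF f \<alpha> \<beta> c]) (use S\<alpha>[of p] S\<beta>[of p] S\<gamma>[of p] in \<open>auto simp: S_def \<gamma>_def\<close>)
    finally show ?thesis .
  qed
  define D where "D = (\<Inter>p. S \<gamma> p)"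
  have [measurable]: "D \<in> sets borel" unfolding D_def by measurable
  have "(\<lambda>p. measure (lam n) (S \<gamma> p)) \<longlonglongrightarrow> measure (lam n) D"
    unfolding D_def
  proof (rule Lim_measure_decseq)
    show "decseq (S \<gamma>)" by (auto simp: decseq_def S_def slabs_def)
    show "emeasure (lam n) (S \<gamma> p) \<noteq> \<infinity>" for p using S\<gamma>[of p] by simp
  qed auto
  from LIMSEQ_le_const[OF this, of v] have vD: "v \<le> measure (lam n) D" using vS by blast
  have D: "dot n u x \<le> H u" if x: "x \<in> D" and u: "u \<in> unit_sphere n" for x u
  proof -
    obtain s :: "nat \<Rightarrow> nat" where s: "(\<lambda>k. U (s k)) \<longlonglongrightarrow> u" using dense[OF u] by blast
    have "dot n (U i) x \<le> H (U i)" for i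
    proof -
      have "x \<in> S \<gamma> (Suc i)" using x by (simp add: D_def)
      then have "\<bar>dot n (U i) x\<bar> \<le> \<gamma> i" by (simp add: S_def slabs_def)
      then show ?thesis by (simp add: \<gamma>H)
    qed
    moreover have "(\<lambda>k. dot n (U (s k)) x) \<longlonglongrightarrow> dot n u x"
      unfolding dot_def by (intro tendsto_intros tendsto_coord s)
    moreover have "(\<lambda>k. H (U (s k))) \<longlonglongrightarrow> H u"
      unfolding H_def using A.support_pos[OF u] B.support_pos[OF u]
      by (intro tendsto_mult tendsto_powr A.support_tendsto B.support_tendsto s tendsto_const) auto
    ultimately show ?thesis by (intro LIMSEQ_le[of _ "dot n u x" _ "H u"]) auto
  qed
  \<comment> \<open>By the arithmetic-geometric inequality the support function of this Minkowski
    combination is at least \<open>H\<close>, so \<open>D\<close> lies in its closure. Being an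
    actual combination of points of A and B is what log-concavity of a density can exploit.\<close>
  define M where "M = {c *\<^sub>R a + (1 - c) *\<^sub>R b |a b. a \<in> A \<and> b \<in> B}"
  have M_cv: "convex M"
  proof -
    have "M = (\<Union>x\<in>(\<lambda>a. c *\<^sub>R a) ` A. \<Union>y\<in>(\<lambda>b. (1 - c) *\<^sub>R b) ` B. {x + y})" by (auto simp: M_def)
    also have "convex \<dots>" by (intro convex_sums convex_scaling A B)
    finally show ?thesis .
  qed
  have M_bd: "M \<subseteq> symbox n (\<lambda>_. \<bar>RK\<bar> + \<bar>RL\<bar>)"
  proof
    fix x assume "x \<in> M"
    then obtain a b where x: "x = c *\<^sub>R a + (1 - c) *\<^sub>R b" "a \<in> A" "b \<in> B" by (auto simp: M_def)
    then have ab: "a \<in> symbox n (\<lambda>_. RK)" "b \<in> symbox n (\<lambda>_. RL)" using subs by auto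
    have "\<bar>c * a i + (1 - c) * b i\<bar> \<le> \<bar>RK\<bar> + \<bar>RL\<bar>" if "i < n" for i
    proof -
      have "\<bar>a i\<bar> \<le> \<bar>RK\<bar>" "\<bar>b i\<bar> \<le> \<bar>RL\<bar>" using ab that by (auto simp: symbox_def)
      moreover have "c * \<bar>a i\<bar> \<le> \<bar>a i\<bar>" "(1 - c) * \<bar>b i\<bar> \<le> \<bar>b i\<bar>"
        using c by (simp_all add: mult_left_le_one_le)
      ultimately have "c * \<bar>a i\<bar> \<le> \<bar>RK\<bar>" "(1 - c) * \<bar>b i\<bar> \<le> \<bar>RL\<bar>" by linarith+
      then show ?thesis using abs_triangle_ineq[of "c * a i" "(1 - c) * b i"] c by (simp add: abs_mult)
    qed
    then show "x \<in> symbox n (\<lambda>_. \<bar>RK\<bar> + \<bar>RL\<bar>)" using ab by (auto simp: x(1) symbox_def Rn_eq)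
  qed
  define e where "e = min eA eB"
  have e: "0 < e" "symbox n (\<lambda>_. e) \<subseteq> M"
  proof -
    show "0 < e" using eA eB by (simp add: e_def)
    show "symbox n (\<lambda>_. e) \<subseteq> M"
    proof
      fix x assume "x \<in> symbox n (\<lambda>_. e)"
      then have "x \<in> symbox n (\<lambda>_. eA)" "x \<in> symbox n (\<lambda>_. eB)" by (auto simp: e_def symbox_def)
      then have "x \<in> A" "x \<in> B" using eA eB by auto
      moreover have "x = c *\<^sub>R x + (1 - c) *\<^sub>R x" by (simp add: scaleR_add_left[symmetric])
      ultimately show "x \<in> M" unfolding M_def by blast
    qed
  qed
  have member: "r *\<^sub>R x \<in> log_comb n c K L \<and> r *\<^sub>R x \<in> M" if x: "x \<in> D" "x \<in> Rn n" and r: "0 < r" "r < 1" for r x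
  proof
    show "r *\<^sub>R x \<in> M"
    proof (rule scaled_supported_mem[OF M_cv M_bd e x(2) _ r])
      fix u and d :: real assume u: "u \<in> unit_sphere n" and d: "0 < d"
      obtain a where a: "a \<in> A" "A.h u < dot n u a + d" using A.support_approx[OF d] by blast
      obtain b where b: "b \<in> B" "B.h u < dot n u b + d" using B.support_approx[OF d] by blast
      have "dot n u x \<le> H u" by (rule D[OF x(1) u])
      also have "\<dots> \<le> c * A.h u + (1 - c) * B.h u"
        unfolding H_def using A.support_pos[OF u] B.support_pos[OF u] c by (intro Youngs_inequality_0) auto
      also have "\<dots> \<le> c * (dot n u a + d) + (1 - c) * (dot n u b + d)"
        using a b c by (intro add_mono mult_left_mono) auto
      also have "\<dots> = dot n u (c *\<^sub>R a + (1 - c) *\<^sub>R b) + d"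
        unfolding dot_add dot_scale by (simp add: algebra_simps)
      finally show "\<exists>m\<in>M. dot n u x \<le> dot n u m + d" using a b unfolding M_def by blast
    qed
    show "r *\<^sub>R x \<in> log_comb n c K L"
      unfolding log_comb_def
    proof (intro CollectI conjI ballI Rn_scale x)
      fix u assume u: "u \<in> unit_sphere n"
      have h: "A.h u \<le> support_fun n K u" "B.h u \<le> support_fun n L u"
        unfolding support_fun_def using A(1) B(1) A.zero_mem B.zero_mem
        by (auto intro!: cSUP_subset_mono bdd_above_dot K L)
      have "dot n (r *\<^sub>R x) u = r * dot n u x" by (simp only: dot_scale_left dot_commute[of n x])
      also have "\<dots> \<le> r * H u" using D[OF x(1) u] r by (intro mult_left_mono) auto
      also have "\<dots> \<le> H u" using H_pos[OF u] r by simp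
      also have "\<dots> \<le> support_fun n K u powr c * support_fun n L u powr (1 - c)"
        unfolding H_def using h A.support_pos[OF u] B.support_pos[OF u] c by (intro mult_mono powr_mono2) auto
      finally show "dot n (r *\<^sub>R x) u \<le> support_fun n K u powr c * support_fun n L u powr (1 - c)" .
    qed
  qed
  \<comment> \<open>Contraction by r costs the factor r^n in volume and moves \<open>D\<close> into
    \<open>E\<close>, up to the null set \<open>Z\<close> and points outside \<open>Rn n\<close>;
    afterwards r tends to 1.\<close>
  have contract: "ennreal (r ^ n * measure (lam n) D) \<le> emeasure (lam n) E" if r: "0 < r" "r < 1" for r
  proof -
    obtain Z where Z: "{x. \<not> (x \<in> log_comb n c K L \<and> (\<exists>a\<in>A. \<exists>b\<in>B. x = c *\<^sub>R a + (1 - c) *\<^sub>R b) \<longrightarrow> x \<in> E)} \<subseteq> Z"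
      "emeasure (lam n) Z = 0" and [measurable]: "Z \<in> sets borel"
      using AE_E[OF EI] by auto
    have "emeasure (lam n) D = (\<integral>\<^sup>+x. indicator D x \<partial>lam n)" by simp
    also have "\<dots> \<le> (\<integral>\<^sup>+x. indicator (E \<union> Z) (r *\<^sub>R x) \<partial>lam n)"
    proof (intro nn_integral_mono_AE, use AE_lam_Rn in eventually_elim)
      fix x assume x: "x \<in> Rn n"
      have "r *\<^sub>R x \<in> E \<union> Z" if "x \<in> D"
        using member[OF that x r] Z(1) by (auto simp: M_def)
      then show "indicator D x \<le> (indicator (E \<union> Z) (r *\<^sub>R x) :: ennreal)"
        by (auto simp: indicator_def simp del: Un_iff)
    qed
    also have "\<dots> = ennreal (1 / r ^ n) * (\<integral>\<^sup>+x. indicator (E \<union> Z) x \<partial>lam n)"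
      using nn_integral_lam_scale[of r "indicator (E \<union> Z)" n] r by simp
    also have "(\<integral>\<^sup>+x. indicator (E \<union> Z) x \<partial>lam n) = emeasure (lam n) E"
      using Z(2) by (simp add: emeasure_Un_null_set null_setsI)
    finally have le: "emeasure (lam n) D \<le> ennreal (1 / r ^ n) * emeasure (lam n) E" .
    have "emeasure (lam n) D \<le> emeasure (lam n) (S \<gamma> 0)" by (intro emeasure_mono) (auto simp: D_def)
    then have "emeasure (lam n) D \<noteq> \<infinity>" using S\<gamma>[of 0] by (auto simp: top_unique)
    then have "ennreal (r ^ n * measure (lam n) D) = ennreal (r ^ n) * emeasure (lam n) D"
      using r by (simp add: emeasure_eq_ennreal_measure ennreal_mult)
    also have "\<dots> \<le> ennreal (r ^ n) * (ennreal (1 / r ^ n) * emeasure (lam n) E)" by (rule mult_left_mono[OF le]) simp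
    also have "\<dots> = emeasure (lam n) E"
      using r by (simp add: mult.assoc[symmetric] ennreal_mult[symmetric])
    finally show ?thesis .
  qed
  have "ennreal (measure (lam n) D) \<le> emeasure (lam n) E"
  proof (rule LIMSEQ_le_const2)
    let ?r = "\<lambda>k. 1 - 1 / real (Suc (Suc k))"
    have "(\<lambda>k. 1 / real (Suc (Suc k))) \<longlonglongrightarrow> 0"
      using LIMSEQ_Suc[OF LIMSEQ_inverse_real_of_nat] by (simp add: inverse_eq_divide)
    from tendsto_diff[OF tendsto_const[of 1] this] have "?r \<longlonglongrightarrow> 1" by simp
    from tendsto_mult[OF tendsto_power[OF this, of n] tendsto_const[of "measure (lam n) D"]]
    show "(\<lambda>k. ennreal (?r k ^ n * measure (lam n) D)) \<longlonglongrightarrow> ennreal (measure (lam n) D)"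
      by (intro tendsto_ennrealI) simp
    show "\<exists>N. \<forall>k\<ge>N. ennreal (?r k ^ n * measure (lam n) D) \<le> emeasure (lam n) E"
      by (intro exI allI impI contract) (auto simp: field_simps)
  qed
  moreover have "ennreal v \<le> ennreal (measure (lam n) D)" using vD by (rule ennreal_leI)
  ultimately show ?thesis unfolding v_def by (rule order.trans[rotated])
qed

section \<open>Layer integrals with exponential levels\<close>

lemma nn_integral_exp_atMost: "0 \<le> y \<Longrightarrow> (\<integral>\<^sup>+\<sigma>. ennreal (exp \<sigma>) * indicator {\<sigma>. exp \<sigma> \<le> y} \<sigma> \<partial>lborel) = ennreal y"
proof (cases "y = 0")
  case True
  then have "indicator {\<sigma>. exp \<sigma> \<le> y} \<sigma> = (0::ennreal)" for \<sigma> by (simp add: indicator_def not_le)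
  then show ?thesis using True by simp
next
  case False
  assume "0 \<le> y"
  then have y: "0 < y" using False by simp
  have "(\<integral>\<^sup>+\<sigma>. ennreal (exp \<sigma>) * indicator {\<sigma>. exp \<sigma> \<le> y} \<sigma> \<partial>lborel) =
    (\<integral>\<^sup>+\<sigma>. ennreal (exp (- \<sigma>)) * indicator {- ln y..} \<sigma> \<partial>lborel)"
    using y by (subst nn_integral_real_affine[where c="-1" and t=0])
      (auto intro!: nn_integral_cong simp: indicator_def ln_ge_iff[symmetric] minus_le_iff)
  also have "\<dots> = ennreal (0 - (- exp (- (- ln y))))"
  proof (rule nn_integral_FTC_atLeast)
    show "((\<lambda>x. - exp (- x)) has_real_derivative exp (- x)) (at x)" for x :: real
      by (auto intro!: derivative_eq_intros)
    have "((\<lambda>x. exp (- x)) \<longlongrightarrow> (0::real)) at_top"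
      by (rule filterlim_compose[OF exp_at_bot filterlim_uminus_at_bot_at_top])
    from tendsto_minus[OF this] show "((\<lambda>x. - exp (- x)) \<longlongrightarrow> (0::real)) at_top" by simp
  qed auto
  finally show ?thesis using y by simp
qed

text \<open>Layer-cake formula in the variable \<sigma> with level e^\<sigma>: geometric means of
  levels become arithmetic means of \<sigma>, as \<open>prekopa_leindler_1d\<close>
  requires.\<close>

lemma nn_integral_exp_layers:
  assumes [measurable]: "G \<in> borel_measurable borel" "S \<in> sets borel" and G: "\<And>x. 0 \<le> G x"
  shows "(\<integral>\<^sup>+\<sigma>. ennreal (exp \<sigma>) * emeasure (lam n) {x \<in> S. exp \<sigma> \<le> G x} \<partial>lborel) =
    (\<integral>\<^sup>+x. ennreal (G x) * indicator S x \<partial>lam n)"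
proof -
  interpret lam: sigma_finite_measure "lam n" by (rule sigma_finite_lam)
  interpret P: pair_sigma_finite lborel "lam n" ..
  have [measurable]: "{x \<in> S. exp \<sigma> \<le> G x} \<in> sets borel" for \<sigma> by measurable
  have "(\<integral>\<^sup>+\<sigma>. ennreal (exp \<sigma>) * emeasure (lam n) {x \<in> S. exp \<sigma> \<le> G x} \<partial>lborel) =
    (\<integral>\<^sup>+\<sigma>. (\<integral>\<^sup>+x. ennreal (exp \<sigma>) * indicator {x \<in> S. exp \<sigma> \<le> G x} x \<partial>lam n) \<partial>lborel)"
    by (intro nn_integral_cong) (simp add: nn_integral_cmult)
  also have "\<dots> = (\<integral>\<^sup>+x. (\<integral>\<^sup>+\<sigma>. ennreal (exp \<sigma>) * indicator {x \<in> S. exp \<sigma> \<le> G x} x \<partial>lborel) \<partial>lam n)"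
    by (rule P.Fubini'[symmetric]) measurable
  also have "\<dots> = (\<integral>\<^sup>+x. ennreal (G x) * indicator S x \<partial>lam n)"
  proof (rule nn_integral_cong)
    fix x
    show "(\<integral>\<^sup>+\<sigma>. ennreal (exp \<sigma>) * indicator {x \<in> S. exp \<sigma> \<le> G x} x \<partial>lborel) = ennreal (G x) * indicator S x"
      using nn_integral_exp_atMost[OF G, of x] by (cases "x \<in> S") (simp_all add: indicator_def)
  qed
  finally show ?thesis .
qed

text \<open>\<open>g\<close> carries log-concavity, its Borel representative \<open>G\<close>
  carries measurability. Hence \<open>log_comb_measure\<close> receives superlevel sets of
  \<open>g\<close> as the convex sets, and those of \<open>G\<close> minus a null set as their Borel
  parts.\<close>

theorem log_BM_log_concave:
  assumes hyp: "\<And>N. 1 \<le> N \<Longrightarrow> \<exists>f. density_fun N f \<and> integrable_on_all_subspaces N f \<and> box_ineq N f"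
    and n: "1 \<le> n" and dens: "density_fun n g" and even: "even_fun n g"
    and lc: "log_concave_on (Rn n) (\<lambda>x. ennreal (g x))"
  shows "log_BM n g"
  unfolding log_BM_def
proof (intro allI impI, elim conjE)
  fix K L and c :: real
  assume cbK: "convex_body n K" and sK: "symmetric_set K" and cbL: "convex_body n L" and sL: "symmetric_set L"
    and c: "0 < c" "c < 1"
  have K: "compact K" "K \<subseteq> Rn n" "convex K" and L: "compact L" "L \<subseteq> Rn n" "convex L"
    using cbK cbL by (auto simp: convex_body_def compactin_Euclidean_space)
  have [measurable]: "K \<in> sets borel" "L \<in> sets borel" using K L by (auto simp: compact_imp_closed)
  have sK': "- x \<in> K" if "x \<in> K" for x using sK that by (metis symmetric_set_def image_eqI)
  have sL': "- x \<in> L" if "x \<in> L" for x using sL that by (metis symmetric_set_def image_eqI)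
  have gm: "g \<in> borel_measurable (leb n)" and g0: "\<And>x. x \<in> Rn n \<Longrightarrow> 0 \<le> g x"
    using dens by (auto simp: density_fun_def)
  obtain G where G [measurable]: "G \<in> borel_measurable borel" and G0: "\<And>x. 0 \<le> G x"
    and rep: "AE x in lam n. g x = G x"
    using leb_borel_rep[OF gm g0] by blast
  have gc: "g x powr t * g y powr (1 - t) \<le> g (t *\<^sub>R x + (1 - t) *\<^sub>R y)"
    if "x \<in> Rn n" "y \<in> Rn n" "0 < t" "t < 1" for x y t
  proof -
    have "ennpow (ennreal (g x)) t * ennpow (ennreal (g y)) (1 - t) \<le> ennreal (g (t *\<^sub>R x + (1 - t) *\<^sub>R y))"
      using lc that unfolding log_concave_on_def ennpow_mult_le_iff_elog[OF that(3,4)] by blast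
    then show ?thesis
      using that by (simp add: ennpow_ennreal g0 ennreal_mult[symmetric] ennreal_le_iff Rn_add Rn_scale)
  qed
  \<comment> \<open>The origin is the midpoint of x and -x. The bound makes integrals over compact
    sets finite, although \<open>g\<close> itself may have infinite integral.\<close>
  have g_max: "g x \<le> g 0" if x: "x \<in> Rn n" for x
  proof -
    have "g x powr (1 / 2) * g (- x) powr (1 - 1 / 2) \<le> g ((1 / 2) *\<^sub>R x + (1 - 1 / 2) *\<^sub>R (- x))"
      by (rule gc) (use x in \<open>auto simp: Rn_uminus\<close>)
    moreover have "g (- x) = g x" using even x by (simp add: even_fun_def)
    moreover have "(1 / 2) *\<^sub>R x + (1 - 1 / 2) *\<^sub>R (- x) = 0" by (simp add: fun_eq_iff)
    moreover have "g x powr (1 / 2) * g x powr (1 - 1 / 2) = g x"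
      using g0[OF x] by (cases "g x = 0") (simp_all add: powr_add[symmetric])
    ultimately show ?thesis by simp
  qed
  define C where "C = log_comb n c K L"
  have [measurable]: "C \<in> sets borel" unfolding C_def by (rule log_comb_borel)
  define E where "E S s = {x \<in> S. s \<le> G x}" for S and s :: real
  have Em [measurable (raw)]: "E S s \<in> sets borel" if [measurable]: "S \<in> sets borel" for S s
    unfolding E_def by measurable
  have level_convex: "convex {x \<in> S. s \<le> g x}" if S: "convex S" "S \<subseteq> Rn n" and s: "0 < s" for S s
    unfolding convex_alt
  proof (intro ballI allI impI)
    fix x y and t :: real assume xy: "x \<in> {x \<in> S. s \<le> g x}" "y \<in> {x \<in> S. s \<le> g x}" and t: "0 \<le> t \<and> t \<le> 1"
    have inS: "(1 - t) *\<^sub>R x + t *\<^sub>R y \<in> S" using S(1) xy t by (auto simp: convex_alt)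
    show "(1 - t) *\<^sub>R x + t *\<^sub>R y \<in> {x \<in> S. s \<le> g x}"
    proof (cases "t = 0 \<or> t = 1")
      case False
      have "s = s powr (1 - t) * s powr t" using s by (simp add: powr_add[symmetric])
      also have "\<dots> \<le> g x powr (1 - t) * g y powr t"
        using xy s t by (intro mult_mono powr_mono2) auto
      also have "\<dots> \<le> g ((1 - t) *\<^sub>R x + t *\<^sub>R y)"
        using gc[of x y "1 - t"] xy S(2) t False by auto
      finally show ?thesis using inS by simp
    qed (use xy in auto)
  qed
  have level: "ennreal (measure (lam n) (E K s) powr c * measure (lam n) (E L t) powr (1 - c)) \<le>
      emeasure (lam n) (E C (s powr c * t powr (1 - c)))" if s: "0 < s" and t: "0 < t" for s t
  proof (cases "emeasure (lam n) (E K s) = 0 \<or> emeasure (lam n) (E L t) = 0")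
    case True
    then show ?thesis using c by (auto simp: measure_def)
  next
    case False
    obtain Z where Z: "{x. \<not> g x = G x} \<subseteq> Z" "emeasure (lam n) Z = 0" and [measurable]: "Z \<in> sets borel"
      using AE_E[OF rep] by auto
    have Zn: "Z \<in> null_sets (lam n)" using Z(2) by (auto simp: null_sets_def)
    have diff: "emeasure (lam n) (E S r - Z) = emeasure (lam n) (E S r)" if "S \<in> sets borel" for S r
      using Zn that by (intro emeasure_Diff_null_set) auto
    have m: "measure (lam n) (E S r - Z) = measure (lam n) (E S r)" if "S \<in> sets borel" for S r
      by (simp add: measure_def diff that)
    have "ennreal (measure (lam n) (E K s - Z) powr c * measure (lam n) (E L t - Z) powr (1 - c)) \<le>
      emeasure (lam n) (E C (s powr c * t powr (1 - c)))"
    proof (rule log_comb_measure[OF n hyp K(1,2) L(1,2) c])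
      show "convex {x \<in> K. s \<le> g x}" "convex {x \<in> L. t \<le> g x}"
        by (intro level_convex K L s t)+
      show "- x \<in> {x \<in> K. s \<le> g x}" if "x \<in> {x \<in> K. s \<le> g x}" for x
        using that sK' even K(2) by (auto simp: even_fun_def)
      show "- x \<in> {x \<in> L. t \<le> g x}" if "x \<in> {x \<in> L. t \<le> g x}" for x
        using that sL' even L(2) by (auto simp: even_fun_def)
      show "E K s - Z \<subseteq> {x \<in> K. s \<le> g x}" "E L t - Z \<subseteq> {x \<in> L. t \<le> g x}"
      proof -
        have "g x = G x" if "x \<notin> Z" for x using Z(1) that by blast
        then show "E K s - Z \<subseteq> {x \<in> K. s \<le> g x}" "E L t - Z \<subseteq> {x \<in> L. t \<le> g x}"
          by (auto simp: E_def)
      qed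
      show "0 < emeasure (lam n) (E K s - Z)" "0 < emeasure (lam n) (E L t - Z)"
        using False by (auto simp: diff zero_less_iff_neq_zero)
      show "AE x in lam n. x \<in> log_comb n c K L \<and>
          (\<exists>a\<in>{x \<in> K. s \<le> g x}. \<exists>b\<in>{x \<in> L. t \<le> g x}. x = c *\<^sub>R a + (1 - c) *\<^sub>R b) \<longrightarrow>
          x \<in> E C (s powr c * t powr (1 - c))"
        using rep
      proof eventually_elim
        case (elim x)
        show ?case
        proof (intro impI, elim conjE bexE)
          fix a b assume x: "x \<in> log_comb n c K L" "x = c *\<^sub>R a + (1 - c) *\<^sub>R b"
            and ab: "a \<in> {x \<in> K. s \<le> g x}" "b \<in> {x \<in> L. t \<le> g x}"
          have "s powr c * t powr (1 - c) \<le> g a powr c * g b powr (1 - c)"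
            using ab s t c by (intro mult_mono powr_mono2) auto
          also have "\<dots> \<le> g x" unfolding x(2) by (rule gc) (use ab K(2) L(2) c in auto)
          finally show "x \<in> E C (s powr c * t powr (1 - c))" using x(1) elim by (simp add: E_def C_def)
        qed
      qed
    qed auto
    then show ?thesis by (simp add: m)
  qed
  define I where "I S = (\<integral>\<^sup>+x. ennreal (G x) * indicator S x \<partial>lam n)" for S
  have int: "int_over n g S = I S" if "S \<in> sets borel" for S
    unfolding I_def by (rule int_over_rep[OF G that rep])
  have fin: "I S < \<infinity>" and Efin: "emeasure (lam n) (E S s) < \<infinity>"
    if S: "compact S" "S \<subseteq> Rn n" for S s
  proof -
    have [measurable]: "S \<in> sets borel" using S by (simp add: compact_imp_closed)
    obtain R where R: "S \<subseteq> symbox n (\<lambda>_. R)" using compact_sub_symbox[OF S] by metis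
    have "emeasure (lam n) S \<le> emeasure (lam n) (symbox n (\<lambda>_. \<bar>R\<bar>))"
      using R by (intro emeasure_mono) (auto simp: symbox_def, fastforce)
    also have "\<dots> < \<infinity>" by (subst emeasure_lam_symbox) auto
    finally have S_fin: "emeasure (lam n) S < \<infinity>" .
    have "emeasure (lam n) (E S s) \<le> emeasure (lam n) S" by (intro emeasure_mono) (auto simp: E_def)
    then show "emeasure (lam n) (E S s) < \<infinity>" using S_fin by (rule le_less_trans)
    have "I S \<le> (\<integral>\<^sup>+x. ennreal (g 0) * indicator S x \<partial>lam n)"
      unfolding I_def
    proof (intro nn_integral_mono_AE, use rep AE_lam_Rn in eventually_elim)
      fix x assume "g x = G x" "x \<in> Rn n"
      then have "G x \<le> g 0" using g_max by metis
      then show "ennreal (G x) * indicator S x \<le> ennreal (g 0) * indicator S x"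
        by (intro mult_right_mono ennreal_leI) auto
    qed
    also have "\<dots> < \<infinity>" using S_fin by (simp add: nn_integral_cmult_indicator ennreal_mult_less_top)
    finally show "I S < \<infinity>" .
  qed
  \<comment> \<open>The integrand of the layer formula as a real function. The factor exp \<sigma>
    turns geometric means into means of \<sigma> with equality, so it passes through the level
    inequality unchanged.\<close>
  define P where "P S \<sigma> = exp \<sigma> * measure (lam n) (E S (exp \<sigma>))" for S \<sigma>
  have P0: "0 \<le> P S \<sigma>" for S \<sigma> by (simp add: P_def)
  have P_eq: "ennreal (P S \<sigma>) = ennreal (exp \<sigma>) * emeasure (lam n) (E S (exp \<sigma>))"
    if "compact S" "S \<subseteq> Rn n" for S \<sigma>
    using Efin[OF that] by (simp add: P_def ennreal_mult emeasure_eq_ennreal_measure less_top)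
  have layer_meas: "(\<lambda>\<sigma>. ennreal (exp \<sigma>) * emeasure (lam n) (E S (exp \<sigma>))) \<in> borel_measurable borel"
    if [measurable]: "S \<in> sets borel" for S
  proof -
    interpret lam: sigma_finite_measure "lam n" by (rule sigma_finite_lam)
    have "emeasure (lam n) (E S (exp \<sigma>)) = (\<integral>\<^sup>+x. indicator {x \<in> S. exp \<sigma> \<le> G x} x \<partial>lam n)" for \<sigma>
      unfolding E_def by (rule nn_integral_indicator[symmetric]) measurable
    then show ?thesis by simp
  qed
  have P_meas: "P S \<in> borel_measurable borel" if "compact S" "S \<subseteq> Rn n" for S
  proof -
    have S: "S \<in> sets borel" using that by (simp add: compact_imp_closed)
    have "(\<lambda>\<sigma>. enn2real (ennreal (P S \<sigma>))) \<in> borel_measurable borel"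
      unfolding P_eq[OF that] by (rule borel_measurable_enn2real[OF layer_meas[OF S]])
    then show ?thesis by (simp add: P0)
  qed
  have P_int: "(\<integral>\<^sup>+\<sigma>. ennreal (P S \<sigma>) \<partial>lborel) = ennreal (enn2real (I S))" if S: "compact S" "S \<subseteq> Rn n" for S
  proof -
    have [measurable]: "S \<in> sets borel" using S by (simp add: compact_imp_closed)
    have "(\<integral>\<^sup>+\<sigma>. ennreal (P S \<sigma>) \<partial>lborel) = I S"
      unfolding P_eq[OF S] E_def I_def by (rule nn_integral_exp_layers) (auto simp: G0)
    then show ?thesis using fin[OF S] by simp
  qed
  \<comment> \<open>Markov inequality, for the boundedness that \<open>prekopa_leindler_1d\<close>
    asks for.\<close>
  have P_bdd: "bdd_above (range (P S))" if S: "compact S" "S \<subseteq> Rn n" for S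
  proof (rule bdd_aboveI2)
    fix \<sigma>
    have [measurable]: "S \<in> sets borel" using S by (simp add: compact_imp_closed)
    have "ennreal (P S \<sigma>) = (\<integral>\<^sup>+x. ennreal (exp \<sigma>) * indicator (E S (exp \<sigma>)) x \<partial>lam n)"
      unfolding P_eq[OF S] by (simp add: nn_integral_cmult_indicator)
    also have "\<dots> \<le> I S" unfolding I_def
      by (intro nn_integral_mono) (auto simp: E_def indicator_def intro: ennreal_leI)
    finally have "ennreal (P S \<sigma>) \<le> ennreal (enn2real (I S))" using fin[OF S] by simp
    then show "P S \<sigma> \<le> enn2real (I S)" by (simp add: ennreal_le_iff)
  qed
  have "ennreal (enn2real (I K) powr c * enn2real (I L) powr (1 - c)) \<le>
    (\<integral>\<^sup>+\<sigma>. ennreal (exp \<sigma>) * emeasure (lam n) (E C (exp \<sigma>)) \<partial>lborel)"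
  proof (rule prekopa_leindler_1d[of "P K" "P L"])
    fix \<sigma> \<tau>
    have e: "exp (c * \<sigma> + (1 - c) * \<tau>) = exp \<sigma> powr c * exp \<tau> powr (1 - c)"
      by (simp add: powr_def exp_add)
    have "P K \<sigma> powr c * P L \<tau> powr (1 - c) = (exp \<sigma> powr c * exp \<tau> powr (1 - c)) *
        (measure (lam n) (E K (exp \<sigma>)) powr c * measure (lam n) (E L (exp \<tau>)) powr (1 - c))"
      by (simp add: P_def powr_mult)
    then have "ennreal (P K \<sigma> powr c * P L \<tau> powr (1 - c)) = ennreal (exp \<sigma> powr c * exp \<tau> powr (1 - c)) *
        ennreal (measure (lam n) (E K (exp \<sigma>)) powr c * measure (lam n) (E L (exp \<tau>)) powr (1 - c))"
      by (simp add: ennreal_mult[symmetric])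
    also have "\<dots> \<le> ennreal (exp \<sigma> powr c * exp \<tau> powr (1 - c)) *
        emeasure (lam n) (E C (exp \<sigma> powr c * exp \<tau> powr (1 - c)))"
      by (intro mult_left_mono level) auto
    finally show "ennreal (P K \<sigma> powr c * P L \<tau> powr (1 - c)) \<le>
       ennreal (exp (c * \<sigma> + (1 - c) * \<tau>)) * emeasure (lam n) (E C (exp (c * \<sigma> + (1 - c) * \<tau>)))"
      by (simp only: e)
  qed (auto intro!: P_meas P_bdd P_int layer_meas K L c simp: P0)
  also have "\<dots> = I C" unfolding E_def I_def by (rule nn_integral_exp_layers) (auto simp: G0)
  finally have main: "ennreal (enn2real (I K) powr c * enn2real (I L) powr (1 - c)) \<le> I C" .
  have "ennpow (I S) t = ennreal (enn2real (I S) powr t)" if "compact S" "S \<subseteq> Rn n" for S t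
    using fin[OF that] by (auto simp: ennpow_def)
  then show "log_BM_for n g c K L"
    using main K L by (simp add: log_BM_for_def int C_def[symmetric] ennreal_mult[symmetric])
qed

text \<open>The first two claims differ only in how \<open>box_ineq\<close> is obtained in each
  dimension. The third obtains it from the log-Brunn-Minkowski inequality and reads
  \<open>diag_log_concave_iff_box_ineq\<close> in the other direction.\<close>

theorem theorem5p1:
  shows
    "((\<forall>n\<ge>1. \<exists>f. density_fun n f \<and> even_fun n f \<and> integrable_on_all_subspaces n f \<and>
          diag_log_concave n f) \<longrightarrow>
        (\<forall>n\<ge>1. \<forall>g. density_fun n g \<and> even_fun n g \<and>
          log_concave_on (Rn n) (\<lambda>x. ennreal (g x)) \<longrightarrow> log_BM n g)) \<and>
     ((\<forall>n\<ge>1. \<exists>f. density_fun n f \<and> even_fun n f \<and> integrable_on_all_subspaces n f \<and>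
          log_BM_parallelepipeds n f) \<longrightarrow>
        (\<forall>n\<ge>1. \<forall>g. density_fun n g \<and> even_fun n g \<and>
          log_concave_on (Rn n) (\<lambda>x. ennreal (g x)) \<longrightarrow> log_BM n g)) \<and>
     (\<forall>n\<ge>1. \<forall>f. density_fun n f \<and> log_BM n f \<longrightarrow> diag_log_concave n f)"
proof (intro conjI impI allI; (elim conjE)?)
  fix n :: nat and g :: "(nat \<Rightarrow> real) \<Rightarrow> real"
  assume H: "\<forall>n\<ge>1. \<exists>f. density_fun n f \<and> even_fun n f \<and> integrable_on_all_subspaces n f \<and> diag_log_concave n f"
    and g: "1 \<le> n" "density_fun n g" "even_fun n g" "log_concave_on (Rn n) (\<lambda>x. ennreal (g x))"
  have "\<exists>f. density_fun N f \<and> integrable_on_all_subspaces N f \<and> box_ineq N f" if "1 \<le> N" for N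
    using H that diag_log_concave_iff_box_ineq by blast
  then show "log_BM n g" by (rule log_BM_log_concave) (use g in auto)
next
  fix n :: nat and g :: "(nat \<Rightarrow> real) \<Rightarrow> real"
  assume H: "\<forall>n\<ge>1. \<exists>f. density_fun n f \<and> even_fun n f \<and> integrable_on_all_subspaces n f \<and> log_BM_parallelepipeds n f"
    and g: "1 \<le> n" "density_fun n g" "even_fun n g" "log_concave_on (Rn n) (\<lambda>x. ennreal (g x))"
  have "\<exists>f. density_fun N f \<and> integrable_on_all_subspaces N f \<and> box_ineq N f" if "1 \<le> N" for N
    using H that log_BM_parallelepipeds_imp_box_ineq by blast
  then show "log_BM n g" by (rule log_BM_log_concave) (use g in auto)
next
  fix n :: nat and f :: "(nat \<Rightarrow> real) \<Rightarrow> real"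
  assume "density_fun n f" "log_BM n f"
  then show "diag_log_concave n f"
    by (simp add: diag_log_concave_iff_box_ineq log_BM_imp_box_ineq)
qed

end
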